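(* Let $F:\mathcal{C}\to\mathcal{D}$ be a dg functor between dg categories over $\mathbf{k}$ with the same collection of objects, acting identically on objects, such that, disregarding differentials, $\mathcal{D}$ is freely generated over $\mathcal{C}$ by a collection of morphisms $s_\alpha$, $\alpha\in I$. Assume moreover that $\mathcal{D}$ is cofibrant over $\mathcal{C}$ in the following sense: each generator $s_\alpha$ is assigned a weight, a natural number, so that $d(s_\alpha)$ is a sum of elements of strictly smaller weight, where the weight of $\mathcal{C}$ is taken to be zero. Then the $\mathcal{C}$-relative cylinder $C_{\mathcal{C}}(\mathcal{D})$ is a good cylinder object for $\mathcal{D}$ in $\mathcal{C}\downarrow\mathrm{dgCat}$.
   Context: Fix a commutative ring $\mathbf{k}$. Dg modules are homologically graded (the differential lowers degree by one). A dg category is a category enriched over dg $\mathbf{k}$-modules. $\mathrm{dgCat}$ is the category of dg categories and dg functors with Tabuada's model structure, whose weak equivalences are the quasi-equivalences. All dg categories are assumed flat over $\mathbf{k}$. $\mathcal{C}\downarrow\mathrm{dgCat}$ is the category of dg categories equipped with a dg functor from $\mathcal{C}$ (maps are commutative triangles), with the induced model structure. A good cylinder object for $\mathcal{D}$ in $\mathcal{C}\downarrow\mathrm{dgCat}$ is a factorization of the codiagonal $\mathcal{D}\coprod_{\mathcal{C}}\mathcal{D}\to\mathcal{D}$ as a cofibration followed by a weak equivalence. The weight of a composite of generators and morphisms of $\mathcal{C}$ is the sum of the weights of its factors. Derivations: for dg functors $F,G:\mathcal{C}_1\to\mathcal{C}_2$ agreeing on objects, an $(F,G)$-derivation $f$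 is a homogeneous $\mathbf{k}$-linear assignment sending a morphism $x:c\to c'$ of $\mathcal{C}_1$ to a morphism $f(x)$ of $\mathcal{C}_2$ between the images of $c$ and $c'$, with $f(x_1x_2)=f(x_1)G(x_2)+(-1)^{|f||x_1|}F(x_1)f(x_2)$. Relative cylinder: let $\mathcal{D}_1,\mathcal{D}_2$ be two copies of $\mathcal{D}$, and for a morphism $s$ of $\mathcal{D}$ write $s^1,s^2$ for its two images in $\mathcal{D}_1\coprod_{\mathcal{C}}\mathcal{D}_2$. As a graded category, $C_{\mathcal{C}}(\mathcal{D})$ is freely generated over $\mathcal{D}_1\coprod_{\mathcal{C}}\mathcal{D}_2$ by morphisms $\bar{s}_\alpha:d\to d'$, one for each generator $s_\alpha:d\to d'$ of $\mathcal{D}$, with $|\bar{s}_\alpha|=|s_\alpha|+1$. Let $i_1,i_2:\mathcal{D}\to C_{\mathcal{C}}(\mathcal{D})$ be the two inclusions and let $f$ be the degree $1$ $(i_1,i_2)$-derivation of $\mathcal{D}$ with values in $C_{\mathcal{C}}(\mathcal{D})$ which vanishes on $\mathcal{C}$ and satisfies $f(s_\alpha)=\bar{s}_\alpha$. The differential on $C_{\mathcal{C}}(\mathcal{D})$ is determined by requiring that $\mathcal{D}_1,\mathcal{D}_2$ be dg subcategories and $d(\bar{s}_\alpha)=s_\alpha^1-s_\alpha^2-f(ds_\alpha)$. The dg functor $C_{\mathcal{C}}(\mathcal{D})\to\mathcal{D}$ maps $\mathcal{D}_1,\mathcal{D}_2$ identically to $\mathcal{D}$ and each $\bar{s}_\alpha$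 to $0$; together with the inclusion $\mathcal{D}\coprod_{\mathcal{C}}\mathcal{D}\to C_{\mathcal{C}}(\mathcal{D})$ it factors the codiagonal. *)

theory Defs
  imports "HOL-Algebra.Module" "HOL-Algebra.Ideal"
begin

section \<open>Graded and dg categories\<close>

text \<open>
  Only homogeneous morphisms are represented: a graded \<open>k\<close>-module is a family of \<open>k\<close>-modules
  indexed by the degree.  Morphisms carry their source, target and degree, so the modules
  \<open>Hom C x y n\<close> are pairwise disjoint (in particular each has its own zero), and \<open>Cmp C g f\<close> is the
  composite of \<open>f\<close> followed by \<open>g\<close>.  Operations are meaningful only on composable, respectively
  parallel, arguments.
\<close>

record ('a, 'o, 'm) grcat =
  Obj :: "'o set"
  Mor :: "'m set"
  Dom :: "'m \<Rightarrow> 'o"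
  Cod :: "'m \<Rightarrow> 'o"
  Deg :: "'m \<Rightarrow> int"
  Ide :: "'o \<Rightarrow> 'm"
  Cmp :: "'m \<Rightarrow> 'm \<Rightarrow> 'm"
  Zer :: "'o \<Rightarrow> 'o \<Rightarrow> int \<Rightarrow> 'm"
  Add :: "'m \<Rightarrow> 'm \<Rightarrow> 'm"
  Scal :: "'a \<Rightarrow> 'm \<Rightarrow> 'm"

record ('a, 'o, 'm) dgcat = "('a, 'o, 'm) grcat" +
  Diff :: "'m \<Rightarrow> 'm"

definition Hom :: "('a, 'o, 'm, 'z) grcat_scheme \<Rightarrow> 'o \<Rightarrow> 'o \<Rightarrow> int \<Rightarrow> 'm set" where
  "Hom C x y n = {f \<in> Mor C. Dom C f = x \<and> Cod C f = y \<and> Deg C f = n}"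

text \<open>The multiplicative fields below are irrelevant: \<^locale>\<open>module\<close> does not constrain them.\<close>

definition hom_module ::
    "('a, 'o, 'm, 'z) grcat_scheme \<Rightarrow> 'o \<Rightarrow> 'o \<Rightarrow> int \<Rightarrow> ('a, 'm) module" where
  "hom_module C x y n =
     \<lparr>carrier = Hom C x y n, monoid.mult = (\<lambda>f g. Zer C x y n), one = Zer C x y n,
      ring.zero = Zer C x y n, ring.add = Add C, smult = Scal C\<rparr>"

definition Sub :: "'a ring \<Rightarrow> ('a, 'o, 'm, 'z) grcat_scheme \<Rightarrow> 'm \<Rightarrow> 'm \<Rightarrow> 'm" where
  "Sub R C f g = Add C f (Scal C (\<ominus>\<^bsub>R\<^esub> \<one>\<^bsub>R\<^esub>) g)"

definition sgn_unit :: "'a ring \<Rightarrow> int \<Rightarrow> 'a" where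
  "sgn_unit R n = (if even n then \<one>\<^bsub>R\<^esub> else \<ominus>\<^bsub>R\<^esub> \<one>\<^bsub>R\<^esub>)"

locale graded_category =
  fixes R :: "'a ring" and C :: "('a, 'o, 'm, 'z) grcat_scheme"
  assumes base: "cring R"
    and Dom_closed: "f \<in> Mor C \<Longrightarrow> Dom C f \<in> Obj C"
    and Cod_closed: "f \<in> Mor C \<Longrightarrow> Cod C f \<in> Obj C"
    and hom_module: "x \<in> Obj C \<Longrightarrow> y \<in> Obj C \<Longrightarrow> module R (hom_module C x y n)"
    and Ide_closed: "x \<in> Obj C \<Longrightarrow> Ide C x \<in> Hom C x x 0"
    and Cmp_closed: "g \<in> Hom C y z m \<Longrightarrow> f \<in> Hom C x y n \<Longrightarrow> Cmp C g f \<in> Hom C x z (m + n)"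
    and Cmp_assoc: "h \<in> Hom C y z l \<Longrightarrow> g \<in> Hom C x y m \<Longrightarrow> f \<in> Hom C v x n \<Longrightarrow>
      Cmp C (Cmp C h g) f = Cmp C h (Cmp C g f)"
    and Ide_left: "f \<in> Hom C x y n \<Longrightarrow> Cmp C (Ide C y) f = f"
    and Ide_right: "f \<in> Hom C x y n \<Longrightarrow> Cmp C f (Ide C x) = f"
    and Cmp_Add_left: "g \<in> Hom C y z m \<Longrightarrow> g' \<in> Hom C y z m \<Longrightarrow> f \<in> Hom C x y n \<Longrightarrow>
      Cmp C (Add C g g') f = Add C (Cmp C g f) (Cmp C g' f)"
    and Cmp_Add_right: "g \<in> Hom C y z m \<Longrightarrow> f \<in> Hom C x y n \<Longrightarrow> f' \<in> Hom C x y n \<Longrightarrow>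
      Cmp C g (Add C f f') = Add C (Cmp C g f) (Cmp C g f')"
    and Cmp_Scal_left: "a \<in> carrier R \<Longrightarrow> g \<in> Hom C y z m \<Longrightarrow> f \<in> Hom C x y n \<Longrightarrow>
      Cmp C (Scal C a g) f = Scal C a (Cmp C g f)"
    and Cmp_Scal_right: "a \<in> carrier R \<Longrightarrow> g \<in> Hom C y z m \<Longrightarrow> f \<in> Hom C x y n \<Longrightarrow>
      Cmp C g (Scal C a f) = Scal C a (Cmp C g f)"

record ('o, 'm, 'p, 'n) dgfun =
  Omap :: "'o \<Rightarrow> 'p"
  Mmap :: "'m \<Rightarrow> 'n"

definition id_fun :: "('o, 'm, 'o, 'm) dgfun" where
  "id_fun = \<lparr>Omap = (\<lambda>x. x), Mmap = (\<lambda>f. f)\<rparr>"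

definition comp_fun ::
    "('p, 'n, 'q, 'l) dgfun \<Rightarrow> ('o, 'm, 'p, 'n) dgfun \<Rightarrow> ('o, 'm, 'q, 'l) dgfun" where
  "comp_fun G F = \<lparr>Omap = (\<lambda>x. Omap G (Omap F x)), Mmap = (\<lambda>f. Mmap G (Mmap F f))\<rparr>"

definition eq_fun ::
    "('a, 'o, 'm, 'z) grcat_scheme \<Rightarrow> ('o, 'm, 'p, 'n) dgfun \<Rightarrow> ('o, 'm, 'p, 'n) dgfun \<Rightarrow> bool"
  where
  "eq_fun C F G \<longleftrightarrow>
     (\<forall>x\<in>Obj C. Omap F x = Omap G x) \<and> (\<forall>f\<in>Mor C. Mmap F f = Mmap G f)"

text \<open>\<open>(F,G)\<close>-derivations of degree \<open>p\<close>, for \<open>F\<close> and \<open>G\<close> agreeing on objects.\<close>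

definition derivation ::
    "'a ring \<Rightarrow> ('a, 'o, 'm, 'z) grcat_scheme \<Rightarrow> ('a, 'p, 'n, 'y) grcat_scheme \<Rightarrow>
     ('o, 'm, 'p, 'n) dgfun \<Rightarrow> ('o, 'm, 'p, 'n) dgfun \<Rightarrow> int \<Rightarrow> ('m \<Rightarrow> 'n) \<Rightarrow> bool" where
  "derivation R A B F G p f \<longleftrightarrow>
     (\<forall>x y n. \<forall>t\<in>Hom A x y n. f t \<in> Hom B (Omap F x) (Omap F y) (n + p)) \<and>
     (\<forall>x y n. \<forall>t\<in>Hom A x y n. \<forall>u\<in>Hom A x y n. f (Add A t u) = Add B (f t) (f u)) \<and>
     (\<forall>a\<in>carrier R. \<forall>t\<in>Mor A. f (Scal A a t) = Scal B a (f t)) \<and>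
     (\<forall>t\<in>Mor A. \<forall>u\<in>Mor A. Dom A t = Cod A u \<longrightarrow>
        f (Cmp A t u) =
          Add B (Cmp B (f t) (Mmap G u))
                (Scal B (sgn_unit R (p * Deg A t)) (Cmp B (Mmap F t) (f u))))"

definition the_derivation ::
    "'a ring \<Rightarrow> ('a, 'o, 'm, 'z) grcat_scheme \<Rightarrow> ('a, 'p, 'n, 'y) grcat_scheme \<Rightarrow>
     ('o, 'm, 'p, 'n) dgfun \<Rightarrow> ('o, 'm, 'p, 'n) dgfun \<Rightarrow> int \<Rightarrow> (('m \<Rightarrow> 'n) \<Rightarrow> bool) \<Rightarrow> 'm \<Rightarrow> 'n"
  where
  "the_derivation R A B F G p Q =
     (THE f. f \<in> extensional (Mor A) \<and> derivation R A B F G p f \<and> Q f)"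

locale dg_category = graded_category R C
  for R :: "'a ring" and C :: "('a, 'o, 'm, 'z) dgcat_scheme" +
  assumes Diff_derivation: "derivation R C C id_fun id_fun (- 1) (Diff C)"
    and Diff_Diff: "f \<in> Hom C x y n \<Longrightarrow> Diff C (Diff C f) = Zer C x y (n - 2)"

locale dg_functor = dom: dg_category R C + cod: dg_category R D
  for R :: "'a ring"
    and C :: "('a, 'o, 'm, 'z) dgcat_scheme"
    and D :: "('a, 'p, 'n, 'y) dgcat_scheme" +
  fixes F :: "('o, 'm, 'p, 'n) dgfun"
  assumes Omap_closed: "x \<in> Obj C \<Longrightarrow> Omap F x \<in> Obj D"
    and Mmap_closed: "f \<in> Hom C x y n \<Longrightarrow> Mmap F f \<in> Hom D (Omap F x) (Omap F y) n"
    and Mmap_Ide: "x \<in> Obj C \<Longrightarrow> Mmap F (Ide C x) = Ide D (Omap F x)"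
    and Mmap_Cmp: "g \<in> Hom C y z m \<Longrightarrow> f \<in> Hom C x y n \<Longrightarrow>
      Mmap F (Cmp C g f) = Cmp D (Mmap F g) (Mmap F f)"
    and Mmap_Add: "f \<in> Hom C x y n \<Longrightarrow> g \<in> Hom C x y n \<Longrightarrow>
      Mmap F (Add C f g) = Add D (Mmap F f) (Mmap F g)"
    and Mmap_Scal: "a \<in> carrier R \<Longrightarrow> f \<in> Mor C \<Longrightarrow> Mmap F (Scal C a f) = Scal D a (Mmap F f)"
    and Mmap_Diff: "f \<in> Mor C \<Longrightarrow> Mmap F (Diff C f) = Diff D (Mmap F f)"


section \<open>Flatness\<close>

text \<open>
  Elements of \<open>N \<otimes> M\<close> are represented by formal sums of pure tensors, that is by lists of pairs;
  \<open>tensor_eq R N M\<close> is equality in \<open>N \<otimes> M\<close>.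
\<close>

inductive tensor_eq ::
    "'a ring \<Rightarrow> ('a, 'n) module \<Rightarrow> ('a, 'm) module \<Rightarrow> ('n \<times> 'm) list \<Rightarrow> ('n \<times> 'm) list \<Rightarrow> bool"
  for R N M where
  refl: "set l \<subseteq> carrier N \<times> carrier M \<Longrightarrow> tensor_eq R N M l l"
| sym: "tensor_eq R N M l l' \<Longrightarrow> tensor_eq R N M l' l"
| trans: "tensor_eq R N M l l' \<Longrightarrow> tensor_eq R N M l' l'' \<Longrightarrow> tensor_eq R N M l l''"
| append: "tensor_eq R N M l l' \<Longrightarrow> tensor_eq R N M k k' \<Longrightarrow> tensor_eq R N M (l @ k) (l' @ k')"
| swap: "set l \<subseteq> carrier N \<times> carrier M \<Longrightarrow> set k \<subseteq> carrier N \<times> carrier M \<Longrightarrow>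
    tensor_eq R N M (l @ k) (k @ l)"
| zero: "x \<in> carrier M \<Longrightarrow> tensor_eq R N M [(\<zero>\<^bsub>N\<^esub>, x)] []"
| add_left: "i \<in> carrier N \<Longrightarrow> j \<in> carrier N \<Longrightarrow> x \<in> carrier M \<Longrightarrow>
    tensor_eq R N M [(i \<oplus>\<^bsub>N\<^esub> j, x)] [(i, x), (j, x)]"
| add_right: "i \<in> carrier N \<Longrightarrow> x \<in> carrier M \<Longrightarrow> y \<in> carrier M \<Longrightarrow>
    tensor_eq R N M [(i, x \<oplus>\<^bsub>M\<^esub> y)] [(i, x), (i, y)]"
| balanced: "a \<in> carrier R \<Longrightarrow> i \<in> carrier N \<Longrightarrow> x \<in> carrier M \<Longrightarrow>
    tensor_eq R N M [(a \<odot>\<^bsub>N\<^esub> i, x)] [(i, a \<odot>\<^bsub>M\<^esub> x)]"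

definition ideal_module :: "'a ring \<Rightarrow> 'a set \<Rightarrow> ('a, 'a) module" where
  "ideal_module R J =
     \<lparr>carrier = J, monoid.mult = monoid.mult R, one = \<one>\<^bsub>R\<^esub>, ring.zero = \<zero>\<^bsub>R\<^esub>,
      ring.add = ring.add R, smult = monoid.mult R\<rparr>"

definition action_sum :: "('a, 'm) module \<Rightarrow> ('a \<times> 'm) list \<Rightarrow> 'm" where
  "action_sum M l = foldr (\<lambda>(a, x) y. (a \<odot>\<^bsub>M\<^esub> x) \<oplus>\<^bsub>M\<^esub> y) l \<zero>\<^bsub>M\<^esub>"

text \<open>
  \<open>M\<close> is flat if \<open>J \<otimes> M \<rightarrow> M\<close> is injective for every ideal \<open>J\<close>; testing on ideals avoids
  quantifying over the carrier types of all modules.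
\<close>

definition flat_module :: "'a ring \<Rightarrow> ('a, 'm) module \<Rightarrow> bool" where
  "flat_module R M \<longleftrightarrow>
     (\<forall>J. ideal J R \<longrightarrow>
        (\<forall>l. set l \<subseteq> J \<times> carrier M \<longrightarrow> action_sum M l = \<zero>\<^bsub>M\<^esub> \<longrightarrow>
             tensor_eq R (ideal_module R J) M l []))"

definition flat_category :: "'a ring \<Rightarrow> ('a, 'o, 'm, 'z) grcat_scheme \<Rightarrow> bool" where
  "flat_category R C \<longleftrightarrow> (\<forall>x\<in>Obj C. \<forall>y\<in>Obj C. \<forall>n. flat_module R (hom_module C x y n))"


section \<open>Tabuada's model structure\<close>

definition cycles :: "('a, 'o, 'm, 'z) dgcat_scheme \<Rightarrow> 'o \<Rightarrow> 'o \<Rightarrow> int \<Rightarrow> 'm set" where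
  "cycles C x y n = {f \<in> Hom C x y n. Diff C f = Zer C x y (n - 1)}"

definition homologous ::
    "('a, 'o, 'm, 'z) dgcat_scheme \<Rightarrow> 'o \<Rightarrow> 'o \<Rightarrow> int \<Rightarrow> ('m \<times> 'm) set" where
  "homologous C x y n =
     {(f, g). f \<in> cycles C x y n \<and> g \<in> cycles C x y n \<and>
              (\<exists>b\<in>Hom C x y (n + 1). f = Add C g (Diff C b))}"

definition homology :: "('a, 'o, 'm, 'z) dgcat_scheme \<Rightarrow> 'o \<Rightarrow> 'o \<Rightarrow> int \<Rightarrow> 'm set set" where
  "homology C x y n = cycles C x y n // homologous C x y n"

definition homology_map ::
    "('a, 'p, 'n, 'z) dgcat_scheme \<Rightarrow> ('o, 'm, 'p, 'n) dgfun \<Rightarrow> 'o \<Rightarrow> 'o \<Rightarrow> int \<Rightarrow>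
     'm set \<Rightarrow> 'n set" where
  "homology_map D F x y n X = homologous D (Omap F x) (Omap F y) n `` (Mmap F ` X)"

text \<open>Cycles of degree \<open>0\<close> representing isomorphisms of the homotopy category \<open>H\<^sub>0\<close>.\<close>

definition homotopy_iso :: "('a, 'o, 'm, 'z) dgcat_scheme \<Rightarrow> 'o \<Rightarrow> 'o \<Rightarrow> 'm \<Rightarrow> bool" where
  "homotopy_iso C x y f \<longleftrightarrow>
     f \<in> cycles C x y 0 \<and>
     (\<exists>g\<in>cycles C y x 0. (Cmp C g f, Ide C x) \<in> homologous C x x 0 \<and>
                        (Cmp C f g, Ide C y) \<in> homologous C y y 0)"

definition quasi_equivalence ::
    "'a ring \<Rightarrow> ('a, 'o, 'm, 'z) dgcat_scheme \<Rightarrow> ('a, 'p, 'n, 'y) dgcat_scheme \<Rightarrow>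
     ('o, 'm, 'p, 'n) dgfun \<Rightarrow> bool" where
  "quasi_equivalence R C D F \<longleftrightarrow>
     dg_functor R C D F \<and>
     (\<forall>x\<in>Obj C. \<forall>y\<in>Obj C. \<forall>n.
        bij_betw (homology_map D F x y n)
          (homology C x y n) (homology D (Omap F x) (Omap F y) n)) \<and>
     (\<forall>y\<in>Obj D. \<exists>x\<in>Obj C. \<exists>f. homotopy_iso D (Omap F x) y f)"

definition fibration ::
    "'a ring \<Rightarrow> ('a, 'o, 'm, 'z) dgcat_scheme \<Rightarrow> ('a, 'p, 'n, 'y) dgcat_scheme \<Rightarrow>
     ('o, 'm, 'p, 'n) dgfun \<Rightarrow> bool" where
  "fibration R C D F \<longleftrightarrow>
     dg_functor R C D F \<and>
     (\<forall>x\<in>Obj C. \<forall>y\<in>Obj C. \<forall>n.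
        Mmap F ` Hom C x y n = Hom D (Omap F x) (Omap F y) n) \<and>
     (\<forall>x\<in>Obj C. \<forall>z\<in>Obj D. \<forall>v. homotopy_iso D (Omap F x) z v \<longrightarrow>
        (\<exists>y\<in>Obj C. \<exists>u. Omap F y = z \<and> homotopy_iso C x y u \<and>
                       (Mmap F u, v) \<in> homologous D (Omap F x) z 0))"

definition left_lifting ::
    "'a ring \<Rightarrow> ('a, 'o, 'm, 'z) dgcat_scheme \<Rightarrow> ('a, 'p, 'n, 'y) dgcat_scheme \<Rightarrow>
     ('o, 'm, 'p, 'n) dgfun \<Rightarrow> ('a, 'q, 'k) dgcat \<Rightarrow> ('a, 'r, 'l) dgcat \<Rightarrow>
     ('q, 'k, 'r, 'l) dgfun \<Rightarrow> bool" where
  "left_lifting R C D i A B p \<longleftrightarrow>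
     (\<forall>u v. dg_functor R C A u \<longrightarrow> dg_functor R D B v \<longrightarrow>
        eq_fun C (comp_fun p u) (comp_fun v i) \<longrightarrow>
        (\<exists>h. dg_functor R D A h \<and> eq_fun C (comp_fun h i) u \<and> eq_fun D (comp_fun p h) v))"

text \<open>
  Cofibrations are the dg functors with the left lifting property against all trivial fibrations
  \<open>A \<rightarrow> B\<close>.  The types carrying \<open>A\<close> and \<open>B\<close> are a parameter of the definition; a statement that some
  functor is a cofibration has to be read for arbitrary, i.e. universally quantified, \<open>'q\<close>, \<open>'k\<close>,
  \<open>'r\<close> and \<open>'l\<close>.
\<close>

definition cofibration ::
    "('q \<times> 'k \<times> 'r \<times> 'l) itself \<Rightarrow> 'a ring \<Rightarrow> ('a, 'o, 'm, 'z) dgcat_scheme \<Rightarrow>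
     ('a, 'p, 'n, 'y) dgcat_scheme \<Rightarrow> ('o, 'm, 'p, 'n) dgfun \<Rightarrow> bool" where
  "cofibration T R C D i \<longleftrightarrow>
     dg_functor R C D i \<and>
     (\<forall>(A :: ('a, 'q, 'k) dgcat) (B :: ('a, 'r, 'l) dgcat) p.
        fibration R A B p \<longrightarrow> quasi_equivalence R A B p \<longrightarrow> left_lifting R C D i A B p)"


section \<open>Graded categories given by generators and relations\<close>

record ('o, 'g) quiver =
  Vert :: "'o set"
  Arr :: "'g set"
  Src :: "'g \<Rightarrow> 'o"
  Tgt :: "'g \<Rightarrow> 'o"
  Dg :: "'g \<Rightarrow> int"

datatype ('a, 'o, 'g) gterm =
    TGen 'g
  | TId 'o
  | TZero 'o 'o int
  | TAdd "('a, 'o, 'g) gterm" "('a, 'o, 'g) gterm"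
  | TScal 'a "('a, 'o, 'g) gterm"
  | TComp "('a, 'o, 'g) gterm" "('a, 'o, 'g) gterm"

primrec tdom :: "('o, 'g) quiver \<Rightarrow> ('a, 'o, 'g) gterm \<Rightarrow> 'o" where
  "tdom Q (TGen g) = Src Q g"
| "tdom Q (TId x) = x"
| "tdom Q (TZero x y n) = x"
| "tdom Q (TAdd t u) = tdom Q t"
| "tdom Q (TScal a t) = tdom Q t"
| "tdom Q (TComp t u) = tdom Q u"

primrec tcod :: "('o, 'g) quiver \<Rightarrow> ('a, 'o, 'g) gterm \<Rightarrow> 'o" where
  "tcod Q (TGen g) = Tgt Q g"
| "tcod Q (TId x) = x"
| "tcod Q (TZero x y n) = y"
| "tcod Q (TAdd t u) = tcod Q t"
| "tcod Q (TScal a t) = tcod Q t"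
| "tcod Q (TComp t u) = tcod Q t"

primrec tdeg :: "('o, 'g) quiver \<Rightarrow> ('a, 'o, 'g) gterm \<Rightarrow> int" where
  "tdeg Q (TGen g) = Dg Q g"
| "tdeg Q (TId x) = 0"
| "tdeg Q (TZero x y n) = n"
| "tdeg Q (TAdd t u) = tdeg Q t"
| "tdeg Q (TScal a t) = tdeg Q t"
| "tdeg Q (TComp t u) = tdeg Q t + tdeg Q u"

definition parallel ::
    "('o, 'g) quiver \<Rightarrow> ('a, 'o, 'g) gterm \<Rightarrow> ('a, 'o, 'g) gterm \<Rightarrow> bool" where
  "parallel Q t u \<longleftrightarrow> tdom Q t = tdom Q u \<and> tcod Q t = tcod Q u \<and> tdeg Q t = tdeg Q u"

primrec wf_term :: "'a ring \<Rightarrow> ('o, 'g) quiver \<Rightarrow> ('a, 'o, 'g) gterm \<Rightarrow> bool" where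
  "wf_term R Q (TGen g) \<longleftrightarrow> g \<in> Arr Q"
| "wf_term R Q (TId x) \<longleftrightarrow> x \<in> Vert Q"
| "wf_term R Q (TZero x y n) \<longleftrightarrow> x \<in> Vert Q \<and> y \<in> Vert Q"
| "wf_term R Q (TAdd t u) \<longleftrightarrow> wf_term R Q t \<and> wf_term R Q u \<and> parallel Q t u"
| "wf_term R Q (TScal a t) \<longleftrightarrow> a \<in> carrier R \<and> wf_term R Q t"
| "wf_term R Q (TComp t u) \<longleftrightarrow> wf_term R Q t \<and> wf_term R Q u \<and> tdom Q t = tcod Q u"

text \<open>The smallest congruence containing \<open>E\<close> and the axioms of \<open>k\<close>-linear graded categories.\<close>

inductive tcong ::
    "'a ring \<Rightarrow> ('o, 'g) quiver \<Rightarrow> (('a, 'o, 'g) gterm \<times> ('a, 'o, 'g) gterm) set \<Rightarrow>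
     ('a, 'o, 'g) gterm \<Rightarrow> ('a, 'o, 'g) gterm \<Rightarrow> bool"
  for R Q E where
  rel: "(t, u) \<in> E \<Longrightarrow> wf_term R Q t \<Longrightarrow> wf_term R Q u \<Longrightarrow> parallel Q t u \<Longrightarrow> tcong R Q E t u"
| refl: "wf_term R Q t \<Longrightarrow> tcong R Q E t t"
| sym: "tcong R Q E t u \<Longrightarrow> tcong R Q E u t"
| trans: "tcong R Q E t u \<Longrightarrow> tcong R Q E u v \<Longrightarrow> tcong R Q E t v"
| add_cong: "tcong R Q E t t' \<Longrightarrow> tcong R Q E u u' \<Longrightarrow> parallel Q t u \<Longrightarrow>
    tcong R Q E (TAdd t u) (TAdd t' u')"
| scal_cong: "a \<in> carrier R \<Longrightarrow> tcong R Q E t t' \<Longrightarrow> tcong R Q E (TScal a t) (TScal a t')"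
| comp_cong: "tcong R Q E t t' \<Longrightarrow> tcong R Q E u u' \<Longrightarrow> tdom Q t = tcod Q u \<Longrightarrow>
    tcong R Q E (TComp t u) (TComp t' u')"
| add_assoc: "wf_term R Q (TAdd (TAdd t u) v) \<Longrightarrow>
    tcong R Q E (TAdd (TAdd t u) v) (TAdd t (TAdd u v))"
| add_comm: "wf_term R Q (TAdd t u) \<Longrightarrow> tcong R Q E (TAdd t u) (TAdd u t)"
| add_zero: "wf_term R Q t \<Longrightarrow> tcong R Q E (TAdd (TZero (tdom Q t) (tcod Q t) (tdeg Q t)) t) t"
| add_inv: "wf_term R Q t \<Longrightarrow>
    tcong R Q E (TAdd (TScal (\<ominus>\<^bsub>R\<^esub> \<one>\<^bsub>R\<^esub>) t) t) (TZero (tdom Q t) (tcod Q t) (tdeg Q t))"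
| scal_one: "wf_term R Q t \<Longrightarrow> tcong R Q E (TScal \<one>\<^bsub>R\<^esub> t) t"
| scal_scal: "a \<in> carrier R \<Longrightarrow> b \<in> carrier R \<Longrightarrow> wf_term R Q t \<Longrightarrow>
    tcong R Q E (TScal a (TScal b t)) (TScal (a \<otimes>\<^bsub>R\<^esub> b) t)"
| scal_add_left: "a \<in> carrier R \<Longrightarrow> b \<in> carrier R \<Longrightarrow> wf_term R Q t \<Longrightarrow>
    tcong R Q E (TScal (a \<oplus>\<^bsub>R\<^esub> b) t) (TAdd (TScal a t) (TScal b t))"
| scal_add_right: "a \<in> carrier R \<Longrightarrow> wf_term R Q (TAdd t u) \<Longrightarrow>
    tcong R Q E (TScal a (TAdd t u)) (TAdd (TScal a t) (TScal a u))"
| comp_assoc: "wf_term R Q (TComp (TComp t u) v) \<Longrightarrow>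
    tcong R Q E (TComp (TComp t u) v) (TComp t (TComp u v))"
| id_left: "wf_term R Q t \<Longrightarrow> tcong R Q E (TComp (TId (tcod Q t)) t) t"
| id_right: "wf_term R Q t \<Longrightarrow> tcong R Q E (TComp t (TId (tdom Q t))) t"
| comp_add_left: "wf_term R Q (TComp (TAdd t u) v) \<Longrightarrow>
    tcong R Q E (TComp (TAdd t u) v) (TAdd (TComp t v) (TComp u v))"
| comp_add_right: "wf_term R Q (TComp t (TAdd u v)) \<Longrightarrow>
    tcong R Q E (TComp t (TAdd u v)) (TAdd (TComp t u) (TComp t v))"
| comp_scal_left: "wf_term R Q (TComp (TScal a t) u) \<Longrightarrow>
    tcong R Q E (TComp (TScal a t) u) (TScal a (TComp t u))"
| comp_scal_right: "wf_term R Q (TComp t (TScal a u)) \<Longrightarrow>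
    tcong R Q E (TComp t (TScal a u)) (TScal a (TComp t u))"

definition tclass ::
    "'a ring \<Rightarrow> ('o, 'g) quiver \<Rightarrow> (('a, 'o, 'g) gterm \<times> ('a, 'o, 'g) gterm) set \<Rightarrow>
     ('a, 'o, 'g) gterm \<Rightarrow> ('a, 'o, 'g) gterm set" where
  "tclass R Q E t = {u. tcong R Q E t u}"

definition trep :: "('a, 'o, 'g) gterm set \<Rightarrow> ('a, 'o, 'g) gterm" where
  "trep X = (SOME t. t \<in> X)"

definition presented ::
    "'a ring \<Rightarrow> ('o, 'g) quiver \<Rightarrow> (('a, 'o, 'g) gterm \<times> ('a, 'o, 'g) gterm) set \<Rightarrow>
     ('a, 'o, ('a, 'o, 'g) gterm set) grcat" where
  "presented R Q E =
     \<lparr>Obj = Vert Q,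
      Mor = tclass R Q E ` {t. wf_term R Q t},
      Dom = (\<lambda>X. tdom Q (trep X)),
      Cod = (\<lambda>X. tcod Q (trep X)),
      Deg = (\<lambda>X. tdeg Q (trep X)),
      Ide = (\<lambda>x. tclass R Q E (TId x)),
      Cmp = (\<lambda>X Y. tclass R Q E (TComp (trep X) (trep Y))),
      Zer = (\<lambda>x y n. tclass R Q E (TZero x y n)),
      Add = (\<lambda>X Y. tclass R Q E (TAdd (trep X) (trep Y))),
      Scal = (\<lambda>a X. tclass R Q E (TScal a (trep X)))\<rparr>"

primrec teval :: "('a, 'o, 'm, 'z) grcat_scheme \<Rightarrow> ('g \<Rightarrow> 'm) \<Rightarrow> ('a, 'o, 'g) gterm \<Rightarrow> 'm" where
  "teval A \<phi> (TGen g) = \<phi> g"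
| "teval A \<phi> (TId x) = Ide A x"
| "teval A \<phi> (TZero x y n) = Zer A x y n"
| "teval A \<phi> (TAdd t u) = Add A (teval A \<phi> t) (teval A \<phi> u)"
| "teval A \<phi> (TScal a t) = Scal A a (teval A \<phi> t)"
| "teval A \<phi> (TComp t u) = Cmp A (teval A \<phi> t) (teval A \<phi> u)"

text \<open>The functor out of a presented category that is \<open>\<phi>\<close> on generators, identical on objects.\<close>

definition induced_fun ::
    "('a, 'o, 'm, 'z) grcat_scheme \<Rightarrow> ('g \<Rightarrow> 'm) \<Rightarrow>
     ('o, ('a, 'o, 'g) gterm set, 'o, 'm) dgfun" where
  "induced_fun A \<phi> = \<lparr>Omap = (\<lambda>x. x), Mmap = (\<lambda>X. teval A \<phi> (trep X))\<rparr>"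

text \<open>The relations saying that the generators \<open>\<iota> f\<close>, \<open>f \<in> Mor C\<close>, compose and add as in \<open>C\<close>.\<close>

definition functor_relations ::
    "'a ring \<Rightarrow> ('a, 'o, 'm, 'z) grcat_scheme \<Rightarrow> ('m \<Rightarrow> 'g) \<Rightarrow>
     (('a, 'o, 'g) gterm \<times> ('a, 'o, 'g) gterm) set" where
  "functor_relations R C \<iota> =
     {(TGen (\<iota> (Ide C x)), TId x) | x. x \<in> Obj C} \<union>
     {(TGen (\<iota> (Cmp C g f)), TComp (TGen (\<iota> g)) (TGen (\<iota> f))) | g f.
        g \<in> Mor C \<and> f \<in> Mor C \<and> Dom C g = Cod C f} \<union>
     {(TGen (\<iota> (Add C f g)), TAdd (TGen (\<iota> f)) (TGen (\<iota> g))) | f g.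
        \<exists>x y n. f \<in> Hom C x y n \<and> g \<in> Hom C x y n} \<union>
     {(TGen (\<iota> (Scal C a f)), TScal a (TGen (\<iota> f))) | a f. a \<in> carrier R \<and> f \<in> Mor C}"

definition with_diff ::
    "('a, 'o, 'm) grcat \<Rightarrow> ('m \<Rightarrow> 'm) \<Rightarrow> ('a, 'o, 'm) dgcat" where
  "with_diff A d = grcat.extend A \<lparr>Diff = d\<rparr>"


section \<open>Free extensions\<close>

text \<open>The graded category freely generated over \<open>C\<close> by the arrows of a quiver on \<open>Obj C\<close>.\<close>

definition free_quiver ::
    "('a, 'o, 'm, 'z) grcat_scheme \<Rightarrow> ('o, 'i) quiver \<Rightarrow> ('o, 'm + 'i) quiver" where
  "free_quiver C G =
     \<lparr>Vert = Obj C, Arr = Inl ` Mor C \<union> Inr ` Arr G,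
      Src = case_sum (Dom C) (Src G), Tgt = case_sum (Cod C) (Tgt G),
      Dg = case_sum (Deg C) (Dg G)\<rparr>"

definition free_extension ::
    "'a ring \<Rightarrow> ('a, 'o, 'm, 'z) grcat_scheme \<Rightarrow> ('o, 'i) quiver \<Rightarrow>
     ('a, 'o, ('a, 'o, 'm + 'i) gterm set) grcat" where
  "free_extension R C G = presented R (free_quiver C G) (functor_relations R C Inl)"

definition free_base ::
    "'a ring \<Rightarrow> ('a, 'o, 'm, 'z) grcat_scheme \<Rightarrow> ('o, 'i) quiver \<Rightarrow>
     ('o, 'm, 'o, ('a, 'o, 'm + 'i) gterm set) dgfun" where
  "free_base R C G =
     \<lparr>Omap = (\<lambda>x. x),
      Mmap = (\<lambda>f. tclass R (free_quiver C G) (functor_relations R C Inl) (TGen (Inl f)))\<rparr>"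

definition free_gen ::
    "'a ring \<Rightarrow> ('a, 'o, 'm, 'z) grcat_scheme \<Rightarrow> ('o, 'i) quiver \<Rightarrow>
     'i \<Rightarrow> ('a, 'o, 'm + 'i) gterm set" where
  "free_gen R C G \<alpha> = tclass R (free_quiver C G) (functor_relations R C Inl) (TGen (Inr \<alpha>))"

text \<open>The quiver of morphisms \<open>s \<alpha>\<close>, \<open>\<alpha> \<in> I\<close>, with all degrees shifted by \<open>k\<close>.\<close>

definition gen_quiver ::
    "('a, 'o, 'm, 'z) grcat_scheme \<Rightarrow> 'i set \<Rightarrow> ('i \<Rightarrow> 'm) \<Rightarrow> int \<Rightarrow> ('o, 'i) quiver" where
  "gen_quiver D I s k =
     \<lparr>Vert = Obj D, Arr = I, Src = (\<lambda>\<alpha>. Dom D (s \<alpha>)), Tgt = (\<lambda>\<alpha>. Cod D (s \<alpha>)),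
      Dg = (\<lambda>\<alpha>. Deg D (s \<alpha>) + k)\<rparr>"

text \<open>
  For \<open>F : C \<rightarrow> D\<close> identical on objects: the canonical functor to \<open>D\<close> from the free extension of \<open>C\<close>
  by the \<open>s \<alpha>\<close> is an isomorphism of graded categories.
\<close>

definition freely_generated ::
    "'a ring \<Rightarrow> ('a, 'o, 'm, 'z) grcat_scheme \<Rightarrow> ('a, 'o, 'n, 'y) grcat_scheme \<Rightarrow>
     ('o, 'm, 'o, 'n) dgfun \<Rightarrow> 'i set \<Rightarrow> ('i \<Rightarrow> 'n) \<Rightarrow> bool" where
  "freely_generated R C D F I s \<longleftrightarrow>
     s ` I \<subseteq> Mor D \<and>
     bij_betw (Mmap (induced_fun D (case_sum (Mmap F) s)))
       (Mor (free_extension R C (gen_quiver D I s 0))) (Mor D)"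

inductive composite ::
    "('a, 'o, 'm, 'z) grcat_scheme \<Rightarrow> ('a, 'o, 'n, 'y) grcat_scheme \<Rightarrow>
     ('o, 'm, 'o, 'n) dgfun \<Rightarrow> 'i set \<Rightarrow> ('i \<Rightarrow> 'n) \<Rightarrow> ('i \<Rightarrow> nat) \<Rightarrow> 'n \<Rightarrow> nat \<Rightarrow> bool"
  for C D F I s w where
  base: "f \<in> Mor C \<Longrightarrow> composite C D F I s w (Mmap F f) 0"
| gen: "\<alpha> \<in> I \<Longrightarrow> composite C D F I s w (s \<alpha>) (w \<alpha>)"
| comp: "composite C D F I s w g m \<Longrightarrow> composite C D F I s w f n \<Longrightarrow> Dom D g = Cod D f \<Longrightarrow>
    composite C D F I s w (Cmp D g f) (m + n)"

text \<open>
  Finite sums in \<open>Hom D x y n\<close> of composites of weight less than \<open>k\<close>.  Scalar multiples need no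
  clause, as multiples of identities come from \<open>C\<close> and have weight zero.
\<close>

inductive weight_below ::
    "('a, 'o, 'm, 'z) grcat_scheme \<Rightarrow> ('a, 'o, 'n, 'y) grcat_scheme \<Rightarrow>
     ('o, 'm, 'o, 'n) dgfun \<Rightarrow> 'i set \<Rightarrow> ('i \<Rightarrow> 'n) \<Rightarrow> ('i \<Rightarrow> nat) \<Rightarrow> nat \<Rightarrow>
     'o \<Rightarrow> 'o \<Rightarrow> int \<Rightarrow> 'n \<Rightarrow> bool"
  for C D F I s w k x y n where
  zero: "weight_below C D F I s w k x y n (Zer D x y n)"
| add: "weight_below C D F I s w k x y n g \<Longrightarrow> composite C D F I s w f m \<Longrightarrow> m < k \<Longrightarrow>
    f \<in> Hom D x y n \<Longrightarrow> weight_below C D F I s w k x y n (Add D f g)"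

definition cofibrant_over ::
    "('a, 'o, 'm, 'z) dgcat_scheme \<Rightarrow> ('a, 'o, 'n, 'y) dgcat_scheme \<Rightarrow>
     ('o, 'm, 'o, 'n) dgfun \<Rightarrow> 'i set \<Rightarrow> ('i \<Rightarrow> 'n) \<Rightarrow> bool" where
  "cofibrant_over C D F I s \<longleftrightarrow>
     (\<exists>w :: 'i \<Rightarrow> nat. \<forall>\<alpha>\<in>I.
        weight_below C D F I s w (w \<alpha>) (Dom D (s \<alpha>)) (Cod D (s \<alpha>)) (Deg D (s \<alpha>) - 1)
          (Diff D (s \<alpha>)))"


section \<open>The coproduct of two copies of a dg category under \<open>C\<close>\<close>

text \<open>
  For \<open>F : C \<rightarrow> D\<close> identical on objects, \<open>D \<squnion>\<^sub>C D\<close> has the objects of \<open>D\<close>, two copies of the morphisms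
  of \<open>D\<close> as generators, and the relations of each copy together with the identification along \<open>C\<close>.
\<close>

definition cop_quiver :: "('a, 'o, 'n, 'y) grcat_scheme \<Rightarrow> ('o, 'n + 'n) quiver" where
  "cop_quiver D =
     \<lparr>Vert = Obj D, Arr = Inl ` Mor D \<union> Inr ` Mor D,
      Src = case_sum (Dom D) (Dom D), Tgt = case_sum (Cod D) (Cod D),
      Dg = case_sum (Deg D) (Deg D)\<rparr>"

definition cop_relations ::
    "'a ring \<Rightarrow> ('a, 'o, 'm, 'z) grcat_scheme \<Rightarrow> ('a, 'o, 'n, 'y) grcat_scheme \<Rightarrow>
     ('o, 'm, 'o, 'n) dgfun \<Rightarrow> (('a, 'o, 'n + 'n) gterm \<times> ('a, 'o, 'n + 'n) gterm) set" where
  "cop_relations R C D F =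
     functor_relations R D Inl \<union> functor_relations R D Inr \<union>
     {(TGen (Inl (Mmap F c)), TGen (Inr (Mmap F c))) | c. c \<in> Mor C}"

definition cop_in ::
    "('n \<Rightarrow> 'n + 'n) \<Rightarrow> 'a ring \<Rightarrow> ('a, 'o, 'm, 'z) grcat_scheme \<Rightarrow>
     ('a, 'o, 'n, 'y) grcat_scheme \<Rightarrow> ('o, 'm, 'o, 'n) dgfun \<Rightarrow>
     ('o, 'n, 'o, ('a, 'o, 'n + 'n) gterm set) dgfun" where
  "cop_in \<iota> R C D F =
     \<lparr>Omap = (\<lambda>x. x),
      Mmap = (\<lambda>f. tclass R (cop_quiver D) (cop_relations R C D F) (TGen (\<iota> f)))\<rparr>"

abbreviation "cop_in1 \<equiv> cop_in Inl"
abbreviation "cop_in2 \<equiv> cop_in Inr"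

definition graded_coproduct ::
    "'a ring \<Rightarrow> ('a, 'o, 'm, 'z) grcat_scheme \<Rightarrow> ('a, 'o, 'n, 'y) grcat_scheme \<Rightarrow>
     ('o, 'm, 'o, 'n) dgfun \<Rightarrow> ('a, 'o, ('a, 'o, 'n + 'n) gterm set) grcat" where
  "graded_coproduct R C D F = presented R (cop_quiver D) (cop_relations R C D F)"

definition coproduct_under ::
    "'a ring \<Rightarrow> ('a, 'o, 'm) dgcat \<Rightarrow> ('a, 'o, 'n) dgcat \<Rightarrow>
     ('o, 'm, 'o, 'n) dgfun \<Rightarrow> ('a, 'o, ('a, 'o, 'n + 'n) gterm set) dgcat" where
  "coproduct_under R C D F =
     (let P = graded_coproduct R C D F in
      with_diff P
        (the_derivation R P P id_fun id_fun (- 1)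
           (\<lambda>d. \<forall>f\<in>Mor D.
              d (Mmap (cop_in1 R C D F) f) = Mmap (cop_in1 R C D F) (Diff D f) \<and>
              d (Mmap (cop_in2 R C D F) f) = Mmap (cop_in2 R C D F) (Diff D f))))"

definition codiagonal ::
    "('a, 'o, 'n) dgcat \<Rightarrow> ('o, ('a, 'o, 'n + 'n) gterm set, 'o, 'n) dgfun" where
  "codiagonal D = induced_fun D (case_sum (\<lambda>f. f) (\<lambda>f. f))"


section \<open>Cylinder objects under \<open>C\<close>\<close>

text \<open>\<open>H\<close> is a morphism from \<open>(D, F)\<close> to \<open>(E, G)\<close> in the category of dg categories under \<open>C\<close>.\<close>

definition under_functor ::
    "'a ring \<Rightarrow> ('a, 'o, 'm) dgcat \<Rightarrow> ('a, 'p, 'n) dgcat \<Rightarrow> ('o, 'm, 'p, 'n) dgfun \<Rightarrow>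
     ('a, 'q, 'l) dgcat \<Rightarrow> ('o, 'm, 'q, 'l) dgfun \<Rightarrow> ('p, 'n, 'q, 'l) dgfun \<Rightarrow> bool" where
  "under_functor R C D F E G H \<longleftrightarrow>
     dg_functor R C D F \<and> dg_functor R C E G \<and> dg_functor R D E H \<and>
     eq_fun C (comp_fun H F) G"

definition good_cylinder ::
    "('q \<times> 'k \<times> 'r \<times> 'l) itself \<Rightarrow> 'a ring \<Rightarrow> ('a, 'o, 'm) dgcat \<Rightarrow> ('a, 'o, 'n) dgcat \<Rightarrow>
     ('o, 'm, 'o, 'n) dgfun \<Rightarrow> ('a, 'p, 'c) dgcat \<Rightarrow> ('o, 'm, 'p, 'c) dgfun \<Rightarrow>
     ('o, ('a, 'o, 'n + 'n) gterm set, 'p, 'c) dgfun \<Rightarrow> ('p, 'c, 'o, 'n) dgfun \<Rightarrow> bool" where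
  "good_cylinder T R C D F Y G i p \<longleftrightarrow>
     (let P = coproduct_under R C D F in
      under_functor R C P (comp_fun (cop_in1 R C D F) F) Y G i \<and>
      under_functor R C Y G D F p \<and>
      eq_fun P (comp_fun p i) (codiagonal D) \<and>
      cofibration T R P Y i \<and>
      quasi_equivalence R Y D p)"


section \<open>The relative cylinder\<close>

definition cyl_graded ::
    "'a ring \<Rightarrow> ('a, 'o, 'm) dgcat \<Rightarrow> ('a, 'o, 'n) dgcat \<Rightarrow> ('o, 'm, 'o, 'n) dgfun \<Rightarrow>
     'i set \<Rightarrow> ('i \<Rightarrow> 'n) \<Rightarrow>
     ('a, 'o, ('a, 'o, ('a, 'o, 'n + 'n) gterm set + 'i) gterm set) grcat" where
  "cyl_graded R C D F I s = free_extension R (coproduct_under R C D F) (gen_quiver D I s 1)"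

definition cyl_incl ::
    "'a ring \<Rightarrow> ('a, 'o, 'm) dgcat \<Rightarrow> ('a, 'o, 'n) dgcat \<Rightarrow> ('o, 'm, 'o, 'n) dgfun \<Rightarrow>
     'i set \<Rightarrow> ('i \<Rightarrow> 'n) \<Rightarrow>
     ('o, ('a, 'o, 'n + 'n) gterm set,
      'o, ('a, 'o, ('a, 'o, 'n + 'n) gterm set + 'i) gterm set) dgfun" where
  "cyl_incl R C D F I s = free_base R (coproduct_under R C D F) (gen_quiver D I s 1)"

definition cyl_gen ::
    "'a ring \<Rightarrow> ('a, 'o, 'm) dgcat \<Rightarrow> ('a, 'o, 'n) dgcat \<Rightarrow> ('o, 'm, 'o, 'n) dgfun \<Rightarrow>
     'i set \<Rightarrow> ('i \<Rightarrow> 'n) \<Rightarrow> 'i \<Rightarrow>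
     ('a, 'o, ('a, 'o, 'n + 'n) gterm set + 'i) gterm set" where
  "cyl_gen R C D F I s = free_gen R (coproduct_under R C D F) (gen_quiver D I s 1)"

definition cyl_i1 where
  "cyl_i1 R C D F I s = comp_fun (cyl_incl R C D F I s) (cop_in1 R C D F)"

definition cyl_i2 where
  "cyl_i2 R C D F I s = comp_fun (cyl_incl R C D F I s) (cop_in2 R C D F)"

text \<open>
  \<open>cyl_derivation\<close> is the degree \<open>1\<close> derivation \<open>f\<close> with \<open>f (s \<alpha>) = cyl_gen \<dots> \<alpha>\<close>; it takes values in the
  underlying graded category of the cylinder, before the cylinder has a differential.
\<close>

definition cyl_derivation ::
    "'a ring \<Rightarrow> ('a, 'o, 'm) dgcat \<Rightarrow> ('a, 'o, 'n) dgcat \<Rightarrow> ('o, 'm, 'o, 'n) dgfun \<Rightarrow>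
     'i set \<Rightarrow> ('i \<Rightarrow> 'n) \<Rightarrow> 'n \<Rightarrow>
     ('a, 'o, ('a, 'o, 'n + 'n) gterm set + 'i) gterm set" where
  "cyl_derivation R C D F I s =
     (let Y = cyl_graded R C D F I s in
      the_derivation R D Y (cyl_i1 R C D F I s) (cyl_i2 R C D F I s) 1
        (\<lambda>f. (\<forall>c\<in>Mor C. f (Mmap F c) = Zer Y (Dom C c) (Cod C c) (Deg C c + 1)) \<and>
             (\<forall>\<alpha>\<in>I. f (s \<alpha>) = cyl_gen R C D F I s \<alpha>)))"

definition relative_cylinder ::
    "'a ring \<Rightarrow> ('a, 'o, 'm) dgcat \<Rightarrow> ('a, 'o, 'n) dgcat \<Rightarrow> ('o, 'm, 'o, 'n) dgfun \<Rightarrow>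
     'i set \<Rightarrow> ('i \<Rightarrow> 'n) \<Rightarrow>
     ('a, 'o, ('a, 'o, ('a, 'o, 'n + 'n) gterm set + 'i) gterm set) dgcat" where
  "relative_cylinder R C D F I s =
     (let Y = cyl_graded R C D F I s;
          i1 = Mmap (cyl_i1 R C D F I s);
          i2 = Mmap (cyl_i2 R C D F I s)
      in with_diff Y
           (the_derivation R Y Y id_fun id_fun (- 1)
              (\<lambda>d. (\<forall>f\<in>Mor D. d (i1 f) = i1 (Diff D f) \<and> d (i2 f) = i2 (Diff D f)) \<and>
                   (\<forall>\<alpha>\<in>I. d (cyl_gen R C D F I s \<alpha>) =
                      Sub R Y (Sub R Y (i1 (s \<alpha>)) (i2 (s \<alpha>)))
                        (cyl_derivation R C D F I s (Diff D (s \<alpha>)))))))"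

definition cyl_unit where
  "cyl_unit R C D F I s = comp_fun (cyl_i1 R C D F I s) F"

definition cyl_proj ::
    "('a, 'o, 'n) dgcat \<Rightarrow> ('i \<Rightarrow> 'n) \<Rightarrow>
     ('o, ('a, 'o, ('a, 'o, 'n + 'n) gterm set + 'i) gterm set, 'o, 'n) dgfun" where
  "cyl_proj D s =
     induced_fun D
       (case_sum (Mmap (codiagonal D))
          (\<lambda>\<alpha>. Zer D (Dom D (s \<alpha>)) (Cod D (s \<alpha>)) (Deg D (s \<alpha>) + 1)))"

end

theory Submission
  imports Defs
begin

text \<open>
  Write \<open>P\<close> for \<open>D \<squnion>\<^sub>C D\<close>, \<open>Y\<close> for the cylinder, \<open>i1, i2 : D \<rightarrow> Y\<close> for its two copies of \<open>D\<close>,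
  \<open>proj : Y \<rightarrow> D\<close> for the projection, \<open>sbar \<alpha>\<close> for the additional generators, and \<open>bar\<close> for the
  \<open>(i1, i2)\<close>-derivation of degree 1 that vanishes on \<open>C\<close> and sends \<open>s \<alpha>\<close> to \<open>sbar \<alpha>\<close>.

  Everything rests on one principle: on a free extension, a graded functor or a derivation can be
  prescribed arbitrarily on the generators, and two of them that agree on the generators are equal.
  For derivations this follows from the case of functors, because an \<open>(F, G)\<close>-derivation \<open>f\<close> is the same
  thing as a functor \<open>x \<mapsto> (F x, f x, G x)\<close> to a category of upper triangular matrices
  (\<open>graded_functor_tri_fun\<close>, \<open>graded_derivation_of_triangular\<close>).  All identities in the proof are
  obtained by recognising both sides as derivations along the same pair of functors and comparing
  them on generators.

  \<^item> The first one is \<open>d bar + bar d = i1 - i2\<close> (\<open>bar_homotopy\<close>).  On \<open>s \<alpha>\<close> it is the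
    definition of \<open>d (sbar \<alpha>)\<close>, and it implies \<open>d d (sbar \<alpha>) = 0\<close>, so that \<open>Y\<close> is a dg category.

  \<^item> The projection is a homotopy equivalence with inverse \<open>i1\<close>.  Indeed, let \<open>h\<close> be the
    \<open>(i1 proj, id)\<close>-derivation of degree 1 on \<open>Y\<close> with \<open>h i1 = 0\<close>, \<open>h i2 = bar\<close> and
    \<open>h (sbar \<alpha>) = 0\<close>.  As \<open>h i1 = 0\<close> and \<open>proj bar = 0\<close>, the composite \<open>h bar\<close> is again an
    \<open>(i1, i2)\<close>-derivation; it vanishes on generators, hence \<open>h bar = 0\<close>.  Now \<open>d h + h d\<close> and
    \<open>i1 proj - id\<close> are both \<open>(i1 proj, id)\<close>-derivations of degree 0, and they agree on \<open>i1\<close>, on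
    \<open>i2\<close> (by the first identity) and on \<open>sbar \<alpha>\<close>, where both are \<open>- sbar \<alpha>\<close>; so they are equal
    (\<open>cylinder_contraction\<close>).

  \<^item> A lift of \<open>v : Y \<rightarrow> B\<close> along a trivial fibration \<open>p : A \<rightarrow> B\<close> that extends \<open>u : P \<rightarrow> A\<close> is a choice
    of morphisms \<open>b \<alpha>\<close> over \<open>v (sbar \<alpha>)\<close> with \<open>d (b \<alpha>) = u1 (s \<alpha>) - u2 (s \<alpha>) - g (d (s \<alpha>))\<close>, where
    \<open>u1\<close>, \<open>u2\<close> are the restrictions of \<open>u\<close> and \<open>g : D \<rightarrow> A\<close> is the derivation with values \<open>b\<close> on the
    generators.  Since \<open>d (s \<alpha>)\<close> is a sum of composites of smaller weight, \<open>g (d (s \<alpha>))\<close> only involves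
    values \<open>b \<beta>\<close> of smaller weight (\<open>derivation_eq_weight_below\<close>), and \<open>b\<close> can be chosen by recursion
    on the weight.  Each single choice is possible because the prescribed boundary is a cycle, again
    by \<open>d g + g d = u1 - u2\<close>, and because \<open>p\<close> is a surjective quasi-isomorphism on morphisms
    (\<open>trivial_fibration_lift\<close>).
\<close>

section \<open>Calculus in graded categories\<close>

text \<open>
  The calculus is phrased with the conditions \<open>f \<in> Mor C\<close>, \<open>Dom C f = x\<close> and so on instead of
  \<open>f \<in> Hom C x y n\<close>: in this form source, target and degree of a compound morphism are computed by
  rewriting, and the side conditions of the algebraic laws are decided along the way.
\<close>

lemma in_Hom_iff: "f \<in> Hom C x y n \<longleftrightarrow> f \<in> Mor C \<and> Dom C f = x \<and> Cod C f = y \<and> Deg C f = n"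
  by (simp add: Hom_def)

lemma Hom_self: "t \<in> Mor A \<Longrightarrow> t \<in> Hom A (Dom A t) (Cod A t) (Deg A t)"
  by (simp add: in_Hom_iff)

context graded_category
begin

sublocale R: cring R by (rule base)

lemmas Mor_Obj [simp] = Dom_closed Cod_closed

lemma module_hom: "f \<in> Mor C \<Longrightarrow> module R (hom_module C (Dom C f) (Cod C f) n)"
  by (simp add: hom_module)

context
  fixes f g
  assumes par: "f \<in> Mor C" "g \<in> Mor C" "Dom C f = Dom C g" "Cod C f = Cod C g" "Deg C f = Deg C g"
begin

lemma Add_Hom: "Add C f g \<in> Hom C (Dom C f) (Cod C f) (Deg C f)"
proof -
  interpret M: module R "hom_module C (Dom C f) (Cod C f) (Deg C f)"
    using par by (simp add: module_hom)
  show ?thesis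
    using M.a_closed[of f g] par by (simp add: hom_module_def in_Hom_iff)
qed

lemma Add_type [simp]:
  "Add C f g \<in> Mor C" "Dom C (Add C f g) = Dom C f" "Cod C (Add C f g) = Cod C f"
  "Deg C (Add C f g) = Deg C f"
  using Add_Hom by (auto simp: in_Hom_iff)

lemma Add_comm: "Add C f g = Add C g f"
proof -
  interpret M: module R "hom_module C (Dom C f) (Cod C f) (Deg C f)"
    using par by (simp add: module_hom)
  show ?thesis
    using M.a_comm[of f g] par by (simp add: hom_module_def in_Hom_iff)
qed

lemma Scal_Add [simp]:
  assumes "a \<in> carrier R"
  shows "Scal C a (Add C f g) = Add C (Scal C a f) (Scal C a g)"
proof -
  interpret M: module R "hom_module C (Dom C f) (Cod C f) (Deg C f)"
    using par by (simp add: module_hom)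
  show ?thesis
    using M.smult_r_distr[of a f g] par assms by (simp add: hom_module_def in_Hom_iff)
qed

lemma Add_assoc:
  assumes "h \<in> Mor C" "Dom C h = Dom C g" "Cod C h = Cod C g" "Deg C h = Deg C g"
  shows "Add C (Add C f g) h = Add C f (Add C g h)"
proof -
  interpret M: module R "hom_module C (Dom C f) (Cod C f) (Deg C f)"
    using par by (simp add: module_hom)
  show ?thesis
    using M.a_assoc[of f g h] par assms by (simp add: hom_module_def in_Hom_iff)
qed

lemma Add_cancel:
  assumes "h \<in> Mor C" "Dom C h = Dom C g" "Cod C h = Cod C g" "Deg C h = Deg C g"
  shows "Add C f g = Add C f h \<longleftrightarrow> g = h"
proof -
  let ?M = "hom_module C (Dom C f) (Cod C f) (Deg C f)"
  interpret M: module R ?M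
    using par by (simp add: module_hom)
  show ?thesis
  proof
    assume eq: "Add C f g = Add C f h"
    have "f \<oplus>\<^bsub>?M\<^esub> g = f \<oplus>\<^bsub>?M\<^esub> h"
      using eq by (simp add: hom_module_def)
    moreover have "f \<in> carrier ?M" "g \<in> carrier ?M" "h \<in> carrier ?M"
      using par assms by (simp_all add: hom_module_def in_Hom_iff)
    ultimately show "g = h"
      by (metis M.r_neg1)
  qed simp
qed

end

context
  fixes f
  assumes f: "f \<in> Mor C"
begin

lemma Scal_type [simp]:
  assumes "a \<in> carrier R"
  shows "Scal C a f \<in> Mor C" "Dom C (Scal C a f) = Dom C f" "Cod C (Scal C a f) = Cod C f"
    "Deg C (Scal C a f) = Deg C f"
proof -
  interpret M: module R "hom_module C (Dom C f) (Cod C f) (Deg C f)"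
    using f by (simp add: module_hom)
  show "Scal C a f \<in> Mor C" "Dom C (Scal C a f) = Dom C f" "Cod C (Scal C a f) = Cod C f"
    "Deg C (Scal C a f) = Deg C f"
    using M.smult_closed[of a f] f assms by (simp_all add: hom_module_def in_Hom_iff)
qed

lemma Scal_Scal [simp]:
  assumes "a \<in> carrier R" "b \<in> carrier R"
  shows "Scal C a (Scal C b f) = Scal C (a \<otimes>\<^bsub>R\<^esub> b) f"
proof -
  interpret M: module R "hom_module C (Dom C f) (Cod C f) (Deg C f)"
    using f by (simp add: module_hom)
  show ?thesis
    using M.smult_assoc1[of a b f] f assms by (simp add: hom_module_def in_Hom_iff)
qed

lemma Scal_plus:
  assumes "a \<in> carrier R" "b \<in> carrier R"
  shows "Scal C (a \<oplus>\<^bsub>R\<^esub> b) f = Add C (Scal C a f) (Scal C b f)"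
proof -
  interpret M: module R "hom_module C (Dom C f) (Cod C f) (Deg C f)"
    using f by (simp add: module_hom)
  show ?thesis
    using M.smult_l_distr[of a b f] f assms by (simp add: hom_module_def in_Hom_iff)
qed

lemma Scal_one [simp]: "Scal C \<one>\<^bsub>R\<^esub> f = f"
proof -
  interpret M: module R "hom_module C (Dom C f) (Cod C f) (Deg C f)"
    using f by (simp add: module_hom)
  show ?thesis
    using M.smult_one[of f] f by (simp add: hom_module_def in_Hom_iff)
qed

lemma Scal_zero [simp]: "Scal C \<zero>\<^bsub>R\<^esub> f = Zer C (Dom C f) (Cod C f) (Deg C f)"
proof -
  interpret M: module R "hom_module C (Dom C f) (Cod C f) (Deg C f)"
    using f by (simp add: module_hom)
  show ?thesis
    using M.smult_l_null[of f] f by (simp add: hom_module_def in_Hom_iff)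
qed

end

lemma Zer_type [simp]:
  assumes "x \<in> Obj C" "y \<in> Obj C"
  shows "Zer C x y n \<in> Mor C" "Dom C (Zer C x y n) = x" "Cod C (Zer C x y n) = y"
    "Deg C (Zer C x y n) = n"
proof -
  interpret M: module R "hom_module C x y n"
    using assms by (rule hom_module)
  show "Zer C x y n \<in> Mor C" "Dom C (Zer C x y n) = x" "Cod C (Zer C x y n) = y"
    "Deg C (Zer C x y n) = n"
    using M.zero_closed by (simp_all add: hom_module_def in_Hom_iff)
qed

lemma Scal_Zer [simp]:
  assumes "a \<in> carrier R" "x \<in> Obj C" "y \<in> Obj C"
  shows "Scal C a (Zer C x y n) = Zer C x y n"
proof -
  interpret M: module R "hom_module C x y n"
    using assms(2,3) by (rule hom_module)
  show ?thesis
    using M.smult_r_null[of a] assms by (simp add: hom_module_def)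
qed

lemma Add_Zer_left [simp]:
  assumes "f \<in> Mor C" "Dom C f = x" "Cod C f = y" "Deg C f = n"
  shows "Add C (Zer C x y n) f = f"
proof -
  interpret M: module R "hom_module C x y n"
    using assms by (auto simp: hom_module)
  show ?thesis
    using M.l_zero[of f] assms by (simp add: hom_module_def in_Hom_iff)
qed

lemma Add_Zer_right [simp]:
  assumes "f \<in> Mor C" "Dom C f = x" "Cod C f = y" "Deg C f = n"
  shows "Add C f (Zer C x y n) = f"
  using assms Add_comm[of f "Zer C x y n"] by auto

lemma Add_left_comm:
  assumes "f \<in> Mor C" "g \<in> Mor C" "Dom C f = Dom C g" "Cod C f = Cod C g" "Deg C f = Deg C g"
    "h \<in> Mor C" "Dom C h = Dom C g" "Cod C h = Cod C g" "Deg C h = Deg C g"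
  shows "Add C f (Add C g h) = Add C g (Add C f h)"
  using assms by (simp add: Add_assoc[symmetric] Add_comm[of f g])

lemmas Add_ac = Add_assoc Add_comm Add_left_comm

abbreviation "Neg f \<equiv> Scal C (\<ominus>\<^bsub>R\<^esub> \<one>\<^bsub>R\<^esub>) f"

lemma minus_one_sq [simp]: "\<ominus>\<^bsub>R\<^esub> \<one>\<^bsub>R\<^esub> \<otimes>\<^bsub>R\<^esub> \<ominus>\<^bsub>R\<^esub> \<one>\<^bsub>R\<^esub> = \<one>\<^bsub>R\<^esub>"
  by (simp add: R.l_minus)

lemma Add_Neg [simp]:
  assumes "f \<in> Mor C"
  shows "Add C f (Neg f) = Zer C (Dom C f) (Cod C f) (Deg C f)"
    and "Add C (Neg f) f = Zer C (Dom C f) (Cod C f) (Deg C f)"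
proof -
  show 1: "Add C f (Neg f) = Zer C (Dom C f) (Cod C f) (Deg C f)"
    using Scal_plus[of f "\<one>\<^bsub>R\<^esub>" "\<ominus>\<^bsub>R\<^esub> \<one>\<^bsub>R\<^esub>"] assms by (simp add: R.r_neg)
  then show "Add C (Neg f) f = Zer C (Dom C f) (Cod C f) (Deg C f)"
    using assms by (simp add: Add_comm[of "Neg f" f])
qed

lemma Add_Neg_Add [simp]:
  assumes "f \<in> Mor C" "g \<in> Mor C" "Dom C f = Dom C g" "Cod C f = Cod C g" "Deg C f = Deg C g"
  shows "Add C f (Add C (Neg f) g) = g" "Add C (Neg f) (Add C f g) = g"
  using assms by (subst Add_assoc[symmetric]; simp)+

lemma Add_self_iff:
  assumes "f \<in> Mor C"
  shows "Add C f f = f \<longleftrightarrow> f = Zer C (Dom C f) (Cod C f) (Deg C f)"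
proof -
  have "Add C f f = Add C f (Zer C (Dom C f) (Cod C f) (Deg C f)) \<longleftrightarrow>
      f = Zer C (Dom C f) (Cod C f) (Deg C f)"
    by (rule Add_cancel) (use assms in simp_all)
  then show ?thesis using assms by simp
qed

lemma Ide_type [simp]:
  assumes "x \<in> Obj C"
  shows "Ide C x \<in> Mor C" "Dom C (Ide C x) = x" "Cod C (Ide C x) = x" "Deg C (Ide C x) = 0"
  using Ide_closed[OF assms] by (simp_all add: in_Hom_iff)

lemma Cmp_type [simp]:
  assumes "g \<in> Mor C" "f \<in> Mor C" "Dom C g = Cod C f"
  shows "Cmp C g f \<in> Mor C" "Dom C (Cmp C g f) = Dom C f" "Cod C (Cmp C g f) = Cod C g"
    "Deg C (Cmp C g f) = Deg C g + Deg C f"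
  using Cmp_closed[of g "Dom C g" "Cod C g" "Deg C g" f "Dom C f" "Deg C f"] assms
  by (simp_all add: in_Hom_iff)

lemma Cmp_assoc' [simp]:
  assumes "h \<in> Mor C" "g \<in> Mor C" "f \<in> Mor C" "Dom C h = Cod C g" "Dom C g = Cod C f"
  shows "Cmp C (Cmp C h g) f = Cmp C h (Cmp C g f)"
  using assms by (intro Cmp_assoc) (auto simp: in_Hom_iff)

lemma Cmp_Ide [simp]:
  assumes "f \<in> Mor C"
  shows "Cod C f = y \<Longrightarrow> Cmp C (Ide C y) f = f" "Dom C f = x \<Longrightarrow> Cmp C f (Ide C x) = f"
  using Ide_left[of f "Dom C f" "Cod C f" "Deg C f"] Ide_right[of f "Dom C f" "Cod C f" "Deg C f"]
    assms by (auto simp: in_Hom_iff)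

lemma Cmp_Add [simp]:
  assumes "f \<in> Mor C" "g \<in> Mor C" "Dom C f = Dom C g" "Cod C f = Cod C g" "Deg C f = Deg C g"
    "h \<in> Mor C"
  shows "Dom C h = Cod C g \<Longrightarrow> Cmp C h (Add C f g) = Add C (Cmp C h f) (Cmp C h g)"
    "Dom C g = Cod C h \<Longrightarrow> Cmp C (Add C f g) h = Add C (Cmp C f h) (Cmp C g h)"
  using Cmp_Add_right[of h "Dom C h" "Cod C h" "Deg C h" f "Dom C f" "Deg C f" g]
    Cmp_Add_left[of f "Dom C f" "Cod C f" "Deg C f" g h "Dom C h" "Deg C h"] assms
  by (simp_all add: in_Hom_iff)

lemma Cmp_Scal [simp]:
  assumes "a \<in> carrier R" "f \<in> Mor C" "g \<in> Mor C" "Dom C g = Cod C f"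
  shows "Cmp C g (Scal C a f) = Scal C a (Cmp C g f)" "Cmp C (Scal C a g) f = Scal C a (Cmp C g f)"
  using Cmp_Scal_left[of a g "Dom C g" "Cod C g" "Deg C g" f "Dom C f" "Deg C f"]
    Cmp_Scal_right[of a g "Dom C g" "Cod C g" "Deg C g" f "Dom C f" "Deg C f"] assms
  by (simp_all add: in_Hom_iff)

lemma Cmp_Zer [simp]:
  assumes "f \<in> Mor C" "x \<in> Obj C"
  shows "Cod C f = y \<Longrightarrow> Cmp C (Zer C y x n) f = Zer C (Dom C f) x (n + Deg C f)"
    "Dom C f = y \<Longrightarrow> Cmp C f (Zer C x y n) = Zer C x (Cod C f) (Deg C f + n)"
proof -
  show "Cmp C (Zer C y x n) f = Zer C (Dom C f) x (n + Deg C f)" if "Cod C f = y"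
    using Cmp_Scal(2)[of "\<zero>\<^bsub>R\<^esub>" f "Zer C y x n"] that assms by force
  show "Cmp C f (Zer C x y n) = Zer C x (Cod C f) (Deg C f + n)" if "Dom C f = y"
    using Cmp_Scal(1)[of "\<zero>\<^bsub>R\<^esub>" "Zer C x y n" f] that assms by force
qed

lemma sgn_unit_closed [simp]: "sgn_unit R n \<in> carrier R"
  by (simp add: sgn_unit_def)

lemma sgn_unit_mult [simp]: "sgn_unit R m \<otimes>\<^bsub>R\<^esub> sgn_unit R n = sgn_unit R (m + n)"
  by (simp add: sgn_unit_def)

lemma sgn_unit_0 [simp]: "sgn_unit R 0 = \<one>\<^bsub>R\<^esub>"
  by (simp add: sgn_unit_def)

lemma Sub_type [simp]:
  assumes "f \<in> Mor C" "g \<in> Mor C" "Dom C f = Dom C g" "Cod C f = Cod C g" "Deg C f = Deg C g"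
  shows "Sub R C f g \<in> Mor C" "Dom C (Sub R C f g) = Dom C f" "Cod C (Sub R C f g) = Cod C f"
    "Deg C (Sub R C f g) = Deg C f"
  using assms by (simp_all add: Sub_def)

lemma Sub_self [simp]:
  "t \<in> Mor C \<Longrightarrow> Sub R C t t = Zer C (Dom C t) (Cod C t) (Deg C t)"
  by (simp add: Sub_def)

lemma Sub_Zer [simp]:
  "t \<in> Mor C \<Longrightarrow> Dom C t = x \<Longrightarrow> Cod C t = y \<Longrightarrow> Deg C t = n \<Longrightarrow> Sub R C t (Zer C x y n) = t"
  by (auto simp: Sub_def)

end

text \<open>
  The module axioms for the sets of morphisms, spelled out as equations; negatives are multiples by
  \<open>- 1\<close>, so the existence of inverses takes the form of an equation as well.
\<close>

lemma graded_categoryI: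
  assumes "cring R"
    and type: "\<And>f. f \<in> Mor C \<Longrightarrow> Dom C f \<in> Obj C \<and> Cod C f \<in> Obj C"
    and Ide: "\<And>x. x \<in> Obj C \<Longrightarrow> Ide C x \<in> Hom C x x 0"
    and Zer: "\<And>x y n. x \<in> Obj C \<Longrightarrow> y \<in> Obj C \<Longrightarrow> Zer C x y n \<in> Hom C x y n"
    and Add: "\<And>f g x y n. f \<in> Hom C x y n \<Longrightarrow> g \<in> Hom C x y n \<Longrightarrow> Add C f g \<in> Hom C x y n"
    and Scal: "\<And>a f x y n. a \<in> carrier R \<Longrightarrow> f \<in> Hom C x y n \<Longrightarrow> Scal C a f \<in> Hom C x y n"
    and Cmp: "\<And>f g x y z m n. g \<in> Hom C y z m \<Longrightarrow> f \<in> Hom C x y n \<Longrightarrow>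
      Cmp C g f \<in> Hom C x z (m + n)"
    and Add_assoc: "\<And>f g h x y n. f \<in> Hom C x y n \<Longrightarrow> g \<in> Hom C x y n \<Longrightarrow> h \<in> Hom C x y n \<Longrightarrow>
      Add C (Add C f g) h = Add C f (Add C g h)"
    and Add_comm: "\<And>f g x y n. f \<in> Hom C x y n \<Longrightarrow> g \<in> Hom C x y n \<Longrightarrow> Add C f g = Add C g f"
    and Add_Zer: "\<And>f x y n. f \<in> Hom C x y n \<Longrightarrow> Add C (Zer C x y n) f = f"
    and Add_Neg: "\<And>f x y n. f \<in> Hom C x y n \<Longrightarrow>
      Add C (Scal C (\<ominus>\<^bsub>R\<^esub> \<one>\<^bsub>R\<^esub>) f) f = Zer C x y n"
    and Scal_one: "\<And>f x y n. f \<in> Hom C x y n \<Longrightarrow> Scal C \<one>\<^bsub>R\<^esub> f = f"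
    and Scal_Scal: "\<And>a b f x y n. a \<in> carrier R \<Longrightarrow> b \<in> carrier R \<Longrightarrow> f \<in> Hom C x y n \<Longrightarrow>
      Scal C a (Scal C b f) = Scal C (a \<otimes>\<^bsub>R\<^esub> b) f"
    and Scal_plus: "\<And>a b f x y n. a \<in> carrier R \<Longrightarrow> b \<in> carrier R \<Longrightarrow> f \<in> Hom C x y n \<Longrightarrow>
      Scal C (a \<oplus>\<^bsub>R\<^esub> b) f = Add C (Scal C a f) (Scal C b f)"
    and Scal_Add: "\<And>a f g x y n. a \<in> carrier R \<Longrightarrow> f \<in> Hom C x y n \<Longrightarrow> g \<in> Hom C x y n \<Longrightarrow>
      Scal C a (Add C f g) = Add C (Scal C a f) (Scal C a g)"
    and Cmp_assoc: "\<And>f g h v x y z l m n. h \<in> Hom C y z l \<Longrightarrow> g \<in> Hom C x y m \<Longrightarrow>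
      f \<in> Hom C v x n \<Longrightarrow> Cmp C (Cmp C h g) f = Cmp C h (Cmp C g f)"
    and Cmp_Ide: "\<And>f x y n. f \<in> Hom C x y n \<Longrightarrow> Cmp C (Ide C y) f = f \<and> Cmp C f (Ide C x) = f"
    and Cmp_Add_left: "\<And>f g g' x y z m n. g \<in> Hom C y z m \<Longrightarrow> g' \<in> Hom C y z m \<Longrightarrow>
      f \<in> Hom C x y n \<Longrightarrow> Cmp C (Add C g g') f = Add C (Cmp C g f) (Cmp C g' f)"
    and Cmp_Add_right: "\<And>f f' g x y z m n. g \<in> Hom C y z m \<Longrightarrow> f \<in> Hom C x y n \<Longrightarrow>
      f' \<in> Hom C x y n \<Longrightarrow> Cmp C g (Add C f f') = Add C (Cmp C g f) (Cmp C g f')"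
    and Cmp_Scal: "\<And>a f g x y z m n. a \<in> carrier R \<Longrightarrow> g \<in> Hom C y z m \<Longrightarrow> f \<in> Hom C x y n \<Longrightarrow>
      Cmp C (Scal C a g) f = Scal C a (Cmp C g f) \<and> Cmp C g (Scal C a f) = Scal C a (Cmp C g f)"
  shows "graded_category R C"
proof -
  interpret R: cring R by fact
  have hom: "module R (hom_module C x y n)" if xy: "x \<in> Obj C" "y \<in> Obj C" for x y n
  proof (intro module.intro abelian_groupI module_axioms.intro)
    show "\<exists>g\<in>carrier (hom_module C x y n).
        g \<oplus>\<^bsub>hom_module C x y n\<^esub> f = \<zero>\<^bsub>hom_module C x y n\<^esub>"
      if "f \<in> carrier (hom_module C x y n)" for f
      using that Add_Neg[of f x y n] Scal[of "\<ominus>\<^bsub>R\<^esub> \<one>\<^bsub>R\<^esub>" f x y n]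
      by (auto simp: hom_module_def)
    show "f \<oplus>\<^bsub>hom_module C x y n\<^esub> g = g \<oplus>\<^bsub>hom_module C x y n\<^esub> f"
      if "f \<in> carrier (hom_module C x y n)" "g \<in> carrier (hom_module C x y n)" for f g
      using that Add_comm[of f x y n g] by (simp add: hom_module_def)
  qed (use xy in \<open>simp_all add: hom_module_def assms(1), (blast intro: Zer Add Scal Add_assoc
      Add_Zer Scal_one Scal_Scal[symmetric] Scal_plus Scal_Add)+\<close>)
  show ?thesis
    by (rule graded_category.intro)
      (rule \<open>cring R\<close> hom type[THEN conjunct1] type[THEN conjunct2] Ide Cmp Cmp_assoc Cmp_Add_left
        Cmp_Add_right Cmp_Ide[THEN conjunct1] Cmp_Ide[THEN conjunct2] Cmp_Scal[THEN conjunct1]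
        Cmp_Scal[THEN conjunct2]; assumption)+
qed


section \<open>Graded functors and derivations\<close>

lemma id_fun_simps [simp]: "Omap id_fun x = x" "Mmap id_fun t = t"
  by (simp_all add: id_fun_def)

lemma comp_fun_simps [simp]:
  "Omap (comp_fun G F) x = Omap G (Omap F x)" "Mmap (comp_fun G F) t = Mmap G (Mmap F t)"
  by (simp_all add: comp_fun_def)

locale graded_functor = dom: graded_category R A + cod: graded_category R B
  for R :: "'a ring"
    and A :: "('a, 'o, 'm, 'z) grcat_scheme"
    and B :: "('a, 'p, 'n, 'y) grcat_scheme" +
  fixes F :: "('o, 'm, 'p, 'n) dgfun"
  assumes Omap_Obj [simp]: "x \<in> Obj A \<Longrightarrow> Omap F x \<in> Obj B"
    and map_type [simp]: "t \<in> Mor A \<Longrightarrow> Mmap F t \<in> Mor B"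
      "t \<in> Mor A \<Longrightarrow> Dom B (Mmap F t) = Omap F (Dom A t)"
      "t \<in> Mor A \<Longrightarrow> Cod B (Mmap F t) = Omap F (Cod A t)"
      "t \<in> Mor A \<Longrightarrow> Deg B (Mmap F t) = Deg A t"
    and map_Ide [simp]: "x \<in> Obj A \<Longrightarrow> Mmap F (Ide A x) = Ide B (Omap F x)"
    and map_Cmp [simp]: "t \<in> Mor A \<Longrightarrow> u \<in> Mor A \<Longrightarrow> Dom A t = Cod A u \<Longrightarrow>
      Mmap F (Cmp A t u) = Cmp B (Mmap F t) (Mmap F u)"
    and map_Add [simp]: "t \<in> Mor A \<Longrightarrow> u \<in> Mor A \<Longrightarrow> Dom A t = Dom A u \<Longrightarrow> Cod A t = Cod A u \<Longrightarrow>
      Deg A t = Deg A u \<Longrightarrow> Mmap F (Add A t u) = Add B (Mmap F t) (Mmap F u)"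
    and map_Scal [simp]: "a \<in> carrier R \<Longrightarrow> t \<in> Mor A \<Longrightarrow>
      Mmap F (Scal A a t) = Scal B a (Mmap F t)"
begin

lemma map_Zer [simp]:
  assumes "x \<in> Obj A" "y \<in> Obj A"
  shows "Mmap F (Zer A x y n) = Zer B (Omap F x) (Omap F y) n"
proof -
  have "Mmap F (Scal A \<zero>\<^bsub>R\<^esub> (Zer A x y n)) = Zer B (Omap F x) (Omap F y) n"
    using assms by (subst map_Scal; simp del: dom.Scal_zero dom.Scal_Zer)
  then show ?thesis using assms by simp
qed

lemma map_Sub:
  "t \<in> Mor A \<Longrightarrow> u \<in> Mor A \<Longrightarrow> Dom A t = Dom A u \<Longrightarrow> Cod A t = Cod A u \<Longrightarrow>
      Deg A t = Deg A u \<Longrightarrow> Mmap F (Sub R A t u) = Sub R B (Mmap F t) (Mmap F u)"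
  by (simp add: Sub_def)

end

locale graded_derivation = F: graded_functor R A B F + G: graded_functor R A B G
  for R :: "'a ring"
    and A :: "('a, 'o, 'm, 'z) grcat_scheme"
    and B :: "('a, 'p, 'n, 'y) grcat_scheme"
    and F G :: "('o, 'm, 'p, 'n) dgfun" +
  fixes p :: int and f :: "'m \<Rightarrow> 'n"
  assumes Omap_agree [simp]: "x \<in> Obj A \<Longrightarrow> Omap G x = Omap F x"
    and der_type [simp]: "t \<in> Mor A \<Longrightarrow> f t \<in> Mor B"
      "t \<in> Mor A \<Longrightarrow> Dom B (f t) = Omap F (Dom A t)"
      "t \<in> Mor A \<Longrightarrow> Cod B (f t) = Omap F (Cod A t)"
      "t \<in> Mor A \<Longrightarrow> Deg B (f t) = Deg A t + p"
    and der_Cmp [simp]: "t \<in> Mor A \<Longrightarrow> u \<in> Mor A \<Longrightarrow> Dom A t = Cod A u \<Longrightarrow>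
      f (Cmp A t u) = Add B (Cmp B (f t) (Mmap G u))
        (Scal B (sgn_unit R (p * Deg A t)) (Cmp B (Mmap F t) (f u)))"
    and der_Add [simp]: "t \<in> Mor A \<Longrightarrow> u \<in> Mor A \<Longrightarrow> Dom A t = Dom A u \<Longrightarrow> Cod A t = Cod A u \<Longrightarrow>
      Deg A t = Deg A u \<Longrightarrow> f (Add A t u) = Add B (f t) (f u)"
    and der_Scal [simp]: "a \<in> carrier R \<Longrightarrow> t \<in> Mor A \<Longrightarrow> f (Scal A a t) = Scal B a (f t)"
begin

lemma derivation: "derivation R A B F G p f"
  unfolding derivation_def in_Hom_iff by (auto simp: in_Hom_iff)

lemma der_Zer [simp]:
  assumes "x \<in> Obj A" "y \<in> Obj A"
  shows "f (Zer A x y n) = Zer B (Omap F x) (Omap F y) (n + p)"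
proof -
  have "f (Scal A \<zero>\<^bsub>R\<^esub> (Zer A x y n)) = Zer B (Omap F x) (Omap F y) (n + p)"
    using assms by (subst der_Scal; simp del: F.dom.Scal_zero F.dom.Scal_Zer)
  then show ?thesis using assms by simp
qed

lemma der_Ide [simp]:
  assumes "x \<in> Obj A"
  shows "f (Ide A x) = Zer B (Omap F x) (Omap F x) p"
proof -
  have "f (Ide A x) = f (Cmp A (Ide A x) (Ide A x))" using assms by simp
  also have "\<dots> = Add B (f (Ide A x)) (f (Ide A x))"
    using assms by (subst der_Cmp) (simp_all add: sgn_unit_def)
  finally show ?thesis
    using assms F.cod.Add_self_iff[of "f (Ide A x)"] by simp
qed

lemma der_Sub:
  assumes "t \<in> Mor A" "u \<in> Mor A" "Dom A t = Dom A u" "Cod A t = Cod A u" "Deg A t = Deg A u"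
  shows "f (Sub R A t u) = Sub R B (f t) (f u)"
  using assms by (simp add: Sub_def)

end

lemma graded_derivationI:
  assumes "graded_functor R A B F" "graded_functor R A B G"
    and "\<And>x. x \<in> Obj A \<Longrightarrow> Omap G x = Omap F x" "derivation R A B F G p f"
  shows "graded_derivation R A B F G p f"
proof -
  interpret F: graded_functor R A B F by fact
  interpret G: graded_functor R A B G by fact
  have 0: "\<forall>x y n. \<forall>t\<in>Hom A x y n. f t \<in> Hom B (Omap F x) (Omap F y) (n + p)"
    "\<forall>x y n. \<forall>t\<in>Hom A x y n. \<forall>u\<in>Hom A x y n. f (Add A t u) = Add B (f t) (f u)"
    using assms(4) unfolding derivation_def by blast+
  have 1: "f t \<in> Hom B (Omap F (Dom A t)) (Omap F (Cod A t)) (Deg A t + p)" if "t \<in> Mor A" for t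
    using that by (intro 0(1)[rule_format]) (simp add: in_Hom_iff)
  have 2: "f (Add A t u) = Add B (f t) (f u)"
    if "t \<in> Mor A" "u \<in> Mor A" "Dom A t = Dom A u" "Cod A t = Cod A u" "Deg A t = Deg A u" for t u
    using that by (intro 0(2)[rule_format, of t "Dom A u" "Cod A u" "Deg A u"])
      (simp_all add: in_Hom_iff)
  show ?thesis
  proof
    fix t u
    show "f (Cmp A t u) = Add B (Cmp B (f t) (Mmap G u))
        (Scal B (sgn_unit R (p * Deg A t)) (Cmp B (Mmap F t) (f u)))"
      if "t \<in> Mor A" "u \<in> Mor A" "Dom A t = Cod A u"
      using assms(4) that unfolding derivation_def by blast
    show "f (Scal A a t) = Scal B a (f t)" if "a \<in> carrier R" "t \<in> Mor A" for a
      using assms(4) that unfolding derivation_def by blast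
  qed (use 1 2 assms(3) in \<open>simp_all add: in_Hom_iff\<close>)
qed

lemma graded_functor_id: "graded_category R A \<Longrightarrow> graded_functor R A A id_fun"
  by (simp add: graded_functor_def graded_functor_axioms_def id_fun_def)

lemma graded_functor_comp:
  assumes "graded_functor R A B F" "graded_functor R B C G"
  shows "graded_functor R A C (comp_fun G F)"
proof -
  interpret F: graded_functor R A B F by fact
  interpret G: graded_functor R B C G by fact
  show ?thesis by unfold_locales (simp_all add: comp_fun_def)
qed

lemma graded_functor_cong:
  assumes "graded_functor R A B F" "eq_fun A F G"
  shows "graded_functor R A B G"
proof -
  interpret F: graded_functor R A B F by fact
  have "Omap G x = Omap F x" if "x \<in> Obj A" for x
    using assms(2) that by (simp add: eq_fun_def)
  moreover have "Mmap G x = Mmap F x" if "x \<in> Mor A" for x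
    using assms(2) that by (simp add: eq_fun_def)
  ultimately show ?thesis by unfold_locales simp_all
qed

lemma graded_derivation_cong:
  assumes "graded_derivation R A B F G p f"
    and "eq_fun A F F'" "eq_fun A G G'" "\<And>x. x \<in> Mor A \<Longrightarrow> f' x = f x"
  shows "graded_derivation R A B F' G' p f'"
proof -
  interpret f: graded_derivation R A B F G p f by fact
  interpret F': graded_functor R A B F'
    using f.F.graded_functor_axioms assms(2) by (rule graded_functor_cong)
  interpret G': graded_functor R A B G'
    using f.G.graded_functor_axioms assms(3) by (rule graded_functor_cong)
  have "Omap F' x = Omap F x" "Omap G' x = Omap F x" if "x \<in> Obj A" for x
    using assms(2,3) that by (simp_all add: eq_fun_def flip: f.Omap_agree)
  moreover have "Mmap F' x = Mmap F x" "Mmap G' x = Mmap G x" if "x \<in> Mor A" for x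
    using assms(2,3) that by (simp_all add: eq_fun_def)
  ultimately show ?thesis by unfold_locales (simp_all add: assms(4))
qed

lemma graded_derivation_comp_left:
  assumes "graded_derivation R A B F G p f" "graded_functor R B C H"
  shows "graded_derivation R A C (comp_fun H F) (comp_fun H G) p (\<lambda>x. Mmap H (f x))"
proof -
  interpret f: graded_derivation R A B F G p f by fact
  interpret H: graded_functor R B C H by fact
  interpret HF: graded_functor R A C "comp_fun H F"
    using f.F.graded_functor_axioms assms(2) by (rule graded_functor_comp)
  interpret HG: graded_functor R A C "comp_fun H G"
    using f.G.graded_functor_axioms assms(2) by (rule graded_functor_comp)
  show ?thesis by unfold_locales (simp_all add: comp_fun_def)
qed

lemma graded_derivation_comp_right:
  assumes "graded_functor R A B H" "graded_derivation R B C F G p f"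
  shows "graded_derivation R A C (comp_fun F H) (comp_fun G H) p (\<lambda>x. f (Mmap H x))"
proof -
  interpret f: graded_derivation R B C F G p f by fact
  interpret H: graded_functor R A B H by fact
  interpret FH: graded_functor R A C "comp_fun F H"
    using assms(1) f.F.graded_functor_axioms by (rule graded_functor_comp)
  interpret GH: graded_functor R A C "comp_fun G H"
    using assms(1) f.G.graded_functor_axioms by (rule graded_functor_comp)
  show ?thesis by unfold_locales (simp_all add: comp_fun_def)
qed

text \<open>
  Every set of morphisms has its own zero, so the zero derivation has to name source, target and
  degree.
\<close>

definition zero_derivation ::
    "('a, 'o, 'm, 'z) grcat_scheme \<Rightarrow> ('a, 'p, 'n, 'y) grcat_scheme \<Rightarrow>
     ('o, 'm, 'p, 'n) dgfun \<Rightarrow> int \<Rightarrow> 'm \<Rightarrow> 'n" where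
  "zero_derivation A B F p = (\<lambda>x. Zer B (Omap F (Dom A x)) (Omap F (Cod A x)) (Deg A x + p))"

lemma graded_derivation_zero:
  assumes "graded_functor R A B F" "graded_functor R A B G"
    and "\<And>x. x \<in> Obj A \<Longrightarrow> Omap G x = Omap F x"
  shows "graded_derivation R A B F G p (zero_derivation A B F p)"
proof -
  interpret F: graded_functor R A B F by fact
  interpret G: graded_functor R A B G by fact
  show ?thesis
    by unfold_locales (simp_all add: assms(3) zero_derivation_def algebra_simps)
qed

text \<open>
  The telescoping identity \<open>F t F u - G t G u = (F t - G t) G u + F t (F u - G u)\<close>.
\<close>

lemma graded_derivation_diff:
  assumes "graded_functor R A B F" "graded_functor R A B G"
    and [simp]: "\<And>x. x \<in> Obj A \<Longrightarrow> Omap G x = Omap F x"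
  shows "graded_derivation R A B F G 0 (\<lambda>x. Sub R B (Mmap F x) (Mmap G x))"
proof -
  interpret F: graded_functor R A B F by fact
  interpret G: graded_functor R A B G by fact
  have *: "Sub R B (Cmp B t u) (Cmp B t' u') =
      Add B (Cmp B (Sub R B t t') u') (Scal B (sgn_unit R 0) (Cmp B t (Sub R B u u')))"
    if [simp]: "t \<in> Mor B" "t' \<in> Mor B" "u \<in> Mor B" "u' \<in> Mor B" "Dom B t = Cod B u" "Dom B t' = Cod B u"
      "Cod B t' = Cod B t" "Deg B t' = Deg B t" "Dom B u' = Dom B u" "Cod B u' = Cod B u"
      "Deg B u' = Deg B u" for t t' u u'
  proof -
    have "Add B (Cmp B (Sub R B t t') u') (Scal B (sgn_unit R 0) (Cmp B t (Sub R B u u'))) =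
       Add B (Add B (Cmp B t u') (F.cod.Neg (Cmp B t' u')))
          (Add B (Cmp B t u) (F.cod.Neg (Cmp B t u')))"
      by (simp add: Sub_def sgn_unit_def)
    also have "\<dots> = Add B (Cmp B t u) (Add B (F.cod.Neg (Cmp B t' u'))
          (Add B (Cmp B t u') (F.cod.Neg (Cmp B t u'))))"
      by (simp add: F.cod.Add_ac del: F.cod.Add_Neg)
    finally show ?thesis by (simp add: Sub_def)
  qed
  show ?thesis
    by unfold_locales (simp_all add: *, simp_all add: Sub_def F.cod.Add_ac F.dom.R.m_comm)
qed

text \<open>
  In \<open>d (d (t u))\<close> the two cross terms \<open>d t d u\<close> carry the signs \<open>(- 1) ^ (n - 1)\<close> and
  \<open>(- 1) ^ n\<close>, where \<open>n\<close> is the degree of \<open>t\<close>, and cancel.  The square is therefore determined by its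
  values on generators, although it is only half of the graded commutator of \<open>d\<close> with itself, and 2
  need not be invertible.
\<close>

lemma graded_derivation_square:
  assumes "graded_derivation R A A id_fun id_fun (- 1) d"
  shows "graded_derivation R A A id_fun id_fun (- 2) (\<lambda>x. d (d x))"
proof -
  interpret d: graded_derivation R A A id_fun id_fun "- 1" d by fact
  show ?thesis
  proof
    fix t u
    assume [simp]: "t \<in> Mor A" "u \<in> Mor A" "Dom A t = Cod A u"
    show "d (d (Cmp A t u)) = Add A (Cmp A (d (d t)) (Mmap id_fun u))
        (Scal A (sgn_unit R (- 2 * Deg A t)) (Cmp A (Mmap id_fun t) (d (d u))))"
      by (cases "even (Deg A t)") (simp_all add: sgn_unit_def d.F.dom.Add_assoc)
  qed simp_all
qed

text \<open>
  The shape in which the terms of a graded commutator, applied to a composite, arise: \<open>b, b'\<close> and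
  \<open>c, c'\<close> are the cross terms.
\<close>

lemma (in graded_category) Add_cross:
  assumes "\<And>z. z \<in> {a, b, c, e, a', b', c', e'} \<Longrightarrow>
      z \<in> Mor C \<and> Dom C z = x \<and> Cod C z = y \<and> Deg C z = n"
    and "Add C b b' = Zer C x y n" "Add C c c' = Zer C x y n"
  shows "Add C (Add C (Add C a b) (Add C c e)) (Add C (Add C a' c') (Add C b' e')) =
    Add C (Add C a a') (Add C e e')"
proof -
  have [simp]: "a \<in> Mor C" "b \<in> Mor C" "c \<in> Mor C" "e \<in> Mor C" "a' \<in> Mor C" "b' \<in> Mor C"
    "c' \<in> Mor C" "e' \<in> Mor C" "Dom C a = x" "Dom C b = x" "Dom C c = x" "Dom C e = x"
    "Dom C a' = x" "Dom C b' = x" "Dom C c' = x" "Dom C e' = x" "Cod C a = y" "Cod C b = y"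
    "Cod C c = y" "Cod C e = y" "Cod C a' = y" "Cod C b' = y" "Cod C c' = y" "Cod C e' = y"
    "Deg C a = n" "Deg C b = n" "Deg C c = n" "Deg C e = n" "Deg C a' = n" "Deg C b' = n"
    "Deg C c' = n" "Deg C e' = n"
    using assms(1) by auto
  have "Add C (Add C (Add C a b) (Add C c e)) (Add C (Add C a' c') (Add C b' e')) =
    Add C (Add C b b') (Add C (Add C c c') (Add C (Add C a a') (Add C e e')))"
    by (simp add: Add_ac)
  then show ?thesis by (simp add: assms(2,3))
qed

lemma graded_derivation_commutator:
  assumes "graded_derivation R A B F G 1 f"
    and "graded_derivation R A A id_fun id_fun (- 1) d"
    and "graded_derivation R B B id_fun id_fun (- 1) e"
    and [simp]: "\<And>x. x \<in> Mor A \<Longrightarrow> e (Mmap F x) = Mmap F (d x)"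
      "\<And>x. x \<in> Mor A \<Longrightarrow> e (Mmap G x) = Mmap G (d x)"
  shows "graded_derivation R A B F G 0 (\<lambda>x. Add B (e (f x)) (f (d x)))"
proof -
  interpret f: graded_derivation R A B F G 1 f by fact
  interpret d: graded_derivation R A A id_fun id_fun "- 1" d by fact
  interpret e: graded_derivation R B B id_fun id_fun "- 1" e by fact
  show ?thesis
  proof
    fix t u
    assume [simp]: "t \<in> Mor A" "u \<in> Mor A" "Dom A t = Cod A u"
    show "Add B (e (f (Cmp A t u))) (f (d (Cmp A t u))) =
        Add B (Cmp B (Add B (e (f t)) (f (d t))) (Mmap G u))
        (Scal B (sgn_unit R (0 * Deg A t)) (Cmp B (Mmap F t) (Add B (e (f u)) (f (d u)))))"
      by (cases "even (Deg A t)"; simp add: sgn_unit_def; rule f.F.cod.Add_cross; auto)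
  qed (simp_all add: f.F.cod.Add_ac)
qed

text \<open>
  In \<open>h (f (t u))\<close> the cross terms are \<open>H (f t) h (G u)\<close> and \<open>h (F t) K (f u)\<close>; both are zero
  under the hypotheses, and what is left is the Leibniz rule for \<open>h \<circ> f\<close>.
\<close>

lemma graded_derivation_compose:
  assumes "graded_derivation R A B F G p f" "graded_derivation R B C H K q h"
    and [simp]: "\<And>x. x \<in> Mor A \<Longrightarrow> h (Mmap F x) = Zer C (Omap H (Omap F (Dom A x))) (Omap H (Omap F (Cod A x))) (Deg A x + q)"
    and [simp]: "\<And>x. x \<in> Mor A \<Longrightarrow> Mmap H (f x) = Zer C (Omap H (Omap F (Dom A x))) (Omap H (Omap F (Cod A x))) (Deg A x + p)"
  shows "graded_derivation R A C (comp_fun H F) (comp_fun K G) (p + q) (\<lambda>x. h (f x))"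
proof -
  interpret f: graded_derivation R A B F G p f by fact
  interpret h: graded_derivation R B C H K q h by fact
  interpret HF: graded_functor R A C "comp_fun H F"
    using f.F.graded_functor_axioms h.F.graded_functor_axioms by (rule graded_functor_comp)
  interpret KG: graded_functor R A C "comp_fun K G"
    using f.G.graded_functor_axioms h.G.graded_functor_axioms by (rule graded_functor_comp)
  show ?thesis
  proof
    fix t u
    assume [simp]: "t \<in> Mor A" "u \<in> Mor A" "Dom A t = Cod A u"
    show "h (f (Cmp A t u)) = Add C (Cmp C (h (f t)) (Mmap (comp_fun K G) u))
        (Scal C (sgn_unit R ((p + q) * Deg A t)) (Cmp C (Mmap (comp_fun H F) t) (h (f u))))"
      by (simp add: comp_fun_def distrib_right)
  qed (simp_all add: comp_fun_def add.assoc)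
qed

section \<open>Derivations as functors to triangular matrices\<close>

text \<open>
  A morphism \<open>(a, f, b)\<close> of degree \<open>n\<close> stands for the upper triangular matrix with diagonal entries
  \<open>a\<close>, \<open>b\<close> of degree \<open>n\<close> and upper right entry \<open>f\<close> of degree \<open>n + p\<close>.  Composition is the matrix
  product with a Koszul sign; the sign is what makes the upper right entry of a product the Leibniz
  rule of a derivation of degree \<open>p\<close>.
\<close>

definition triangular ::
    "'a ring \<Rightarrow> ('a, 'o, 'm, 'z) grcat_scheme \<Rightarrow> int \<Rightarrow> ('a, 'o, 'm \<times> 'm \<times> 'm) grcat" where
  "triangular R B p =
     \<lparr>Obj = Obj B,
      Mor = {(a, f, b). a \<in> Mor B \<and> f \<in> Mor B \<and> b \<in> Mor B \<and>
        Dom B f = Dom B a \<and> Cod B f = Cod B a \<and> Deg B f = Deg B a + p \<and>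
        Dom B b = Dom B a \<and> Cod B b = Cod B a \<and> Deg B b = Deg B a},
      Dom = (\<lambda>(a, f, b). Dom B a),
      Cod = (\<lambda>(a, f, b). Cod B a),
      Deg = (\<lambda>(a, f, b). Deg B a),
      Ide = (\<lambda>x. (Ide B x, Zer B x x p, Ide B x)),
      Cmp = (\<lambda>(a, f, b) (a', f', b').
        (Cmp B a a', Add B (Cmp B f b') (Scal B (sgn_unit R (p * Deg B a)) (Cmp B a f')), Cmp B b b')),
      Zer = (\<lambda>x y n. (Zer B x y n, Zer B x y (n + p), Zer B x y n)),
      Add = (\<lambda>(a, f, b) (a', f', b'). (Add B a a', Add B f f', Add B b b')),
      Scal = (\<lambda>r (a, f, b). (Scal B r a, Scal B r f, Scal B r b))\<rparr>"

lemma in_Hom_triangular: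
  "t \<in> Hom (triangular R B p) x y n \<longleftrightarrow> (\<exists>a f b. t = (a, f, b) \<and> a \<in> Hom B x y n \<and>
     f \<in> Hom B x y (n + p) \<and> b \<in> Hom B x y n)"
  by (auto simp: in_Hom_iff triangular_def)

lemma graded_category_triangular:
  assumes "graded_category R B"
  shows "graded_category R (triangular R B p)"
proof -
  interpret graded_category R B by fact
  note [simp] = in_Hom_iff
  show ?thesis
  proof (rule graded_categoryI)
    show "cring R" by (rule base)
  qed (auto simp: triangular_def Add_ac Scal_plus distrib_left R.m_comm)
qed

definition tri_fun ::
    "('o, 'm, 'p, 'n) dgfun \<Rightarrow> ('m \<Rightarrow> 'n) \<Rightarrow> ('o, 'm, 'p, 'n) dgfun \<Rightarrow>
     ('o, 'm, 'p, 'n \<times> 'n \<times> 'n) dgfun" where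
  "tri_fun F f G = \<lparr>Omap = Omap F, Mmap = (\<lambda>t. (Mmap F t, f t, Mmap G t))\<rparr>"

lemma graded_functor_tri_fun:
  assumes "graded_derivation R A B F G p f"
  shows "graded_functor R A (triangular R B p) (tri_fun F f G)"
proof -
  interpret f: graded_derivation R A B F G p f by fact
  interpret T: graded_category R "triangular R B p"
    using f.F.cod.graded_category_axioms by (rule graded_category_triangular)
  show ?thesis
    by unfold_locales (simp_all add: triangular_def tri_fun_def)
qed

lemma graded_derivation_of_triangular:
  assumes H: "graded_functor R A (triangular R B p) H" and B: "graded_category R B"
  shows "graded_derivation R A B \<lparr>Omap = Omap H, Mmap = (\<lambda>t. fst (Mmap H t))\<rparr>
    \<lparr>Omap = Omap H, Mmap = (\<lambda>t. snd (snd (Mmap H t)))\<rparr> p (\<lambda>t. fst (snd (Mmap H t)))"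
proof -
  interpret H: graded_functor R A "triangular R B p" H by fact
  interpret B: graded_category R B by fact
  have 1: "Mmap H t \<in> Hom (triangular R B p) (Omap H (Dom A t)) (Omap H (Cod A t)) (Deg A t)"
    if "t \<in> Mor A" for t
    using that by (simp add: in_Hom_iff)
  have [simp]: "Omap H x \<in> Obj B" if "x \<in> Obj A" for x
    using H.Omap_Obj[OF that] by (simp add: triangular_def)
  have 2: "fst (Mmap H t) \<in> Mor B" "Dom B (fst (Mmap H t)) = Omap H (Dom A t)"
    "Cod B (fst (Mmap H t)) = Omap H (Cod A t)" "Deg B (fst (Mmap H t)) = Deg A t"
    "fst (snd (Mmap H t)) \<in> Mor B" "Dom B (fst (snd (Mmap H t))) = Omap H (Dom A t)"
    "Cod B (fst (snd (Mmap H t))) = Omap H (Cod A t)" "Deg B (fst (snd (Mmap H t))) = Deg A t + p"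
    "snd (snd (Mmap H t)) \<in> Mor B" "Dom B (snd (snd (Mmap H t))) = Omap H (Dom A t)"
    "Cod B (snd (snd (Mmap H t))) = Omap H (Cod A t)" "Deg B (snd (snd (Mmap H t))) = Deg A t"
    if "t \<in> Mor A" for t
    using 1[OF that, unfolded in_Hom_triangular] by (auto simp: in_Hom_iff)
  have 3: "Cmp (triangular R B p) s t =
      (Cmp B (fst s) (fst t), Add B (Cmp B (fst (snd s)) (snd (snd t)))
        (Scal B (sgn_unit R (p * Deg B (fst s))) (Cmp B (fst s) (fst (snd t)))),
       Cmp B (snd (snd s)) (snd (snd t)))"
    "Add (triangular R B p) s t =
      (Add B (fst s) (fst t), Add B (fst (snd s)) (fst (snd t)), Add B (snd (snd s)) (snd (snd t)))"
    "Scal (triangular R B p) r t = (Scal B r (fst t), Scal B r (fst (snd t)), Scal B r (snd (snd t)))"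
    "Ide (triangular R B p) x = (Ide B x, Zer B x x p, Ide B x)" for s t r x
    by (simp_all add: triangular_def split: prod.splits)
  show ?thesis by unfold_locales (simp_all add: 2 3)
qed

section \<open>Universal properties of presented categories\<close>

lemma parallel_refl [simp]: "parallel Q t t"
  by (simp add: parallel_def)

locale presentation =
  fixes R :: "'a ring" and Q :: "('o, 'g) quiver"
    and E :: "(('a, 'o, 'g) gterm \<times> ('a, 'o, 'g) gterm) set"
  assumes cring: "cring R"
    and Src_Vert: "g \<in> Arr Q \<Longrightarrow> Src Q g \<in> Vert Q"
    and Tgt_Vert: "g \<in> Arr Q \<Longrightarrow> Tgt Q g \<in> Vert Q"
begin

sublocale R: cring R by (rule cring)

lemma tdom_Vert [simp]: "wf_term R Q t \<Longrightarrow> tdom Q t \<in> Vert Q"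
  and tcod_Vert [simp]: "wf_term R Q t \<Longrightarrow> tcod Q t \<in> Vert Q"
  by (induction t) (auto simp: Src_Vert Tgt_Vert)

lemma tcong_wf: "tcong R Q E t u \<Longrightarrow> wf_term R Q t \<and> wf_term R Q u \<and> parallel Q t u"
  by (induction rule: tcong.induct) (auto simp: parallel_def)

lemma tclass_eq_iff: "wf_term R Q t \<Longrightarrow> tclass R Q E t = tclass R Q E u \<longleftrightarrow> tcong R Q E t u"
  unfolding tclass_def by (blast intro: tcong.refl tcong.sym tcong.trans)

lemma tcong_trep: "wf_term R Q t \<Longrightarrow> tcong R Q E t (trep (tclass R Q E t))"
  unfolding trep_def tclass_def by (rule someI2[of _ t]) (simp_all add: tcong.refl)

lemma trep_tclass [simp]:
  assumes "wf_term R Q t"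
  shows "wf_term R Q (trep (tclass R Q E t))" "tdom Q (trep (tclass R Q E t)) = tdom Q t"
    "tcod Q (trep (tclass R Q E t)) = tcod Q t" "tdeg Q (trep (tclass R Q E t)) = tdeg Q t"
  using tcong_wf[OF tcong_trep[OF assms]] by (simp_all add: parallel_def)

abbreviation "Pr \<equiv> presented R Q E"
abbreviation "cls \<equiv> tclass R Q E"

lemma presented_simps [simp]:
  "Obj Pr = Vert Q"
  "Ide Pr x = cls (TId x)"
  "Zer Pr x y n = cls (TZero x y n)"
  by (simp_all add: presented_def)

lemma presented_type [simp]:
  assumes "wf_term R Q t"
  shows "cls t \<in> Mor Pr" "Dom Pr (cls t) = tdom Q t" "Cod Pr (cls t) = tcod Q t"
    "Deg Pr (cls t) = tdeg Q t"
  using assms by (simp_all add: presented_def)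

lemma presented_Cmp [simp]:
  assumes "wf_term R Q t" "wf_term R Q u" "tdom Q t = tcod Q u"
  shows "Cmp Pr (cls t) (cls u) = cls (TComp t u)"
  using assms unfolding presented_def
  by (simp add: tclass_eq_iff) (intro tcong.comp_cong tcong_trep[THEN tcong.sym]; simp)

lemma presented_Add [simp]:
  assumes "wf_term R Q t" "wf_term R Q u" "parallel Q t u"
  shows "Add Pr (cls t) (cls u) = cls (TAdd t u)"
  using assms unfolding presented_def
  by (simp add: tclass_eq_iff parallel_def) (intro tcong.add_cong tcong_trep[THEN tcong.sym]; simp add: parallel_def)

lemma presented_Scal [simp]:
  assumes "wf_term R Q t" "a \<in> carrier R"
  shows "Scal Pr a (cls t) = cls (TScal a t)"
  using assms unfolding presented_def
  by (simp add: tclass_eq_iff) (intro tcong.scal_cong tcong_trep[THEN tcong.sym]; simp)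

lemma Mor_presentedE:
  assumes "X \<in> Hom Pr x y n"
  obtains t where "wf_term R Q t" "X = cls t" "tdom Q t = x" "tcod Q t = y" "tdeg Q t = n"
proof -
  have "X \<in> Mor Pr" using assms by (simp add: in_Hom_iff)
  then obtain t where t: "wf_term R Q t" "X = cls t" by (auto simp: presented_def)
  then show ?thesis using that assms by (simp add: in_Hom_iff)
qed

lemma cls_in_Hom:
  "wf_term R Q t \<Longrightarrow> cls t \<in> Hom Pr x y n \<longleftrightarrow> tdom Q t = x \<and> tcod Q t = y \<and> tdeg Q t = n"
  by (simp add: in_Hom_iff)

lemma cls_eqI: "tcong R Q E t u \<Longrightarrow> cls t = cls u"
  using tcong_wf tclass_eq_iff by blast

sublocale presented: graded_category R Pr
proof (rule graded_categoryI)
  show "cring R" by (rule cring)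
  note [elim!] = Mor_presentedE
  note [simp] = cls_in_Hom parallel_def tclass_eq_iff
  show "Dom Pr X \<in> Obj Pr \<and> Cod Pr X \<in> Obj Pr" if "X \<in> Mor Pr" for X
    using that by (auto simp: presented_def)
  fix x y n X Y
  assume X: "X \<in> Hom Pr x y n" and Y: "Y \<in> Hom Pr x y n"
  show "Add Pr X Y \<in> Hom Pr x y n" using X Y by auto
  show "Add Pr X Y = Add Pr Y X"
    using X Y by (elim Mor_presentedE, hypsubst, simp add: tcong.add_comm)
  show "Add Pr (Add Pr X Y) Z = Add Pr X (Add Pr Y Z)" if "Z \<in> Hom Pr x y n" for Z
    using X Y that by (elim Mor_presentedE, hypsubst, simp add: tcong.add_assoc)
  show "Scal Pr a (Add Pr X Y) = Add Pr (Scal Pr a X) (Scal Pr a Y)" if "a \<in> carrier R" for a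
    using X Y that by (elim Mor_presentedE, hypsubst, simp add: tcong.scal_add_right)
  show "Cmp Pr Z (Add Pr X Y) = Add Pr (Cmp Pr Z X) (Cmp Pr Z Y)" if "Z \<in> Hom Pr y z m" for z m Z
    using X Y that by (elim Mor_presentedE, hypsubst, simp add: tcong.comp_add_right)
  show "Cmp Pr (Add Pr X Y) Z = Add Pr (Cmp Pr X Z) (Cmp Pr Y Z)" if "Z \<in> Hom Pr z x m" for z m Z
    using X Y that by (elim Mor_presentedE, hypsubst, simp add: tcong.comp_add_left)
next
  note [elim!] = Mor_presentedE
  note [simp] = cls_in_Hom parallel_def tclass_eq_iff
  fix x y n X
  assume X: "X \<in> Hom Pr x y n"
  show "Add Pr (Zer Pr x y n) X = X"
    using X by (elim Mor_presentedE, hypsubst, simp add: tcong.add_zero)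
  show "Add Pr (Scal Pr (\<ominus>\<^bsub>R\<^esub> \<one>\<^bsub>R\<^esub>) X) X = Zer Pr x y n"
    using X by (elim Mor_presentedE, hypsubst, simp add: tcong.add_inv[of R Q _ E])
  show "Scal Pr \<one>\<^bsub>R\<^esub> X = X"
    using X by (elim Mor_presentedE, hypsubst, simp add: tcong.scal_one)
  show "Cmp Pr (Ide Pr y) X = X \<and> Cmp Pr X (Ide Pr x) = X"
    using X by (elim Mor_presentedE, hypsubst, simp add: tcong.id_left tcong.id_right)
  fix a assume a: "a \<in> carrier R"
  show "Scal Pr a X \<in> Hom Pr x y n" using a X by auto
  show "Scal Pr a (Scal Pr b X) = Scal Pr (a \<otimes>\<^bsub>R\<^esub> b) X" if "b \<in> carrier R" for b
    using a that X by (elim Mor_presentedE, hypsubst, simp add: tcong.scal_scal)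
  show "Scal Pr (a \<oplus>\<^bsub>R\<^esub> b) X = Add Pr (Scal Pr a X) (Scal Pr b X)" if "b \<in> carrier R" for b
    using a that X by (elim Mor_presentedE, hypsubst, simp add: tcong.scal_add_left)
  show "Cmp Pr (Scal Pr a Z) X = Scal Pr a (Cmp Pr Z X) \<and> Cmp Pr Z (Scal Pr a X) = Scal Pr a (Cmp Pr Z X)"
    if "Z \<in> Hom Pr y z m" for z m Z
    using a that X by (elim Mor_presentedE, hypsubst, simp add: tcong.comp_scal_left tcong.comp_scal_right)
next
  note [elim!] = Mor_presentedE
  note [simp] = cls_in_Hom parallel_def tclass_eq_iff
  fix X Y Z v x y z l m n
  assume Z: "Z \<in> Hom Pr y z l" and Y: "Y \<in> Hom Pr x y m"
  show "Cmp Pr Z Y \<in> Hom Pr x z (l + m)"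
    using Y Z by auto
  show "Cmp Pr (Cmp Pr Z Y) X = Cmp Pr Z (Cmp Pr Y X)" if "X \<in> Hom Pr v x n"
    using Z Y that by (elim Mor_presentedE, hypsubst, simp add: tcong.comp_assoc)
qed (auto simp: cls_in_Hom)

end

text \<open>
  \<open>teval\<close> leaves objects unchanged; functors that move objects, such as those of a lifting problem,
  need an evaluation that maps the vertices as well.
\<close>

primrec ext_eval ::
    "('o \<Rightarrow> 'p) \<Rightarrow> ('a, 'p, 'n, 'z) grcat_scheme \<Rightarrow> ('g \<Rightarrow> 'n) \<Rightarrow> ('a, 'o, 'g) gterm \<Rightarrow> 'n" where
  "ext_eval \<omega> B \<psi> (TGen g) = \<psi> g"
| "ext_eval \<omega> B \<psi> (TId x) = Ide B (\<omega> x)"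
| "ext_eval \<omega> B \<psi> (TZero x y n) = Zer B (\<omega> x) (\<omega> y) n"
| "ext_eval \<omega> B \<psi> (TAdd t u) = Add B (ext_eval \<omega> B \<psi> t) (ext_eval \<omega> B \<psi> u)"
| "ext_eval \<omega> B \<psi> (TScal a t) = Scal B a (ext_eval \<omega> B \<psi> t)"
| "ext_eval \<omega> B \<psi> (TComp t u) = Cmp B (ext_eval \<omega> B \<psi> t) (ext_eval \<omega> B \<psi> u)"

lemma teval_eq_ext_eval: "teval A \<phi> t = ext_eval (\<lambda>x. x) A \<phi> t"
  by (induction t) simp_all

text \<open>
  The data from which a universal property produces a functor: a typed interpretation of the
  generators in \<open>B\<close> that satisfies the relations.
\<close>

locale realization = presentation R Q E + B: graded_category R B
  for R :: "'a ring" and Q :: "('o, 'g) quiver" and E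
    and B :: "('a, 'p, 'n, 'z) grcat_scheme" +
  fixes \<omega> :: "'o \<Rightarrow> 'p" and \<psi> :: "'g \<Rightarrow> 'n"
  assumes Vert_Obj [simp]: "x \<in> Vert Q \<Longrightarrow> \<omega> x \<in> Obj B"
    and gen_Hom: "g \<in> Arr Q \<Longrightarrow> \<psi> g \<in> Hom B (\<omega> (Src Q g)) (\<omega> (Tgt Q g)) (Dg Q g)"
    and relations: "(t, u) \<in> E \<Longrightarrow> wf_term R Q t \<Longrightarrow> wf_term R Q u \<Longrightarrow>
      ext_eval \<omega> B \<psi> t = ext_eval \<omega> B \<psi> u"
begin

abbreviation "ev \<equiv> ext_eval \<omega> B \<psi>"

lemma ev_Hom: "wf_term R Q t \<Longrightarrow> ev t \<in> Hom B (\<omega> (tdom Q t)) (\<omega> (tcod Q t)) (tdeg Q t)"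
  by (induction t) (auto simp: gen_Hom, auto simp: in_Hom_iff parallel_def)

lemma ev_type [simp]:
  assumes "wf_term R Q t"
  shows "ev t \<in> Mor B" "Dom B (ev t) = \<omega> (tdom Q t)" "Cod B (ev t) = \<omega> (tcod Q t)"
    "Deg B (ev t) = tdeg Q t"
  using ev_Hom[OF assms] by (simp_all add: in_Hom_iff)

lemma ev_tcong: "tcong R Q E t u \<Longrightarrow> ev t = ev u"
proof (induction rule: tcong.induct)
  case (rel t u)
  then show ?case by (simp add: relations)
next
  case (add_comm t u)
  then show ?case by (auto simp: parallel_def intro: B.Add_comm)
qed (auto simp: parallel_def B.Add_assoc B.Scal_plus)

end

text \<open>
  \<open>A\<close> is isomorphic, via evaluation at \<open>\<phi>\<close>, to the category with generators \<open>Q\<close> and relations \<open>E\<close>.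
  Stating this for an arbitrary \<open>A\<close> makes the universal property available for the given category \<open>D\<close>
  as well as for the quotients of term algebras.
\<close>

locale presents = presentation R Q E + A: graded_category R A
  for R :: "'a ring" and Q :: "('o, 'g) quiver" and E
    and A :: "('a, 'o, 'm, 'z) grcat_scheme" +
  fixes \<phi> :: "'g \<Rightarrow> 'm"
  assumes Obj_eq [simp]: "Obj A = Vert Q"
    and gen_Hom: "g \<in> Arr Q \<Longrightarrow> \<phi> g \<in> Hom A (Src Q g) (Tgt Q g) (Dg Q g)"
    and generated: "x \<in> Mor A \<Longrightarrow> \<exists>t. wf_term R Q t \<and> teval A \<phi> t = x"
    and complete: "wf_term R Q t \<Longrightarrow> wf_term R Q u \<Longrightarrow> teval A \<phi> t = teval A \<phi> u \<Longrightarrow> tcong R Q E t u"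
begin

lemma gen_type [simp]:
  assumes "g \<in> Arr Q"
  shows "\<phi> g \<in> Mor A" "Dom A (\<phi> g) = Src Q g" "Cod A (\<phi> g) = Tgt Q g" "Deg A (\<phi> g) = Dg Q g"
  using gen_Hom[OF assms] by (simp_all add: in_Hom_iff)

lemma teval_type [simp]:
  assumes "wf_term R Q t"
  shows "teval A \<phi> t \<in> Mor A" "Dom A (teval A \<phi> t) = tdom Q t" "Cod A (teval A \<phi> t) = tcod Q t"
    "Deg A (teval A \<phi> t) = tdeg Q t"
  using assms by (induction t) (simp_all add: parallel_def)

lemma functor_eqI:
  assumes "graded_functor R A B H" "graded_functor R A B K"
    and "\<And>x. x \<in> Vert Q \<Longrightarrow> Omap H x = Omap K x"
    and "\<And>g. g \<in> Arr Q \<Longrightarrow> Mmap H (\<phi> g) = Mmap K (\<phi> g)"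
  shows "eq_fun A H K"
proof -
  interpret H: graded_functor R A B H by fact
  interpret K: graded_functor R A B K by fact
  have "Mmap H (teval A \<phi> t) = Mmap K (teval A \<phi> t)" if "wf_term R Q t" for t
    using that by (induction t) (simp_all add: assms(3,4) parallel_def)
  then show ?thesis
    using generated by (force simp: eq_fun_def assms(3))
qed

lemma derivation_eqI:
  assumes "graded_derivation R A B F G p f" "graded_derivation R A B F G p f'"
    and "\<And>g. g \<in> Arr Q \<Longrightarrow> f (\<phi> g) = f' (\<phi> g)"
    and "x \<in> Mor A"
  shows "f x = f' x"
proof -
  have "eq_fun A (tri_fun F f G) (tri_fun F f' G)"
    using assms(1,2)[THEN graded_functor_tri_fun]
    by (rule functor_eqI) (simp_all add: tri_fun_def assms(3))
  then show ?thesis using assms(4) by (simp add: eq_fun_def tri_fun_def)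
qed

text \<open>
  The functor evaluates a term that represents the given morphism; completeness of the relations
  makes the value independent of the term.
\<close>

lemma ex_functor:
  assumes "realization R Q E B \<omega> \<psi>"
  obtains H where "graded_functor R A B H" "Omap H = \<omega>" "\<And>g. g \<in> Arr Q \<Longrightarrow> Mmap H (\<phi> g) = \<psi> g"
proof -
  interpret r: realization R Q E B \<omega> \<psi> by fact
  define rp where "rp x = (SOME t. wf_term R Q t \<and> teval A \<phi> t = x)" for x
  have rp [simp]: "wf_term R Q (rp x)" "teval A \<phi> (rp x) = x" if "x \<in> Mor A" for x
    using someI_ex[OF generated[OF that]] by (simp_all add: rp_def)
  have rp_type [simp]: "tdom Q (rp x) = Dom A x" "tcod Q (rp x) = Cod A x" "tdeg Q (rp x) = Deg A x"
    if "x \<in> Mor A" for x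
    using teval_type[OF rp(1)[OF that]] that by simp_all
  define H where "H = \<lparr>Omap = \<omega>, Mmap = (\<lambda>x. r.ev (rp x))\<rparr>"
  have ev: "r.ev (rp x) = r.ev t" if "wf_term R Q t" "teval A \<phi> t = x" for x t
    using that by (intro r.ev_tcong complete) auto
  have "r.ev (rp (Ide A x)) = Ide B (\<omega> x)" if "x \<in> Vert Q" for x
    using ev[of "TId x" "Ide A x"] that by simp
  moreover have "r.ev (rp (Cmp A x y)) = Cmp B (r.ev (rp x)) (r.ev (rp y))"
    if "x \<in> Mor A" "y \<in> Mor A" "Dom A x = Cod A y" for x y
    using ev[of "TComp (rp x) (rp y)" "Cmp A x y"] that by simp
  moreover have "r.ev (rp (Add A x y)) = Add B (r.ev (rp x)) (r.ev (rp y))"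
    if "x \<in> Mor A" "y \<in> Mor A" "Dom A x = Dom A y" "Cod A x = Cod A y" "Deg A x = Deg A y" for x y
    using ev[of "TAdd (rp x) (rp y)" "Add A x y"] that by (simp add: parallel_def)
  moreover have "r.ev (rp (Scal A a x)) = Scal B a (r.ev (rp x))" if "a \<in> carrier R" "x \<in> Mor A" for a x
    using ev[of "TScal a (rp x)" "Scal A a x"] that by simp
  ultimately have "graded_functor R A B H"
    by unfold_locales (simp_all add: H_def)
  moreover have "Mmap H (\<phi> g) = \<psi> g" if "g \<in> Arr Q" for g
    using ev[of "TGen g" "\<phi> g"] that by (simp add: H_def)
  ultimately show ?thesis using that by (simp add: H_def)
qed

text \<open>
  The functor to triangular matrices given by the universal property has some diagonal entries; they
  agree with \<open>F\<close> and \<open>G\<close> on generators, hence everywhere.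
\<close>

lemma ex_derivation:
  assumes F: "graded_functor R A B F" and G: "graded_functor R A B G"
    and FG: "\<And>x. x \<in> Vert Q \<Longrightarrow> Omap G x = Omap F x"
    and r: "realization R Q E (triangular R B p) (Omap F) (\<lambda>g. (Mmap F (\<phi> g), \<delta> g, Mmap G (\<phi> g)))"
  obtains f where "graded_derivation R A B F G p f" "\<And>g. g \<in> Arr Q \<Longrightarrow> f (\<phi> g) = \<delta> g"
proof -
  interpret F: graded_functor R A B F by fact
  obtain H where H: "graded_functor R A (triangular R B p) H" "Omap H = Omap F"
    "\<And>g. g \<in> Arr Q \<Longrightarrow> Mmap H (\<phi> g) = (Mmap F (\<phi> g), \<delta> g, Mmap G (\<phi> g))"
    using ex_functor[OF r] by metis
  note d = graded_derivation_of_triangular[OF H(1) F.cod.graded_category_axioms]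
  interpret d: graded_derivation R A B "\<lparr>Omap = Omap H, Mmap = (\<lambda>t. fst (Mmap H t))\<rparr>"
    "\<lparr>Omap = Omap H, Mmap = (\<lambda>t. snd (snd (Mmap H t)))\<rparr>" p "\<lambda>t. fst (snd (Mmap H t))"
    by (rule d)
  have "eq_fun A \<lparr>Omap = Omap H, Mmap = (\<lambda>t. fst (Mmap H t))\<rparr> F"
    by (rule functor_eqI[OF d.F.graded_functor_axioms F]) (simp_all add: H)
  moreover have "eq_fun A \<lparr>Omap = Omap H, Mmap = (\<lambda>t. snd (snd (Mmap H t)))\<rparr> G"
    by (rule functor_eqI[OF d.G.graded_functor_axioms G]) (simp_all add: H FG)
  ultimately have "graded_derivation R A B F G p (\<lambda>t. fst (snd (Mmap H t)))"
    by (rule graded_derivation_cong[OF d]) simp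
  then show ?thesis by (rule that) (simp add: H)
qed

end

context presentation
begin

lemma teval_presented: "wf_term R Q t \<Longrightarrow> teval Pr (\<lambda>g. cls (TGen g)) t = cls t"
  by (induction t) auto

lemma presents_presented: "presents R Q E Pr (\<lambda>g. cls (TGen g))"
proof
  show "\<exists>t. wf_term R Q t \<and> teval Pr (\<lambda>g. cls (TGen g)) t = X" if "X \<in> Mor Pr" for X
    using that teval_presented by (auto simp: presented_def)
  show "tcong R Q E t u"
    if "wf_term R Q t" "wf_term R Q u"
      "teval Pr (\<lambda>g. cls (TGen g)) t = teval Pr (\<lambda>g. cls (TGen g)) u" for t u
    using that by (simp add: teval_presented tclass_eq_iff)
  show "cls (TGen g) \<in> Hom Pr (Src Q g) (Tgt Q g) (Dg Q g)" if "g \<in> Arr Q" for g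
    using that by (simp add: cls_in_Hom)
qed simp

lemma induced_fun_cls:
  assumes "realization R Q E B (\<lambda>x. x) \<psi>" "wf_term R Q t"
  shows "Mmap (induced_fun B \<psi>) (cls t) = teval B \<psi> t"
proof -
  interpret r: realization R Q E B "\<lambda>x. x" \<psi> by fact
  show ?thesis
    using r.ev_tcong[OF tcong_trep[OF assms(2)]]
    by (simp add: induced_fun_def teval_eq_ext_eval)
qed

text \<open>
  \<open>induced_fun\<close> is not defined by the universal property but by evaluating a chosen representative; it
  coincides with the functor that the universal property provides.
\<close>

lemma graded_functor_induced_fun:
  assumes "realization R Q E B (\<lambda>x. x) \<psi>"
  shows "graded_functor R Pr B (induced_fun B \<psi>)"
proof -
  interpret r: realization R Q E B "\<lambda>x. x" \<psi> by fact
  interpret P: presents R Q E Pr "\<lambda>g. cls (TGen g)" by (rule presents_presented)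
  obtain H where H: "graded_functor R Pr B H" "Omap H = (\<lambda>x. x)"
    "\<And>g. g \<in> Arr Q \<Longrightarrow> Mmap H (cls (TGen g)) = \<psi> g"
    using P.ex_functor[OF assms] by metis
  interpret H: graded_functor R Pr B H by fact
  have "Mmap H (teval Pr (\<lambda>g. cls (TGen g)) t) = teval B \<psi> t" if "wf_term R Q t" for t
    using that by (induction t) (simp_all add: H(2,3) parallel_def del: presented_simps(2,3))
  then have "Mmap H (cls t) = Mmap (induced_fun B \<psi>) (cls t)" if "wf_term R Q t" for t
    using that by (simp add: induced_fun_cls[OF assms] teval_presented)
  moreover have "Omap (induced_fun B \<psi>) x = x" for x
    by (simp add: induced_fun_def)
  moreover have "\<exists>t. wf_term R Q t \<and> X = cls t" if "X \<in> Mor Pr" for X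
    using that by (auto simp: presented_def)
  ultimately have "eq_fun Pr H (induced_fun B \<psi>)"
    unfolding eq_fun_def H(2) by metis
  with H(1) show ?thesis by (rule graded_functor_cong)
qed

end

lemma functor_relations_eval:
  assumes "graded_functor R K B H" "(t, u) \<in> functor_relations R K \<iota>"
    and "\<And>x. x \<in> Obj K \<Longrightarrow> \<omega> x = Omap H x"
    and "\<And>f. f \<in> Mor K \<Longrightarrow> \<psi> (\<iota> f) = Mmap H f"
  shows "ext_eval \<omega> B \<psi> t = ext_eval \<omega> B \<psi> u"
proof -
  interpret H: graded_functor R K B H by fact
  show ?thesis
    using assms(2) unfolding functor_relations_def
    by (auto simp: assms(3,4) in_Hom_iff)
qed

section \<open>Universal properties of free extensions\<close>

lemma functor_relationsI:
  "x \<in> Obj K \<Longrightarrow> (TGen (\<iota> (Ide K x)), TId x) \<in> functor_relations R K \<iota>"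
  "g \<in> Mor K \<Longrightarrow> f \<in> Mor K \<Longrightarrow> Dom K g = Cod K f \<Longrightarrow>
    (TGen (\<iota> (Cmp K g f)), TComp (TGen (\<iota> g)) (TGen (\<iota> f))) \<in> functor_relations R K \<iota>"
  "f \<in> Mor K \<Longrightarrow> g \<in> Mor K \<Longrightarrow> Dom K f = Dom K g \<Longrightarrow> Cod K f = Cod K g \<Longrightarrow> Deg K f = Deg K g \<Longrightarrow>
    (TGen (\<iota> (Add K f g)), TAdd (TGen (\<iota> f)) (TGen (\<iota> g))) \<in> functor_relations R K \<iota>"
  "a \<in> carrier R \<Longrightarrow> f \<in> Mor K \<Longrightarrow>
    (TGen (\<iota> (Scal K a f)), TScal a (TGen (\<iota> f))) \<in> functor_relations R K \<iota>"
  unfolding functor_relations_def in_Hom_iff by blast+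

lemma (in presentation) graded_functor_cls:
  assumes K: "graded_category R K" and Obj: "Obj K = Vert Q"
    and E: "functor_relations R K \<iota> \<subseteq> E"
    and \<iota>: "\<And>f. f \<in> Mor K \<Longrightarrow> \<iota> f \<in> Arr Q \<and> Src Q (\<iota> f) = Dom K f \<and> Tgt Q (\<iota> f) = Cod K f \<and>
      Dg Q (\<iota> f) = Deg K f"
  shows "graded_functor R K Pr \<lparr>Omap = (\<lambda>x. x), Mmap = (\<lambda>f. cls (TGen (\<iota> f)))\<rparr>"
proof -
  interpret K: graded_category R K by fact
  note [simp] = \<iota> Obj
  have rel: "cls t = cls u" if "(t, u) \<in> functor_relations R K \<iota>" "wf_term R Q t" "wf_term R Q u"
    "parallel Q t u" for t u
    using that E by (intro cls_eqI tcong.rel) auto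
  show ?thesis
  proof
    fix x assume [simp]: "x \<in> Obj K"
    have "cls (TGen (\<iota> (Ide K x))) = cls (TId x)"
      by (rule rel) (simp_all add: functor_relationsI parallel_def flip: Obj)
    then show "Mmap \<lparr>Omap = \<lambda>x. x, Mmap = \<lambda>f. cls (TGen (\<iota> f))\<rparr> (Ide K x) =
        Ide Pr (Omap \<lparr>Omap = \<lambda>x. x, Mmap = \<lambda>f. cls (TGen (\<iota> f))\<rparr> x)"
      by simp
  next
    fix t u assume tu [simp]: "t \<in> Mor K" "u \<in> Mor K" "Dom K t = Cod K u"
    have "cls (TGen (\<iota> (Cmp K t u))) = cls (TComp (TGen (\<iota> t)) (TGen (\<iota> u)))"
      using tu by (intro rel functor_relationsI) (simp_all add: parallel_def)
    then show "Mmap \<lparr>Omap = \<lambda>x. x, Mmap = \<lambda>f. cls (TGen (\<iota> f))\<rparr> (Cmp K t u) =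
        Cmp Pr (Mmap \<lparr>Omap = \<lambda>x. x, Mmap = \<lambda>f. cls (TGen (\<iota> f))\<rparr> t)
          (Mmap \<lparr>Omap = \<lambda>x. x, Mmap = \<lambda>f. cls (TGen (\<iota> f))\<rparr> u)"
      by simp
  next
    fix t u assume tu [simp]: "t \<in> Mor K" "u \<in> Mor K" "Dom K t = Dom K u" "Cod K t = Cod K u"
      "Deg K t = Deg K u"
    have "cls (TGen (\<iota> (Add K t u))) = cls (TAdd (TGen (\<iota> t)) (TGen (\<iota> u)))"
      using tu by (intro rel functor_relationsI) (simp_all add: parallel_def)
    then show "Mmap \<lparr>Omap = \<lambda>x. x, Mmap = \<lambda>f. cls (TGen (\<iota> f))\<rparr> (Add K t u) =
        Add Pr (Mmap \<lparr>Omap = \<lambda>x. x, Mmap = \<lambda>f. cls (TGen (\<iota> f))\<rparr> t)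
          (Mmap \<lparr>Omap = \<lambda>x. x, Mmap = \<lambda>f. cls (TGen (\<iota> f))\<rparr> u)"
      by (simp add: parallel_def)
  next
    fix a t assume at [simp]: "a \<in> carrier R" "t \<in> Mor K"
    have "cls (TGen (\<iota> (Scal K a t))) = cls (TScal a (TGen (\<iota> t)))"
      using at by (intro rel functor_relationsI) (simp_all add: parallel_def)
    then show "Mmap \<lparr>Omap = \<lambda>x. x, Mmap = \<lambda>f. cls (TGen (\<iota> f))\<rparr> (Scal K a t) =
        Scal Pr a (Mmap \<lparr>Omap = \<lambda>x. x, Mmap = \<lambda>f. cls (TGen (\<iota> f))\<rparr> t)"
      by simp
  qed simp_all
qed

lemma free_quiver_simps [simp]:
  "Vert (free_quiver K G) = Obj K" "Arr (free_quiver K G) = Inl ` Mor K \<union> Inr ` Arr G"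
  "Src (free_quiver K G) (Inl f) = Dom K f" "Tgt (free_quiver K G) (Inl f) = Cod K f"
  "Dg (free_quiver K G) (Inl f) = Deg K f" "Src (free_quiver K G) (Inr i) = Src G i"
  "Tgt (free_quiver K G) (Inr i) = Tgt G i" "Dg (free_quiver K G) (Inr i) = Dg G i"
  by (simp_all add: free_quiver_def)

lemma realization_free:
  assumes H: "graded_functor R K B H"
    and G: "\<And>i. i \<in> Arr G \<Longrightarrow> Src G i \<in> Obj K \<and> Tgt G i \<in> Obj K"
    and \<omega>: "\<And>x. x \<in> Obj K \<Longrightarrow> \<omega> x = Omap H x"
    and \<psi>: "\<And>f. f \<in> Mor K \<Longrightarrow> \<psi> (Inl f) = Mmap H f"
    and \<psi>_gen: "\<And>i. i \<in> Arr G \<Longrightarrow> \<psi> (Inr i) \<in> Hom B (\<omega> (Src G i)) (\<omega> (Tgt G i)) (Dg G i)"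
  shows "realization R (free_quiver K G) (functor_relations R K Inl) B \<omega> \<psi>"
proof -
  interpret H: graded_functor R K B H by fact
  show ?thesis
  proof
    show "ext_eval \<omega> B \<psi> t = ext_eval \<omega> B \<psi> u" if "(t, u) \<in> functor_relations R K Inl" for t u
      using H that \<omega> \<psi> by (rule functor_relations_eval)
  qed (use \<omega> G \<psi>_gen in \<open>auto simp: \<psi> in_Hom_iff H.dom.base\<close>)
qed

text \<open>
  \<open>A\<close> is, as a graded category, freely generated over \<open>K\<close> along \<open>J\<close> by the morphisms \<open>\<sigma> i\<close>.  The
  instances are \<open>D\<close> over \<open>C\<close> with generators \<open>s \<alpha>\<close>, and the cylinder over \<open>P\<close> with generators
  \<open>sbar \<alpha>\<close>.
\<close>

locale free_over = J: graded_functor R K A J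
  for R :: "'a ring"
    and K :: "('a, 'o, 'm, 'z) grcat_scheme"
    and A :: "('a, 'o, 'n, 'y) grcat_scheme"
    and J :: "('o, 'm, 'o, 'n) dgfun" +
  fixes G :: "('o, 'i) quiver" and \<sigma> :: "'i \<Rightarrow> 'n"
  assumes Omap_J [simp]: "x \<in> Obj K \<Longrightarrow> Omap J x = x"
    and presents: "presents R (free_quiver K G) (functor_relations R K Inl) A (case_sum (Mmap J) \<sigma>)"
begin

sublocale pres: presents R "free_quiver K G" "functor_relations R K Inl" A "case_sum (Mmap J) \<sigma>"
  by (rule presents)

lemma Src_Obj: "i \<in> Arr G \<Longrightarrow> Src G i \<in> Obj K" and Tgt_Obj: "i \<in> Arr G \<Longrightarrow> Tgt G i \<in> Obj K"
  using pres.Src_Vert[of "Inr i"] pres.Tgt_Vert[of "Inr i"] by simp_all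

lemma gen_type:
  assumes "i \<in> Arr G"
  shows "\<sigma> i \<in> Mor A" "Dom A (\<sigma> i) = Src G i" "Cod A (\<sigma> i) = Tgt G i" "Deg A (\<sigma> i) = Dg G i"
  using pres.gen_type[of "Inr i"] assms by simp_all

lemma functor_eqI:
  assumes "graded_functor R A B H" "graded_functor R A B L"
    and "\<And>x. x \<in> Obj K \<Longrightarrow> Omap H x = Omap L x"
    and "\<And>x. x \<in> Mor K \<Longrightarrow> Mmap H (Mmap J x) = Mmap L (Mmap J x)"
    and "\<And>i. i \<in> Arr G \<Longrightarrow> Mmap H (\<sigma> i) = Mmap L (\<sigma> i)"
  shows "eq_fun A H L"
  using assms(1,2) by (rule pres.functor_eqI) (auto simp: assms)

lemma derivation_eqI:
  assumes "graded_derivation R A B H L p f" "graded_derivation R A B H L p f'"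
    and "\<And>x. x \<in> Mor K \<Longrightarrow> f (Mmap J x) = f' (Mmap J x)"
    and "\<And>i. i \<in> Arr G \<Longrightarrow> f (\<sigma> i) = f' (\<sigma> i)"
    and "x \<in> Mor A"
  shows "f x = f' x"
  using assms(1,2) _ assms(5) by (rule pres.derivation_eqI) (auto simp: assms)

lemma ex_functor:
  assumes u: "graded_functor R K B u"
    and b: "\<And>i. i \<in> Arr G \<Longrightarrow> b i \<in> Hom B (Omap u (Src G i)) (Omap u (Tgt G i)) (Dg G i)"
  obtains H where "graded_functor R A B H" "Omap H = Omap u"
    "\<And>x. x \<in> Mor K \<Longrightarrow> Mmap H (Mmap J x) = Mmap u x" "\<And>i. i \<in> Arr G \<Longrightarrow> Mmap H (\<sigma> i) = b i"
proof -
  have "realization R (free_quiver K G) (functor_relations R K Inl) B (Omap u) (case_sum (Mmap u) b)"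
    using u by (rule realization_free) (simp_all add: b Src_Obj Tgt_Obj)
  then obtain H where H: "graded_functor R A B H" "Omap H = Omap u"
    "\<And>g. g \<in> Arr (free_quiver K G) \<Longrightarrow> Mmap H (case_sum (Mmap J) \<sigma> g) = case_sum (Mmap u) b g"
    by (rule pres.ex_functor) blast
  show ?thesis
    using H(3)[of "Inl x" for x] H(3)[of "Inr i" for i] by (intro that[OF H(1,2)]) simp_all
qed

lemma ex_derivation:
  assumes H: "graded_functor R A B H" and L: "graded_functor R A B L"
    and HL: "\<And>x. x \<in> Obj A \<Longrightarrow> Omap L x = Omap H x"
    and \<delta>: "graded_derivation R K B (comp_fun H J) (comp_fun L J) p \<delta>"
    and b: "\<And>i. i \<in> Arr G \<Longrightarrow> b i \<in> Hom B (Omap H (Src G i)) (Omap H (Tgt G i)) (Dg G i + p)"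
  obtains f where "graded_derivation R A B H L p f"
    "\<And>x. x \<in> Mor K \<Longrightarrow> f (Mmap J x) = \<delta> x" "\<And>i. i \<in> Arr G \<Longrightarrow> f (\<sigma> i) = b i"
proof -
  interpret H: graded_functor R A B H by fact
  interpret L: graded_functor R A B L by fact
  have tri: "(Mmap H (\<sigma> i), b i, Mmap L (\<sigma> i)) \<in> Hom (triangular R B p) (Omap H (Src G i))
      (Omap H (Tgt G i)) (Dg G i)" if "i \<in> Arr G" for i
    using b[OF that] that Src_Obj[OF that] Tgt_Obj[OF that]
    by (simp add: in_Hom_triangular, simp add: in_Hom_iff HL gen_type)
  have r: "realization R (free_quiver K G) (functor_relations R K Inl) (triangular R B p) (Omap H)
    (\<lambda>g. (Mmap H (case_sum (Mmap J) \<sigma> g), case_sum \<delta> b g, Mmap L (case_sum (Mmap J) \<sigma> g)))"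
    using graded_functor_tri_fun[OF \<delta>]
    by (rule realization_free) (simp_all add: Src_Obj Tgt_Obj tri_fun_def comp_fun_def tri)
  obtain f where f: "graded_derivation R A B H L p f"
    "\<And>g. g \<in> Arr (free_quiver K G) \<Longrightarrow> f (case_sum (Mmap J) \<sigma> g) = case_sum \<delta> b g"
    by (rule pres.ex_derivation[OF H L _ r]) (simp_all add: HL)
  show ?thesis
    using f(2)[of "Inl x" for x] f(2)[of "Inr i" for i] by (intro that[OF f(1)]) simp_all
qed

end

lemma free_over_free_extension:
  assumes K: "graded_category R K"
    and G: "\<And>i. i \<in> Arr G \<Longrightarrow> Src G i \<in> Obj K \<and> Tgt G i \<in> Obj K"
  shows "free_over R K (free_extension R K G) (free_base R K G) G (free_gen R K G)"
proof -
  interpret K: graded_category R K by fact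
  interpret p: presentation R "free_quiver K G" "functor_relations R K Inl"
    using G by unfold_locales (auto simp: K.base)
  have J: "graded_functor R K (free_extension R K G) (free_base R K G)"
    unfolding free_extension_def free_base_def using K
    by (rule p.graded_functor_cls) simp_all
  have eq: "case_sum (Mmap (free_base R K G)) (free_gen R K G) = (\<lambda>g. p.cls (TGen g))"
    by (rule ext) (auto simp: free_base_def free_gen_def split: sum.split)
  have "presents R (free_quiver K G) (functor_relations R K Inl) (free_extension R K G)
      (case_sum (Mmap (free_base R K G)) (free_gen R K G))"
    unfolding eq free_extension_def by (rule p.presents_presented)
  then show ?thesis
    using J by (intro free_over.intro free_over_axioms.intro) (simp_all add: free_base_def)
qed

lemma gen_quiver_simps [simp]:
  "Arr (gen_quiver D I s k) = I" "Src (gen_quiver D I s k) i = Dom D (s i)"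
  "Tgt (gen_quiver D I s k) i = Cod D (s i)" "Dg (gen_quiver D I s k) i = Deg D (s i) + k"
  by (simp_all add: gen_quiver_def)

text \<open>
  Injectivity of the evaluation functor is the completeness of the relations, surjectivity is
  generation.
\<close>

lemma free_over_freely_generated:
  assumes F: "graded_functor R C D F" and Obj: "Obj C = Obj D" "\<And>x. x \<in> Obj C \<Longrightarrow> Omap F x = x"
    and free: "freely_generated R C D F I s"
  shows "free_over R C D F (gen_quiver D I s 0) s"
proof -
  interpret F: graded_functor R C D F by fact
  let ?Q = "free_quiver C (gen_quiver D I s 0)" and ?E = "functor_relations R C Inl"
  let ?\<phi> = "case_sum (Mmap F) s"
  have s: "s i \<in> Mor D" if "i \<in> I" for i
    using free that unfolding freely_generated_def by blast
  have bij: "bij_betw (Mmap (induced_fun D ?\<phi>)) (Mor (presented R ?Q ?E)) (Mor D)"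
    using free by (simp add: freely_generated_def free_extension_def)
  have r: "realization R ?Q ?E D (\<lambda>x. x) ?\<phi>"
    using F by (rule realization_free) (simp_all add: s Obj(1) Obj(2)[unfolded Obj(1)] in_Hom_iff)
  interpret r: realization R ?Q ?E D "\<lambda>x. x" ?\<phi> by (rule r)
  note cls = r.induced_fun_cls[OF r]
  have "presents R ?Q ?E D ?\<phi>"
  proof
    show "\<exists>t. wf_term R ?Q t \<and> teval D ?\<phi> t = x" if "x \<in> Mor D" for x
    proof -
      have "x \<in> Mmap (induced_fun D ?\<phi>) ` Mor (presented R ?Q ?E)"
        unfolding bij_betw_imp_surj_on[OF bij] by (fact that)
      then obtain X where X: "X \<in> Mor (presented R ?Q ?E)" "Mmap (induced_fun D ?\<phi>) X = x"
        by (elim imageE) simp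
      obtain t where t: "wf_term R ?Q t" "X = r.cls t"
        using X(1) unfolding presented_def by auto
      have "teval D ?\<phi> t = x" using X(2) t cls by metis
      with t(1) show ?thesis by blast
    qed
    show "tcong R ?Q ?E t u"
      if "wf_term R ?Q t" "wf_term R ?Q u" "teval D ?\<phi> t = teval D ?\<phi> u" for t u
    proof -
      have "r.cls t = r.cls u"
        using bij_betw_imp_inj_on[OF bij] by (rule inj_onD) (simp_all add: that cls)
      then show ?thesis using that by (simp add: r.tclass_eq_iff)
    qed
  qed (use r.gen_Hom in \<open>simp_all add: Obj(1)\<close>)
  then show ?thesis
    by (intro free_over.intro free_over_axioms.intro F Obj(2))
qed

section \<open>Constructing dg categories and dg functors\<close>

lemma dg_functor_imp_graded_functor:
  assumes "dg_functor R C D F"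
  shows "graded_functor R C D F"
proof -
  interpret F: dg_functor R C D F by fact
  show ?thesis
  proof
    fix t assume "t \<in> Mor C"
    then have "Mmap F t \<in> Hom D (Omap F (Dom C t)) (Omap F (Cod C t)) (Deg C t)"
      by (intro F.Mmap_closed) (simp add: in_Hom_iff)
    then show "Mmap F t \<in> Mor D" "Dom D (Mmap F t) = Omap F (Dom C t)"
      "Cod D (Mmap F t) = Omap F (Cod C t)" "Deg D (Mmap F t) = Deg C t"
      by (simp_all add: in_Hom_iff)
  next
    fix t u assume "t \<in> Mor C" "u \<in> Mor C" "Dom C t = Cod C u"
    then show "Mmap F (Cmp C t u) = Cmp D (Mmap F t) (Mmap F u)"
      by (intro F.Mmap_Cmp) (auto simp: in_Hom_iff)
  next
    fix t u
    assume "t \<in> Mor C" "u \<in> Mor C" "Dom C t = Dom C u" "Cod C t = Cod C u" "Deg C t = Deg C u"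
    then show "Mmap F (Add C t u) = Add D (Mmap F t) (Mmap F u)"
      by (intro F.Mmap_Add) (auto simp: in_Hom_iff)
  qed (simp_all add: F.Omap_closed F.Mmap_Ide F.Mmap_Scal)
qed

lemma dg_category_imp_graded_derivation:
  assumes "dg_category R C"
  shows "graded_derivation R C C id_fun id_fun (- 1) (Diff C)"
proof -
  interpret dg_category R C by fact
  show ?thesis
    using graded_functor_id[OF graded_category_axioms] graded_functor_id[OF graded_category_axioms] _
      Diff_derivation by (rule graded_derivationI) simp
qed

lemma with_diff_simps [simp]:
  "Obj (with_diff A d) = Obj A" "Mor (with_diff A d) = Mor A" "Dom (with_diff A d) = Dom A"
  "Cod (with_diff A d) = Cod A" "Deg (with_diff A d) = Deg A" "Ide (with_diff A d) = Ide A"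
  "Cmp (with_diff A d) = Cmp A" "Zer (with_diff A d) = Zer A" "Add (with_diff A d) = Add A"
  "Scal (with_diff A d) = Scal A" "Diff (with_diff A d) = d" "Hom (with_diff A d) = Hom A"
  "hom_module (with_diff A d) = hom_module A"
  by (simp_all add: with_diff_def grcat.defs fun_eq_iff Hom_def hom_module_def)

lemma graded_category_with_diff [simp]:
  "graded_category R (with_diff A d) \<longleftrightarrow> graded_category R A"
  by (simp add: graded_category_def)

lemma graded_functor_with_diff [simp]:
  "graded_functor R (with_diff A d) B F \<longleftrightarrow> graded_functor R A B F"
  "graded_functor R A' (with_diff B' d) F' \<longleftrightarrow> graded_functor R A' B' F'"
  by (simp_all add: graded_functor_def graded_functor_axioms_def)

lemma graded_derivation_with_diff [simp]:
  "graded_derivation R (with_diff A d) B F G p f \<longleftrightarrow> graded_derivation R A B F G p f"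
  "graded_derivation R A' (with_diff B' d) F' G' p f' \<longleftrightarrow> graded_derivation R A' B' F' G' p f'"
  by (simp_all add: graded_derivation_def graded_derivation_axioms_def)

lemma dg_categoryI:
  assumes "graded_derivation R A A id_fun id_fun (- 1) (Diff A)"
    and "\<And>x. x \<in> Mor A \<Longrightarrow> Diff A (Diff A x) = zero_derivation A A id_fun (- 2) x"
  shows "dg_category R A"
proof -
  interpret d: graded_derivation R A A id_fun id_fun "- 1" "Diff A" by fact
  show ?thesis
    using d.derivation d.F.dom.graded_category_axioms assms(2)
    by (intro dg_category.intro dg_category_axioms.intro)
      (auto simp: in_Hom_iff zero_derivation_def)
qed

lemma dg_functorI:
  assumes "dg_category R A" "dg_category R B" "graded_functor R A B F"
    and "\<And>x. x \<in> Mor A \<Longrightarrow> Mmap F (Diff A x) = Diff B (Mmap F x)"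
  shows "dg_functor R A B F"
proof -
  interpret F: graded_functor R A B F by fact
  show ?thesis
    using assms(1,2,4)
    by (intro dg_functor.intro dg_functor_axioms.intro) (simp_all add: in_Hom_iff)
qed

lemma dg_functor_comp:
  assumes "dg_functor R A B H" "dg_functor R B E L"
  shows "dg_functor R A E (comp_fun L H)"
proof -
  interpret H: dg_functor R A B H by fact
  interpret L: dg_functor R B E L by fact
  interpret H': graded_functor R A B H by (rule dg_functor_imp_graded_functor) fact
  show ?thesis
    using H.dom.dg_category_axioms L.cod.dg_category_axioms
      graded_functor_comp[OF assms[THEN dg_functor_imp_graded_functor]]
    by (rule dg_functorI) (simp add: H.Mmap_Diff L.Mmap_Diff)
qed

text \<open>
  The definite description in \<open>the_derivation\<close> ranges over extensional functions; a derivation that is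
  unique on morphisms becomes unique after restriction.
\<close>

lemma the_derivation_props:
  assumes f: "graded_derivation R A B F G p f" "P f"
    and unique: "\<And>f f' x. graded_derivation R A B F G p f \<Longrightarrow> P f \<Longrightarrow>
      graded_derivation R A B F G p f' \<Longrightarrow> P f' \<Longrightarrow> x \<in> Mor A \<Longrightarrow> f x = f' x"
    and restrict: "P (restrict f (Mor A))"
  shows "graded_derivation R A B F G p (the_derivation R A B F G p P)"
    and "P (the_derivation R A B F G p P)"
proof -
  interpret f: graded_derivation R A B F G p f by (rule f)
  let ?f = "restrict f (Mor A)"
  have F: "graded_derivation R A B F G p h" if "derivation R A B F G p h" for h
    using f.F.graded_functor_axioms f.G.graded_functor_axioms f.Omap_agree that
    by (rule graded_derivationI)
  have der: "graded_derivation R A B F G p ?f"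
    using f(1) by (rule graded_derivation_cong) (simp_all add: eq_fun_def)
  have "the_derivation R A B F G p P = ?f"
    unfolding the_derivation_def
  proof (rule the_equality)
    show "?f \<in> extensional (Mor A) \<and> derivation R A B F G p ?f \<and> P ?f"
      using graded_derivation.derivation[OF der] restrict by simp
    fix h assume h: "h \<in> extensional (Mor A) \<and> derivation R A B F G p h \<and> P h"
    then have "h x = ?f x" if "x \<in> Mor A" for x
      using unique[OF F[of h] _ der restrict that] by blast
    with h show "h = ?f" by (intro extensionalityI[of h "Mor A" ?f]) auto
  qed
  then show "graded_derivation R A B F G p (the_derivation R A B F G p P)"
    and "P (the_derivation R A B F G p P)"
    using der restrict by simp_all
qed


section \<open>The coproduct of two copies of a dg category\<close>

locale dg_under = dg_functor R C D F
  for R :: "'a ring"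
    and C :: "('a, 'o, 'm) dgcat"
    and D :: "('a, 'o, 'n) dgcat"
    and F :: "('o, 'm, 'o, 'n) dgfun" +
  assumes Obj_C: "Obj C = Obj D"
    and Omap_F [simp]: "x \<in> Obj C \<Longrightarrow> Omap F x = x"
begin

sublocale F: graded_functor R C D F
  by (rule dg_functor_imp_graded_functor) (rule dg_functor_axioms)

sublocale C: graded_derivation R C C id_fun id_fun "- 1" "Diff C"
  by (rule dg_category_imp_graded_derivation) (rule dom.dg_category_axioms)

sublocale D: graded_derivation R D D id_fun id_fun "- 1" "Diff D"
  by (rule dg_category_imp_graded_derivation) (rule cod.dg_category_axioms)

text \<open>
  \<open>P0\<close> is the underlying graded category of \<open>P\<close>.  The existence of the differential of \<open>P\<close> is a statement
  about derivations of \<open>P0\<close>, so \<open>P0\<close> has to be treated first.  The same goes for \<open>Y0\<close> and \<open>Y\<close> below.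
\<close>

abbreviation "Q \<equiv> cop_quiver D"
abbreviation "E \<equiv> cop_relations R C D F"
abbreviation "P0 \<equiv> graded_coproduct R C D F"
abbreviation "P \<equiv> coproduct_under R C D F"
abbreviation "in1 \<equiv> cop_in1 R C D F"
abbreviation "in2 \<equiv> cop_in2 R C D F"

lemma Q_simps [simp]:
  "Vert Q = Obj D" "Arr Q = Inl ` Mor D \<union> Inr ` Mor D"
  "Src Q (Inl f) = Dom D f" "Tgt Q (Inl f) = Cod D f" "Dg Q (Inl f) = Deg D f"
  "Src Q (Inr f) = Dom D f" "Tgt Q (Inr f) = Cod D f" "Dg Q (Inr f) = Deg D f"
  by (simp_all add: cop_quiver_def)

sublocale Q: presentation R Q E
  by unfold_locales (auto simp: dom.base)

sublocale P0: presents R Q E P0 "\<lambda>g. Q.cls (TGen g)"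
  unfolding graded_coproduct_def by (rule Q.presents_presented)

lemma in_simps [simp]: "Omap in1 x = x" "Omap in2 x = x"
  by (simp_all add: cop_in_def)

lemma cls_eq_in:
  "Q.cls (TGen (Inl f)) = Mmap in1 f" "Q.cls (TGen (Inr f)) = Mmap in2 f"
  by (simp_all add: cop_in_def)

sublocale in1: graded_functor R D P0 in1
  unfolding graded_coproduct_def cop_in_def
  by (rule Q.graded_functor_cls) (auto simp: cop_relations_def cod.graded_category_axioms)

sublocale in2: graded_functor R D P0 in2
  unfolding graded_coproduct_def cop_in_def
  by (rule Q.graded_functor_cls) (auto simp: cop_relations_def cod.graded_category_axioms)

lemma in2_F: "c \<in> Mor C \<Longrightarrow> Mmap in2 (Mmap F c) = Mmap in1 (Mmap F c)"
  unfolding cls_eq_in[symmetric]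
  by (rule Q.cls_eqI, rule tcong.sym, rule tcong.rel) (auto simp: cop_relations_def parallel_def)

lemma coproduct_derivation_eqI:
  assumes "graded_derivation R P0 B H L p f" "graded_derivation R P0 B H L p f'"
    and "\<And>x. x \<in> Mor D \<Longrightarrow> f (Mmap in1 x) = f' (Mmap in1 x)"
    and "\<And>x. x \<in> Mor D \<Longrightarrow> f (Mmap in2 x) = f' (Mmap in2 x)"
    and "x \<in> Mor P0"
  shows "f x = f' x"
  using assms(1,2) _ assms(5) by (rule P0.derivation_eqI) (auto simp: assms cls_eq_in)

lemma realization_coproduct:
  assumes H: "graded_functor R D B H" and L: "graded_functor R D B L"
    and \<omega>: "\<And>x. x \<in> Obj D \<Longrightarrow> \<omega> x = Omap H x" "\<And>x. x \<in> Obj D \<Longrightarrow> \<omega> x = Omap L x"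
    and \<psi>: "\<And>f. f \<in> Mor D \<Longrightarrow> \<psi> (Inl f) = Mmap H f" "\<And>f. f \<in> Mor D \<Longrightarrow> \<psi> (Inr f) = Mmap L f"
    and F: "\<And>c. c \<in> Mor C \<Longrightarrow> Mmap H (Mmap F c) = Mmap L (Mmap F c)"
  shows "realization R Q E B \<omega> \<psi>"
proof -
  interpret H: graded_functor R D B H by fact
  interpret L: graded_functor R D B L by fact
  show ?thesis
  proof
    fix t u :: "('a, 'o, 'n + 'n) gterm"
    assume "(t, u) \<in> E"
    then consider "(t, u) \<in> functor_relations R D Inl" | "(t, u) \<in> functor_relations R D Inr"
      | c where "c \<in> Mor C" "t = TGen (Inl (Mmap F c))" "u = TGen (Inr (Mmap F c))"
      unfolding cop_relations_def by blast
    then show "ext_eval \<omega> B \<psi> t = ext_eval \<omega> B \<psi> u"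
    proof cases
      case 1
      with H show ?thesis using \<omega>(1) \<psi>(1) by (rule functor_relations_eval)
    next
      case 2
      with L show ?thesis using \<omega>(2) \<psi>(2) by (rule functor_relations_eval)
    next
      case 3
      then show ?thesis by (simp add: \<psi> F)
    qed
  next
    fix g assume "g \<in> Arr Q"
    then consider f where "f \<in> Mor D" "g = Inl f" | f where "f \<in> Mor D" "g = Inr f" by auto
    then show "\<psi> g \<in> Hom B (\<omega> (Src Q g)) (\<omega> (Tgt Q g)) (Dg Q g)"
    proof cases
      case 1 then show ?thesis by (simp add: \<psi> \<omega>(1) in_Hom_iff)
    next
      case 2 then show ?thesis by (simp add: \<psi> \<omega>(2) in_Hom_iff)
    qed
  qed (simp add: \<omega>(1))
qed

lemma ex_coproduct_derivation:
  assumes H: "graded_functor R P0 B H" and L: "graded_functor R P0 B L"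
    and HL: "\<And>x. x \<in> Obj D \<Longrightarrow> Omap L x = Omap H x"
    and \<delta>1: "graded_derivation R D B (comp_fun H in1) (comp_fun L in1) p \<delta>1"
    and \<delta>2: "graded_derivation R D B (comp_fun H in2) (comp_fun L in2) p \<delta>2"
    and \<delta>: "\<And>c. c \<in> Mor C \<Longrightarrow> \<delta>1 (Mmap F c) = \<delta>2 (Mmap F c)"
  obtains f where "graded_derivation R P0 B H L p f"
    "\<And>x. x \<in> Mor D \<Longrightarrow> f (Mmap in1 x) = \<delta>1 x" "\<And>x. x \<in> Mor D \<Longrightarrow> f (Mmap in2 x) = \<delta>2 x"
proof -
  have r: "realization R Q E (triangular R B p) (Omap H)
    (\<lambda>g. (Mmap H (Q.cls (TGen g)), case_sum \<delta>1 \<delta>2 g, Mmap L (Q.cls (TGen g))))"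
    using graded_functor_tri_fun[OF \<delta>1] graded_functor_tri_fun[OF \<delta>2]
    by (rule realization_coproduct) (simp_all add: tri_fun_def cls_eq_in in2_F \<delta>)
  obtain f where f: "graded_derivation R P0 B H L p f"
    "\<And>g. g \<in> Arr Q \<Longrightarrow> f (Q.cls (TGen g)) = case_sum \<delta>1 \<delta>2 g"
    by (rule P0.ex_derivation[OF H L _ r]) (simp_all add: HL)
  show ?thesis
    using f(2)[of "Inl x" for x] f(2)[of "Inr x" for x]
    by (intro that[OF f(1)]) (simp_all add: cls_eq_in)
qed

lemma Diff_F [simp]: "c \<in> Mor C \<Longrightarrow> Diff D (Mmap F c) = Mmap F (Diff C c)"
  by (simp add: Mmap_Diff)

text \<open>
  The two differentials agree on \<open>C\<close>, so they extend to a derivation of \<open>P\<close>, and since \<open>P\<close> is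
  generated by both copies of \<open>D\<close>, to only one.
\<close>

lemma coproduct_Diff:
  shows "graded_derivation R P0 P0 id_fun id_fun (- 1) (Diff P)"
    and Diff_in: "f \<in> Mor D \<Longrightarrow> Diff P (Mmap in1 f) = Mmap in1 (Diff D f)"
      "f \<in> Mor D \<Longrightarrow> Diff P (Mmap in2 f) = Mmap in2 (Diff D f)"
proof -
  note id = graded_functor_id[OF P0.A.graded_category_axioms]
  define S where "S = (\<lambda>d. \<forall>f\<in>Mor D. d (Mmap in1 f) = Mmap in1 (Diff D f) \<and>
     d (Mmap in2 f) = Mmap in2 (Diff D f))"
  have 1: "graded_derivation R D P0 (comp_fun id_fun in1) (comp_fun id_fun in1) (- 1)
      (\<lambda>x. Mmap in1 (Diff D x))"
    using graded_derivation_comp_left[OF D.graded_derivation_axioms in1.graded_functor_axioms]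
    by (rule graded_derivation_cong) (simp_all add: eq_fun_def)
  have 2: "graded_derivation R D P0 (comp_fun id_fun in2) (comp_fun id_fun in2) (- 1)
      (\<lambda>x. Mmap in2 (Diff D x))"
    using graded_derivation_comp_left[OF D.graded_derivation_axioms in2.graded_functor_axioms]
    by (rule graded_derivation_cong) (simp_all add: eq_fun_def)
  obtain d where d: "graded_derivation R P0 P0 id_fun id_fun (- 1) d"
    "\<And>x. x \<in> Mor D \<Longrightarrow> d (Mmap in1 x) = Mmap in1 (Diff D x)"
    "\<And>x. x \<in> Mor D \<Longrightarrow> d (Mmap in2 x) = Mmap in2 (Diff D x)"
    by (rule ex_coproduct_derivation[OF id id _ 1 2]) (simp_all add: in2_F)
  have P: "Diff P = the_derivation R P0 P0 id_fun id_fun (- 1) S"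
    by (simp add: coproduct_under_def Let_def S_def)
  have *: "f x = f' x" if "graded_derivation R P0 P0 id_fun id_fun (- 1) f" "S f"
    "graded_derivation R P0 P0 id_fun id_fun (- 1) f'" "S f'" "x \<in> Mor P0" for f f' x
    using that(1,3) _ _ that(5) by (rule coproduct_derivation_eqI) (use that in \<open>simp_all add: S_def\<close>)
  have S: "S d" "S (restrict d (Mor P0))"
    using d by (simp_all add: S_def)
  show "graded_derivation R P0 P0 id_fun id_fun (- 1) (Diff P)"
    unfolding P using d(1) S(1) * S(2) by (rule the_derivation_props)
  have "S (Diff P)"
    unfolding P using d(1) S(1) * S(2) by (rule the_derivation_props)
  then show "f \<in> Mor D \<Longrightarrow> Diff P (Mmap in1 f) = Mmap in1 (Diff D f)"
    "f \<in> Mor D \<Longrightarrow> Diff P (Mmap in2 f) = Mmap in2 (Diff D f)"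
    by (simp_all add: S_def)
qed



lemma P_eq: "P = with_diff P0 (Diff P)"
  by (simp add: coproduct_under_def Let_def)

lemma P_simps [simp]:
  "Obj P = Obj D" "Mor P = Mor P0" "Dom P = Dom P0" "Cod P = Cod P0" "Deg P = Deg P0"
  "Zer P = Zer P0" "Hom P = Hom P0"
  by (subst P_eq, simp)+

lemma graded_functor_P [simp]:
  "graded_functor R P B H \<longleftrightarrow> graded_functor R P0 B H"
  "graded_functor R B' P H' \<longleftrightarrow> graded_functor R B' P0 H'"
  by (subst P_eq, simp)+

lemma graded_derivation_P [simp]:
  "graded_derivation R P B H L p f \<longleftrightarrow> graded_derivation R P0 B H L p f"
  "graded_derivation R B' P H' L' p f' \<longleftrightarrow> graded_derivation R B' P0 H' L' p f'"
  by (subst P_eq, simp)+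

lemma dg_category_P: "dg_category R P"
proof (rule dg_categoryI)
  show "graded_derivation R P P id_fun id_fun (- 1) (Diff P)"
    by (simp add: coproduct_Diff)
  interpret d: graded_derivation R P0 P0 id_fun id_fun "- 1" "Diff P" by (rule coproduct_Diff)
  note id = graded_functor_id[OF P0.A.graded_category_axioms]
  fix x assume "x \<in> Mor P"
  then have x: "x \<in> Mor P0" by simp
  have "Diff P (Diff P x) = zero_derivation P0 P0 id_fun (- 2) x"
  proof (rule coproduct_derivation_eqI[OF graded_derivation_square[OF d.graded_derivation_axioms]
        graded_derivation_zero[OF id id HOL.refl] _ _ x])
    fix y assume y: "y \<in> Mor D"
    show "Diff P (Diff P (Mmap in1 y)) = zero_derivation P0 P0 id_fun (- 2) (Mmap in1 y)"
      using y by (simp add: Diff_in zero_derivation_def cod.Diff_Diff[OF Hom_self])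
    show "Diff P (Diff P (Mmap in2 y)) = zero_derivation P0 P0 id_fun (- 2) (Mmap in2 y)"
      using y by (simp add: Diff_in zero_derivation_def cod.Diff_Diff[OF Hom_self])
  qed
  then show "Diff P (Diff P x) = zero_derivation P P id_fun (- 2) x"
    by (simp add: zero_derivation_def)
qed

sublocale P: dg_category R P by (rule dg_category_P)

end


section \<open>The relative cylinder\<close>

locale free_dg_under = dg_under R C D F
  for R :: "'a ring"
    and C :: "('a, 'o, 'm) dgcat"
    and D :: "('a, 'o, 'n) dgcat"
    and F :: "('o, 'm, 'o, 'n) dgfun" +
  fixes I :: "'i set" and s :: "'i \<Rightarrow> 'n"
  assumes free: "freely_generated R C D F I s"
begin

abbreviation "Y0 \<equiv> cyl_graded R C D F I s"
abbreviation "Y \<equiv> relative_cylinder R C D F I s"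
abbreviation "incl \<equiv> cyl_incl R C D F I s"
abbreviation "sbar \<equiv> cyl_gen R C D F I s"
abbreviation "i1 \<equiv> cyl_i1 R C D F I s"
abbreviation "i2 \<equiv> cyl_i2 R C D F I s"
abbreviation "bar \<equiv> cyl_derivation R C D F I s"

sublocale D_free: free_over R C D F "gen_quiver D I s 0" s
  using F.graded_functor_axioms Obj_C Omap_F free by (rule free_over_freely_generated)

\<comment> \<open>The presentation of \<open>D\<close> over \<open>C\<close> would rewrite the objects of \<open>D\<close> to those of \<open>C\<close>; the opposite
  direction is the one compatible with \<open>P\<close> and \<open>Y\<close>.\<close>
declare D_free.pres.Obj_eq [simp del] and Obj_C [simp]

lemma Dom_C_Obj_D [simp]: "c \<in> Mor C \<Longrightarrow> Dom C c \<in> Obj D" "c \<in> Mor C \<Longrightarrow> Cod C c \<in> Obj D"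
  using dom.Dom_closed[of c] dom.Cod_closed[of c] by simp_all

lemma s_type [simp]: "\<alpha> \<in> I \<Longrightarrow> s \<alpha> \<in> Mor D"
  using D_free.gen_type(1)[of \<alpha>] by simp

sublocale Y_free: free_over R P Y0 incl "gen_quiver D I s 1" sbar
  unfolding cyl_graded_def cyl_incl_def cyl_gen_def
  by (rule free_over_free_extension[OF P.graded_category_axioms]) simp

lemma sbar_type [simp]:
  assumes "\<alpha> \<in> I"
  shows "sbar \<alpha> \<in> Mor Y0" "Dom Y0 (sbar \<alpha>) = Dom D (s \<alpha>)" "Cod Y0 (sbar \<alpha>) = Cod D (s \<alpha>)"
    "Deg Y0 (sbar \<alpha>) = Deg D (s \<alpha>) + 1"
  using Y_free.gen_type[of \<alpha>] assms by simp_all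

sublocale i1: graded_functor R D Y0 i1
  unfolding cyl_i1_def
  by (rule graded_functor_comp[OF _ Y_free.J.graded_functor_axioms])
    (simp add: in1.graded_functor_axioms)

sublocale i2: graded_functor R D Y0 i2
  unfolding cyl_i2_def
  by (rule graded_functor_comp[OF _ Y_free.J.graded_functor_axioms])
    (simp add: in2.graded_functor_axioms)

lemma Omap_i [simp]: "Omap incl x = x" "Omap i1 x = x" "Omap i2 x = x"
  by (simp_all add: cyl_i1_def cyl_i2_def cyl_incl_def free_base_def)

lemma incl_in: "Mmap incl (Mmap in1 x) = Mmap i1 x" "Mmap incl (Mmap in2 x) = Mmap i2 x"
  by (simp_all add: cyl_i1_def cyl_i2_def)

lemma i2_F [simp]: "c \<in> Mor C \<Longrightarrow> Mmap i2 (Mmap F c) = Mmap i1 (Mmap F c)"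
  by (simp add: in2_F flip: incl_in)

lemma Obj_Y0 [simp]: "Obj Y0 = Obj D"
  using Y_free.pres.Obj_eq by simp

text \<open>
  Agreement on \<open>P\<close> reduces to agreement on the two copies of \<open>D\<close>, which generate it.
\<close>

lemma cylinder_derivation_eqI:
  assumes "graded_derivation R Y0 B H L p g" "graded_derivation R Y0 B H L p g'"
    and "\<And>x. x \<in> Mor D \<Longrightarrow> g (Mmap i1 x) = g' (Mmap i1 x)"
    and "\<And>x. x \<in> Mor D \<Longrightarrow> g (Mmap i2 x) = g' (Mmap i2 x)"
    and "\<And>\<alpha>. \<alpha> \<in> I \<Longrightarrow> g (sbar \<alpha>) = g' (sbar \<alpha>)"
    and "x \<in> Mor Y0"
  shows "g x = g' x"
  using assms(1,2)
proof (rule Y_free.derivation_eqI)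
  fix y assume "y \<in> Mor P"
  then have "y \<in> Mor P0" by simp
  note 1 = assms(1,2)[THEN graded_derivation_comp_right[OF Y_free.J.graded_functor_axioms]]
  show "g (Mmap incl y) = g' (Mmap incl y)"
    using 1[unfolded graded_derivation_P] _ _ \<open>y \<in> Mor P0\<close>
    by (rule coproduct_derivation_eqI) (simp_all add: incl_in assms)
qed (use assms in simp_all)

lemma cyl_derivation:
  shows bar_derivation: "graded_derivation R D Y0 i1 i2 1 bar"
    and bar_F: "c \<in> Mor C \<Longrightarrow> bar (Mmap F c) = Zer Y0 (Dom C c) (Cod C c) (Deg C c + 1)"
    and bar_gen: "\<alpha> \<in> I \<Longrightarrow> bar (s \<alpha>) = sbar \<alpha>"
proof -
  define S where "S = (\<lambda>f. (\<forall>c\<in>Mor C. f (Mmap F c) = Zer Y0 (Dom C c) (Cod C c) (Deg C c + 1)) \<and>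
             (\<forall>\<alpha>\<in>I. f (s \<alpha>) = sbar \<alpha>))"
  note i1F = graded_functor_comp[OF F.graded_functor_axioms i1.graded_functor_axioms]
    and i2F = graded_functor_comp[OF F.graded_functor_axioms i2.graded_functor_axioms]
  have "graded_derivation R C Y0 (comp_fun i1 F) (comp_fun i2 F) 1 (zero_derivation C Y0 (comp_fun i1 F) 1)"
    using i1F i2F by (rule graded_derivation_zero) simp
  note zero = this
  obtain f0 where f0: "graded_derivation R D Y0 i1 i2 1 f0"
    "\<And>x. x \<in> Mor C \<Longrightarrow> f0 (Mmap F x) = zero_derivation C Y0 (comp_fun i1 F) 1 x"
    "\<And>\<alpha>. \<alpha> \<in> I \<Longrightarrow> f0 (s \<alpha>) = sbar \<alpha>"
    by (rule D_free.ex_derivation[OF i1.graded_functor_axioms i2.graded_functor_axioms _ zero, where b = sbar])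
      (simp_all add: in_Hom_iff)
  have bar: "bar = the_derivation R D Y0 i1 i2 1 S"
    by (simp add: cyl_derivation_def Let_def S_def)
  have *: "g x = g' x" if "graded_derivation R D Y0 i1 i2 1 g" "S g"
    "graded_derivation R D Y0 i1 i2 1 g'" "S g'" "x \<in> Mor D" for g g' x
    using that(1,3) _ _ that(5)
    by (rule D_free.derivation_eqI) (use that in \<open>simp_all add: S_def\<close>)
  have S: "S f0" "S (restrict f0 (Mor D))"
    using f0 by (simp_all add: S_def zero_derivation_def)
  show "graded_derivation R D Y0 i1 i2 1 bar"
    unfolding bar using f0(1) S(1) * S(2) by (rule the_derivation_props)
  have "S bar"
    unfolding bar using f0(1) S(1) * S(2) by (rule the_derivation_props)
  then show "c \<in> Mor C \<Longrightarrow> bar (Mmap F c) = Zer Y0 (Dom C c) (Cod C c) (Deg C c + 1)"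
    "\<alpha> \<in> I \<Longrightarrow> bar (s \<alpha>) = sbar \<alpha>"
    by (simp_all add: S_def)
qed

sublocale bar: graded_derivation R D Y0 i1 i2 1 bar by (rule bar_derivation)

definition dsbar where
  "dsbar \<alpha> = Sub R Y0 (Sub R Y0 (Mmap i1 (s \<alpha>)) (Mmap i2 (s \<alpha>))) (bar (Diff D (s \<alpha>)))"

lemma cylinder_Diff:
  shows Diff_Y_derivation: "graded_derivation R Y0 Y0 id_fun id_fun (- 1) (Diff Y)"
    and Diff_i: "x \<in> Mor D \<Longrightarrow> Diff Y (Mmap i1 x) = Mmap i1 (Diff D x)"
      "x \<in> Mor D \<Longrightarrow> Diff Y (Mmap i2 x) = Mmap i2 (Diff D x)"
    and Diff_sbar: "\<alpha> \<in> I \<Longrightarrow> Diff Y (sbar \<alpha>) = dsbar \<alpha>"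
proof -
  note id = graded_functor_id[OF Y_free.J.cod.graded_category_axioms]
  define S where "S = (\<lambda>d. (\<forall>f\<in>Mor D. d (Mmap i1 f) = Mmap i1 (Diff D f) \<and>
      d (Mmap i2 f) = Mmap i2 (Diff D f)) \<and> (\<forall>\<alpha>\<in>I. d (sbar \<alpha>) = dsbar \<alpha>))"
  have "graded_derivation R P P id_fun id_fun (- 1) (Diff P)"
    by (simp add: coproduct_Diff)
  then have "graded_derivation R P Y0 (comp_fun incl id_fun) (comp_fun incl id_fun) (- 1)
      (\<lambda>x. Mmap incl (Diff P x))"
    using Y_free.J.graded_functor_axioms by (rule graded_derivation_comp_left)
  then have "graded_derivation R P Y0 (comp_fun id_fun incl) (comp_fun id_fun incl) (- 1)
      (\<lambda>x. Mmap incl (Diff P x))"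
    by (rule graded_derivation_cong) (simp_all add: eq_fun_def)
  note ext = this
  obtain d where d: "graded_derivation R Y0 Y0 id_fun id_fun (- 1) d"
    "\<And>x. x \<in> Mor P \<Longrightarrow> d (Mmap incl x) = Mmap incl (Diff P x)"
    "\<And>\<alpha>. \<alpha> \<in> I \<Longrightarrow> d (sbar \<alpha>) = dsbar \<alpha>"
    by (rule Y_free.ex_derivation[OF id id _ ext, where b = dsbar]) (simp_all add: in_Hom_iff dsbar_def)
  have Y: "Diff Y = the_derivation R Y0 Y0 id_fun id_fun (- 1) S"
    by (simp add: relative_cylinder_def Let_def S_def dsbar_def)
  have *: "g x = g' x" if "graded_derivation R Y0 Y0 id_fun id_fun (- 1) g" "S g"
    "graded_derivation R Y0 Y0 id_fun id_fun (- 1) g'" "S g'" "x \<in> Mor Y0" for g g' x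
    using that(1,3) _ _ _ that(5)
    by (rule cylinder_derivation_eqI) (use that in \<open>simp_all add: S_def\<close>)
  have S: "S d" "S (restrict d (Mor Y0))"
    using d(3) d(2)[of "Mmap in1 x" for x] d(2)[of "Mmap in2 x" for x]
    by (simp_all add: S_def incl_in Diff_in)
  show "graded_derivation R Y0 Y0 id_fun id_fun (- 1) (Diff Y)"
    unfolding Y using d(1) S(1) * S(2) by (rule the_derivation_props)
  have "S (Diff Y)"
    unfolding Y using d(1) S(1) * S(2) by (rule the_derivation_props)
  then show "x \<in> Mor D \<Longrightarrow> Diff Y (Mmap i1 x) = Mmap i1 (Diff D x)"
    "x \<in> Mor D \<Longrightarrow> Diff Y (Mmap i2 x) = Mmap i2 (Diff D x)"
    "\<alpha> \<in> I \<Longrightarrow> Diff Y (sbar \<alpha>) = dsbar \<alpha>"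
    by (simp_all add: S_def)
qed

sublocale dY: graded_derivation R Y0 Y0 id_fun id_fun "- 1" "Diff Y" by (rule Diff_Y_derivation)

lemma Diff_incl:
  assumes "x \<in> Mor P0"
  shows "Diff Y (Mmap incl x) = Mmap incl (Diff P x)"
proof -
  have 1: "graded_derivation R P Y0 incl incl (- 1) (\<lambda>x. Diff Y (Mmap incl x))"
    using graded_derivation_comp_right[OF Y_free.J.graded_functor_axioms Diff_Y_derivation]
    by (rule graded_derivation_cong) (simp_all add: eq_fun_def)
  have "graded_derivation R P P id_fun id_fun (- 1) (Diff P)"
    by (simp add: coproduct_Diff)
  from graded_derivation_comp_left[OF this Y_free.J.graded_functor_axioms]
  have 2: "graded_derivation R P Y0 incl incl (- 1) (\<lambda>x. Mmap incl (Diff P x))"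
    by (rule graded_derivation_cong) (simp_all add: eq_fun_def)
  show ?thesis
    using 1[unfolded graded_derivation_P] 2[unfolded graded_derivation_P] _ _ assms
    by (rule coproduct_derivation_eqI) (simp_all add: incl_in Diff_in Diff_i)
qed

text \<open>
  Both sides are \<open>(i1, i2)\<close>-derivations of degree 0, the left one as the graded commutator of \<open>bar\<close> with
  the differentials.  On \<open>s \<alpha>\<close> the equation is the definition of \<open>d (sbar \<alpha>)\<close>.  The identity
  \<open>d d = 0\<close> on \<open>Y\<close> is deduced from this lemma.
\<close>

lemma bar_homotopy:
  assumes "x \<in> Mor D"
  shows "Add Y0 (Diff Y (bar x)) (bar (Diff D x)) = Sub R Y0 (Mmap i1 x) (Mmap i2 x)"
proof -
  have "graded_derivation R D Y0 i1 i2 0 (\<lambda>x. Add Y0 (Diff Y (bar x)) (bar (Diff D x)))"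
    using bar_derivation D.graded_derivation_axioms Diff_Y_derivation
    by (rule graded_derivation_commutator) (simp_all add: Diff_i)
  moreover have "graded_derivation R D Y0 i1 i2 0 (\<lambda>x. Sub R Y0 (Mmap i1 x) (Mmap i2 x))"
    using i1.graded_functor_axioms i2.graded_functor_axioms by (rule graded_derivation_diff) simp
  ultimately show ?thesis
    using _ _ assms
  proof (rule D_free.derivation_eqI)
    fix c assume "c \<in> Mor C"
    then show "Add Y0 (Diff Y (bar (Mmap F c))) (bar (Diff D (Mmap F c))) =
        Sub R Y0 (Mmap i1 (Mmap F c)) (Mmap i2 (Mmap F c))"
      by (simp add: bar_F Sub_def)
  next
    fix \<alpha> assume "\<alpha> \<in> Arr (gen_quiver D I s 0)"
    then show "Add Y0 (Diff Y (bar (s \<alpha>))) (bar (Diff D (s \<alpha>))) =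
        Sub R Y0 (Mmap i1 (s \<alpha>)) (Mmap i2 (s \<alpha>))"
      by (simp add: bar_gen Diff_sbar dsbar_def Sub_def Y_free.J.cod.Add_assoc)
  qed
qed

end

section \<open>Homology\<close>

lemma homologousI:
  "t \<in> cycles C x y n \<Longrightarrow> u \<in> cycles C x y n \<Longrightarrow> b \<in> Hom C x y (n + 1) \<Longrightarrow>
    t = Add C u (Diff C b) \<Longrightarrow> (t, u) \<in> homologous C x y n"
  unfolding homologous_def by blast

lemma (in dg_category) graded_derivation_Diff: "graded_derivation R C C id_fun id_fun (- 1) (Diff C)"
  by (rule dg_category_imp_graded_derivation) (rule dg_category_axioms)

context dg_category
begin

interpretation d: graded_derivation R C C id_fun id_fun "- 1" "Diff C"
  by (rule graded_derivation_Diff)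

lemma Diff_type [simp]:
  assumes "t \<in> Mor C"
  shows "Diff C t \<in> Mor C" "Dom C (Diff C t) = Dom C t" "Cod C (Diff C t) = Cod C t"
    "Deg C (Diff C t) = Deg C t - 1"
  using d.der_type assms by simp_all

lemma Diff_Zer [simp]: "x \<in> Obj C \<Longrightarrow> y \<in> Obj C \<Longrightarrow> Diff C (Zer C x y n) = Zer C x y (n - 1)"
  using d.der_Zer by simp

lemma Diff_Ide [simp]: "x \<in> Obj C \<Longrightarrow> Diff C (Ide C x) = Zer C x x (- 1)"
  using d.der_Ide by simp

lemma Diff_Add [simp]: "t \<in> Mor C \<Longrightarrow> u \<in> Mor C \<Longrightarrow> Dom C t = Dom C u \<Longrightarrow> Cod C t = Cod C u \<Longrightarrow>
      Deg C t = Deg C u \<Longrightarrow> Diff C (Add C t u) = Add C (Diff C t) (Diff C u)"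
  by (rule d.der_Add)

lemma Diff_Scal [simp]: "a \<in> carrier R \<Longrightarrow> t \<in> Mor C \<Longrightarrow> Diff C (Scal C a t) = Scal C a (Diff C t)"
  by (rule d.der_Scal)

lemma Diff_Sub:
  "t \<in> Mor C \<Longrightarrow> u \<in> Mor C \<Longrightarrow> Dom C t = Dom C u \<Longrightarrow> Cod C t = Cod C u \<Longrightarrow> Deg C t = Deg C u \<Longrightarrow>
    Diff C (Sub R C t u) = Sub R C (Diff C t) (Diff C u)"
  by (simp add: Sub_def)

lemma Diff_Diff_Mor [simp]:
  "t \<in> Mor C \<Longrightarrow> Diff C (Diff C t) = Zer C (Dom C t) (Cod C t) (Deg C t - 2)"
  by (rule Diff_Diff) (simp add: in_Hom_iff)

lemma equiv_homologous: "equiv (cycles C x y n) (homologous C x y n)"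
proof (rule equivI)
  show "homologous C x y n \<subseteq> cycles C x y n \<times> cycles C x y n"
    by (auto simp: homologous_def)
  show "refl_on (cycles C x y n) (homologous C x y n)"
  proof (rule refl_onI)
    fix t assume t: "t \<in> cycles C x y n"
    then have "x \<in> Obj C" "y \<in> Obj C" "t = Add C t (Diff C (Zer C x y (n + 1)))"
      by (auto simp: cycles_def in_Hom_iff)
    then show "(t, t) \<in> homologous C x y n"
      using t by (intro homologousI[of _ _ _ _ _ _ "Zer C x y (n + 1)"]) (simp_all add: in_Hom_iff)
  qed
  show "sym (homologous C x y n)"
  proof (rule symI)
    fix t u assume tu: "(t, u) \<in> homologous C x y n"
    then obtain b where b: "b \<in> Hom C x y (n + 1)" "t = Add C u (Diff C b)"
      "t \<in> cycles C x y n" "u \<in> cycles C x y n"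
      by (auto simp: homologous_def)
    then have "u = Add C t (Diff C (Neg b))"
      by (simp add: in_Hom_iff cycles_def Add_assoc)
    then show "(u, t) \<in> homologous C x y n"
      using b by (intro homologousI[of _ _ _ _ _ _ "Neg b"]) (simp_all add: in_Hom_iff)
  qed
  show "trans (homologous C x y n)"
  proof (rule transI)
    fix t u v assume "(t, u) \<in> homologous C x y n" "(u, v) \<in> homologous C x y n"
    then obtain b c where b: "b \<in> Hom C x y (n + 1)" "t = Add C u (Diff C b)"
      "c \<in> Hom C x y (n + 1)" "u = Add C v (Diff C c)"
      "t \<in> cycles C x y n" "u \<in> cycles C x y n" "v \<in> cycles C x y n"
      by (auto simp: homologous_def)
    then have "t = Add C v (Diff C (Add C c b))"
      by (simp add: in_Hom_iff cycles_def Add_assoc)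
    moreover have "Add C c b \<in> Hom C x y (n + 1)"
      using b by (simp add: in_Hom_iff)
    ultimately show "(t, v) \<in> homologous C x y n"
      using b(5,7) unfolding homologous_def by blast
  qed
qed

end

context dg_functor
begin

interpretation G: graded_functor R C D F
  by (rule dg_functor_imp_graded_functor) (rule dg_functor_axioms)

lemma map_cycles: "t \<in> cycles C x y n \<Longrightarrow> Mmap F t \<in> cycles D (Omap F x) (Omap F y) n"
  by (auto simp: cycles_def in_Hom_iff simp flip: Mmap_Diff)

lemma map_homologous:
  assumes "(t, u) \<in> homologous C x y n"
  shows "(Mmap F t, Mmap F u) \<in> homologous D (Omap F x) (Omap F y) n"
proof -
  obtain b where b: "b \<in> Hom C x y (n + 1)" "t = Add C u (Diff C b)"
      "t \<in> cycles C x y n" "u \<in> cycles C x y n"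
    using assms by (auto simp: homologous_def)
  then have "Mmap F t = Add D (Mmap F u) (Diff D (Mmap F b))"
    by (simp add: in_Hom_iff cycles_def flip: Mmap_Diff)
  moreover have "Mmap F b \<in> Hom D (Omap F x) (Omap F y) (n + 1)"
    using b by (auto simp: in_Hom_iff)
  ultimately show ?thesis
    using b(3,4) map_cycles unfolding homologous_def by blast
qed

lemma homology_map_class:
  assumes "t \<in> cycles C x y n"
  shows "homology_map D F x y n (homologous C x y n `` {t}) =
    homologous D (Omap F x) (Omap F y) n `` {Mmap F t}"
proof -
  note C = dom.equiv_homologous[of x y n]
    and D = cod.equiv_homologous[of "Omap F x" "Omap F y" n]
  have "(u, v) \<in> homologous D (Omap F x) (Omap F y) n \<Longrightarrow>
    (Mmap F t, v) \<in> homologous D (Omap F x) (Omap F y) n"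
    if "(t, u') \<in> homologous C x y n" "u = Mmap F u'" for u u' v
    using map_homologous[OF that(1)] that(2) D by (auto elim!: equivE dest: transD)
  moreover have "(t, t) \<in> homologous C x y n"
    using C assms by (auto elim!: equivE dest: refl_onD)
  ultimately show ?thesis
    unfolding homology_map_def by fastforce
qed

end

text \<open>
  \<open>i\<close> is a section of \<open>p\<close>, so \<open>p\<close> is surjective on homology; \<open>i p\<close> is homotopic to the identity on
  cycles, so it is injective.  On objects \<open>p\<close> is bijective, and identities serve as homotopy
  isomorphisms.
\<close>

lemma retraction_quasi_equivalence:
  assumes p: "dg_functor R Y D p" and i: "dg_functor R D Y i"
    and Omap: "Obj Y = Obj D" "\<And>x. x \<in> Obj D \<Longrightarrow> Omap i x = x" "\<And>x. x \<in> Obj D \<Longrightarrow> Omap p x = x"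
    and pi: "\<And>t. t \<in> Mor D \<Longrightarrow> Mmap p (Mmap i t) = t"
    and homotopic: "\<And>x y n t. t \<in> cycles Y x y n \<Longrightarrow> (Mmap i (Mmap p t), t) \<in> homologous Y x y n"
  shows "quasi_equivalence R Y D p"
proof -
  interpret p: dg_functor R Y D p by fact
  interpret i: dg_functor R D Y i by fact
  have "bij_betw (homology_map D p x y n) (homology Y x y n) (homology D (Omap p x) (Omap p y) n)"
    if "x \<in> Obj D" "y \<in> Obj D" for x y n
  proof -
    note Y = p.dom.equiv_homologous[of x y n] and D = p.cod.equiv_homologous[of x y n]
    have xy [simp]: "Omap p x = x" "Omap p y = y" "Omap i x = x" "Omap i y = y"
      using that Omap by simp_all
    have inj: "(t, u) \<in> homologous Y x y n"
      if "t \<in> cycles Y x y n" "u \<in> cycles Y x y n" "(Mmap p t, Mmap p u) \<in> homologous D x y n" for t u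
    proof -
      have "(Mmap i (Mmap p t), Mmap i (Mmap p u)) \<in> homologous Y x y n"
        using i.map_homologous[OF that(3)] by simp
      then show ?thesis
        using homotopic[OF that(1)] homotopic[OF that(2)] Y
        by (meson equivE symE transE)
    qed
    have "inj_on (homology_map D p x y n) (homology Y x y n)"
    proof (rule inj_onI)
      fix X X'
      assume "X \<in> homology Y x y n" "X' \<in> homology Y x y n"
      then obtain t u where t: "t \<in> cycles Y x y n" "X = homologous Y x y n `` {t}"
        and u: "u \<in> cycles Y x y n" "X' = homologous Y x y n `` {u}"
        unfolding homology_def by (auto elim!: quotientE)
      assume "homology_map D p x y n X = homology_map D p x y n X'"
      then have "homologous D x y n `` {Mmap p t} = homologous D x y n `` {Mmap p u}"
        using p.homology_map_class[OF t(1)] p.homology_map_class[OF u(1)] t u by simp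
      moreover have "Mmap p t \<in> cycles D x y n" "Mmap p u \<in> cycles D x y n"
        using p.map_cycles[OF t(1)] p.map_cycles[OF u(1)] by simp_all
      ultimately have "(Mmap p t, Mmap p u) \<in> homologous D x y n"
        using eq_equiv_class_iff[OF D] by blast
      then show "X = X'"
        using inj[OF t(1) u(1)] equiv_class_eq[OF Y] t u by blast
    qed
    moreover have "homology_map D p x y n ` homology Y x y n = homology D x y n"
    proof (intro equalityI subsetI)
      fix Z assume "Z \<in> homology_map D p x y n ` homology Y x y n"
      then obtain t where "t \<in> cycles Y x y n" "Z = homology_map D p x y n (homologous Y x y n `` {t})"
        unfolding homology_def by (auto elim!: quotientE)
      then show "Z \<in> homology D x y n"
        using p.homology_map_class[of t x y n] p.map_cycles[of t x y n]
        by (simp add: homology_def quotientI)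
    next
      fix Z assume "Z \<in> homology D x y n"
      then obtain t where t: "t \<in> cycles D x y n" "Z = homologous D x y n `` {t}"
        unfolding homology_def by (auto elim!: quotientE)
      have it: "Mmap i t \<in> cycles Y x y n" using i.map_cycles[OF t(1)] by simp
      have "t \<in> Mor D" using t(1) by (simp add: cycles_def in_Hom_iff)
      then have "homology_map D p x y n (homologous Y x y n `` {Mmap i t}) = Z"
        using p.homology_map_class[OF it] t(2) by (simp add: pi)
      moreover have "homologous Y x y n `` {Mmap i t} \<in> homology Y x y n"
        unfolding homology_def using it by (rule quotientI)
      ultimately show "Z \<in> homology_map D p x y n ` homology Y x y n" by blast
    qed
    ultimately show ?thesis by (simp add: bij_betw_def)
  qed
  moreover have "homotopy_iso D (Omap p x) x (Ide D x)" if "x \<in> Obj D" for x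
  proof -
    have 1: "Ide D x \<in> cycles D x x 0"
      using that by (simp add: cycles_def in_Hom_iff)
    have 2: "(Ide D x, Ide D x) \<in> homologous D x x 0"
      using 1 p.cod.equiv_homologous[of x x 0] by (auto elim!: equivE dest: refl_onD)
    show ?thesis
      unfolding homotopy_iso_def using that 1 2
      by (intro conjI bexI[of _ "Ide D x"]) (simp_all add: Omap)
  qed
  ultimately show ?thesis
    using p unfolding quasi_equivalence_def Omap(1) by blast
qed

section \<open>The cylinder as a dg category\<close>

context free_dg_under
begin

lemma Y0_Obj_D [simp]: "t \<in> Mor Y0 \<Longrightarrow> Dom Y0 t \<in> Obj D" "t \<in> Mor Y0 \<Longrightarrow> Cod Y0 t \<in> Obj D"
  using Y_free.J.cod.Dom_closed[of t] Y_free.J.cod.Cod_closed[of t] by simp_all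

lemma Y_eq: "Y = with_diff Y0 (Diff Y)"
  by (simp add: relative_cylinder_def Let_def)

lemma Y_simps [simp]:
  "Obj Y = Obj D" "Mor Y = Mor Y0" "Dom Y = Dom Y0" "Cod Y = Cod Y0" "Deg Y = Deg Y0"
  "Zer Y = Zer Y0" "Add Y = Add Y0" "Hom Y = Hom Y0"
  by (subst Y_eq, simp)+

lemma graded_functor_Y [simp]:
  "graded_functor R Y B H \<longleftrightarrow> graded_functor R Y0 B H"
  "graded_functor R B' Y H' \<longleftrightarrow> graded_functor R B' Y0 H'"
  by (subst Y_eq, simp)+

lemma graded_derivation_Y [simp]:
  "graded_derivation R Y B H L p f \<longleftrightarrow> graded_derivation R Y0 B H L p f"
  "graded_derivation R B' Y H' L' p f' \<longleftrightarrow> graded_derivation R B' Y0 H' L' p f'"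
  by (subst Y_eq, simp)+

text \<open>
  The homotopy identity at the boundary \<open>d x\<close>.  For \<open>x = s \<alpha>\<close> it says that the three terms of
  \<open>d (sbar \<alpha>)\<close> have boundaries that cancel.
\<close>

lemma Diff_bar:
  assumes "x \<in> Mor D"
  shows "Diff Y (bar (Diff D x)) = Sub R Y0 (Mmap i1 (Diff D x)) (Mmap i2 (Diff D x))"
  using bar_homotopy[of "Diff D x"] assms by simp

lemma dg_category_Y: "dg_category R Y"
proof (rule dg_categoryI)
  show "graded_derivation R Y Y id_fun id_fun (- 1) (Diff Y)"
    by (simp add: Diff_Y_derivation)
  note id = graded_functor_id[OF Y_free.J.cod.graded_category_axioms]
  fix x assume "x \<in> Mor Y"
  then have x: "x \<in> Mor Y0" by simp
  have "Diff Y (Diff Y x) = zero_derivation Y0 Y0 id_fun (- 2) x"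
  proof (rule cylinder_derivation_eqI[OF graded_derivation_square[OF Diff_Y_derivation]
        graded_derivation_zero[OF id id HOL.refl] _ _ _ x])
    fix y assume y: "y \<in> Mor D"
    show "Diff Y (Diff Y (Mmap i1 y)) = zero_derivation Y0 Y0 id_fun (- 2) (Mmap i1 y)"
      using y by (simp add: Diff_i zero_derivation_def)
    show "Diff Y (Diff Y (Mmap i2 y)) = zero_derivation Y0 Y0 id_fun (- 2) (Mmap i2 y)"
      using y by (simp add: Diff_i zero_derivation_def)
  next
    fix \<alpha> assume "\<alpha> \<in> I"
    then show "Diff Y (Diff Y (sbar \<alpha>)) = zero_derivation Y0 Y0 id_fun (- 2) (sbar \<alpha>)"
      by (simp add: Diff_sbar dsbar_def dY.der_Sub Diff_i Diff_bar zero_derivation_def)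
  qed
  then show "Diff Y (Diff Y x) = zero_derivation Y Y id_fun (- 2) x"
    by (simp add: zero_derivation_def)
qed

lemma dg_functor_in1: "dg_functor R D P in1"
  by (rule dg_functorI[OF cod.dg_category_axioms dg_category_P])
    (simp_all add: Diff_in in1.graded_functor_axioms)

lemma dg_functor_incl: "dg_functor R P Y incl"
  by (rule dg_functorI[OF dg_category_P dg_category_Y])
    (simp_all add: Diff_incl Y_free.J.graded_functor_axioms[unfolded graded_functor_P])

lemma dg_functor_i1: "dg_functor R D Y i1"
  by (rule dg_functorI[OF cod.dg_category_axioms dg_category_Y])
    (simp_all add: Diff_i i1.graded_functor_axioms)


section \<open>The projection of the cylinder\<close>

abbreviation "cod \<equiv> codiagonal D"
abbreviation "proj \<equiv> cyl_proj D s"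

lemma realization_codiagonal: "realization R Q E D (\<lambda>x. x) (case_sum (\<lambda>f. f) (\<lambda>f. f))"
  using graded_functor_id[OF cod.graded_category_axioms] graded_functor_id[OF cod.graded_category_axioms]
  by (rule realization_coproduct) simp_all

sublocale cod: graded_functor R P0 D cod
  unfolding codiagonal_def graded_coproduct_def
  using realization_codiagonal by (rule Q.graded_functor_induced_fun)

lemma cod_in [simp]:
  "x \<in> Mor D \<Longrightarrow> Mmap cod (Mmap in1 x) = x" "x \<in> Mor D \<Longrightarrow> Mmap cod (Mmap in2 x) = x"
  unfolding codiagonal_def cls_eq_in[symmetric]
  by (simp_all add: Q.induced_fun_cls[OF realization_codiagonal])

lemma Omap_cod [simp]: "Omap cod x = x"
  by (simp add: codiagonal_def induced_fun_def)

lemma realization_proj: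
  "realization R (free_quiver P (gen_quiver D I s 1)) (functor_relations R P Inl) D (\<lambda>x. x)
     (case_sum (Mmap cod) (\<lambda>\<alpha>. Zer D (Dom D (s \<alpha>)) (Cod D (s \<alpha>)) (Deg D (s \<alpha>) + 1)))"
proof -
  have "graded_functor R P D cod" by (simp add: cod.graded_functor_axioms)
  then show ?thesis by (rule realization_free) (simp_all add: in_Hom_iff)
qed

sublocale proj: graded_functor R Y0 D proj
  unfolding cyl_proj_def cyl_graded_def free_extension_def
  using realization_proj by (rule Y_free.pres.graded_functor_induced_fun)

lemma Omap_proj [simp]: "Omap proj x = x"
  by (simp add: cyl_proj_def induced_fun_def)

lemma proj_incl [simp]: "x \<in> Mor P0 \<Longrightarrow> Mmap proj (Mmap incl x) = Mmap cod x"
  by (simp add: cyl_proj_def cyl_incl_def free_base_def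
      Y_free.pres.induced_fun_cls[OF realization_proj])

lemma proj_sbar [simp]:
  "\<alpha> \<in> I \<Longrightarrow> Mmap proj (sbar \<alpha>) = Zer D (Dom D (s \<alpha>)) (Cod D (s \<alpha>)) (Deg D (s \<alpha>) + 1)"
  by (simp add: cyl_proj_def cyl_gen_def free_gen_def
      Y_free.pres.induced_fun_cls[OF realization_proj])

lemma proj_i [simp]:
  "x \<in> Mor D \<Longrightarrow> Mmap proj (Mmap i1 x) = x" "x \<in> Mor D \<Longrightarrow> Mmap proj (Mmap i2 x) = x"
  by (simp_all flip: incl_in)

text \<open>
  \<open>proj bar\<close> is an \<open>(id, id)\<close>-derivation which vanishes on \<open>C\<close> and on all \<open>s \<alpha>\<close>.
\<close>

lemma proj_bar [simp]:
  assumes "x \<in> Mor D"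
  shows "Mmap proj (bar x) = Zer D (Dom D x) (Cod D x) (Deg D x + 1)"
proof -
  note pi1 = graded_functor_comp[OF i1.graded_functor_axioms proj.graded_functor_axioms]
    and pi2 = graded_functor_comp[OF i2.graded_functor_axioms proj.graded_functor_axioms]
  have "Mmap proj (bar x) = zero_derivation D D (comp_fun proj i1) 1 x"
    by (rule D_free.derivation_eqI[OF graded_derivation_comp_left[OF bar_derivation
          proj.graded_functor_axioms] graded_derivation_zero[OF pi1 pi2] _ _ assms])
      (simp_all add: bar_F bar_gen zero_derivation_def)
  then show ?thesis by (simp add: zero_derivation_def)
qed

lemma proj_Diff:
  assumes "x \<in> Mor Y0"
  shows "Mmap proj (Diff Y x) = Diff D (Mmap proj x)"
proof -
  have 1: "graded_derivation R Y0 D proj proj (- 1) (\<lambda>x. Mmap proj (Diff Y x))"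
    using graded_derivation_comp_left[OF Diff_Y_derivation proj.graded_functor_axioms]
    by (rule graded_derivation_cong) (simp_all add: eq_fun_def)
  have 2: "graded_derivation R Y0 D proj proj (- 1) (\<lambda>x. Diff D (Mmap proj x))"
    using graded_derivation_comp_right[OF proj.graded_functor_axioms D.graded_derivation_axioms]
    by (rule graded_derivation_cong) (simp_all add: eq_fun_def)
  show ?thesis
    by (rule cylinder_derivation_eqI[OF 1 2 _ _ _ assms])
      (simp_all add: Diff_i Diff_sbar dsbar_def proj.map_Sub)
qed

lemma dg_functor_proj: "dg_functor R Y D proj"
  by (rule dg_functorI[OF dg_category_Y cod.dg_category_axioms])
    (simp_all add: proj_Diff proj.graded_functor_axioms)


section \<open>The contracting homotopy\<close>

abbreviation "i1p \<equiv> comp_fun i1 proj"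

sublocale i1p: graded_functor R Y0 Y0 i1p
  using proj.graded_functor_axioms i1.graded_functor_axioms by (rule graded_functor_comp)

text \<open>
  The restriction along \<open>i2\<close> of an \<open>(i1 proj, id)\<close>-derivation is an \<open>(i1, i2)\<close>-derivation, because
  \<open>proj i2 = id\<close>.  That of a homotopy from \<open>i1 proj\<close> to the identity must have \<open>i1 - i2\<close> as its
  commutator with the differentials, which is why \<open>bar\<close> is prescribed there.
\<close>

lemma ex_contraction:
  obtains h where "graded_derivation R Y0 Y0 i1p id_fun 1 h"
    "\<And>x. x \<in> Mor D \<Longrightarrow> h (Mmap i1 x) = Zer Y0 (Dom D x) (Cod D x) (Deg D x + 1)"
    "\<And>x. x \<in> Mor D \<Longrightarrow> h (Mmap i2 x) = bar x"
    "\<And>\<alpha>. \<alpha> \<in> I \<Longrightarrow> h (sbar \<alpha>) = Zer Y0 (Dom D (s \<alpha>)) (Cod D (s \<alpha>)) (Deg D (s \<alpha>) + 2)"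
proof -
  let ?H = "comp_fun i1p incl" and ?L = "comp_fun id_fun incl"
  note id = graded_functor_id[OF Y_free.J.cod.graded_category_axioms]
  note incl = Y_free.J.graded_functor_axioms[unfolded graded_functor_P]
  note H = graded_functor_comp[OF incl i1p.graded_functor_axioms]
    and L = graded_functor_comp[OF incl id]
  note H1 = graded_functor_comp[OF in1.graded_functor_axioms H]
    and L1 = graded_functor_comp[OF in1.graded_functor_axioms L]
  have 1: "graded_derivation R D Y0 (comp_fun ?H in1) (comp_fun ?L in1) 1
      (zero_derivation D Y0 (comp_fun ?H in1) 1)"
    using H1 L1 by (rule graded_derivation_zero) simp
  have 2: "graded_derivation R D Y0 (comp_fun ?H in2) (comp_fun ?L in2) 1 bar"
    using bar_derivation by (rule graded_derivation_cong) (simp_all add: eq_fun_def flip: incl_in)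
  obtain hP where hP: "graded_derivation R P0 Y0 ?H ?L 1 hP"
    "\<And>x. x \<in> Mor D \<Longrightarrow> hP (Mmap in1 x) = zero_derivation D Y0 (comp_fun ?H in1) 1 x"
    "\<And>x. x \<in> Mor D \<Longrightarrow> hP (Mmap in2 x) = bar x"
    by (rule ex_coproduct_derivation[OF H L _ 1 2]) (simp_all add: zero_derivation_def bar_F)
  have hP': "graded_derivation R P Y0 ?H ?L 1 hP"
    using hP(1) by simp
  obtain h where h: "graded_derivation R Y0 Y0 i1p id_fun 1 h"
    "\<And>x. x \<in> Mor P \<Longrightarrow> h (Mmap incl x) = hP x"
    "\<And>\<alpha>. \<alpha> \<in> I \<Longrightarrow> h (sbar \<alpha>) = Zer Y0 (Dom D (s \<alpha>)) (Cod D (s \<alpha>)) (Deg D (s \<alpha>) + 2)"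
    by (rule Y_free.ex_derivation[OF i1p.graded_functor_axioms id _ hP', where
          b = "\<lambda>\<alpha>. Zer Y0 (Dom D (s \<alpha>)) (Cod D (s \<alpha>)) (Deg D (s \<alpha>) + 2)"])
      (simp_all add: in_Hom_iff)
  show ?thesis
    by (rule that[OF h(1)])
      (simp_all add: h(2,3) hP(2,3) zero_derivation_def flip: incl_in)
qed

text \<open>
  Once \<open>h bar = 0\<close> is known, the two sides at \<open>sbar \<alpha>\<close> are \<open>h (i1 (s \<alpha>)) - h (i2 (s \<alpha>)) = - sbar \<alpha>\<close>
  and \<open>0 - sbar \<alpha>\<close>.
\<close>

lemma cylinder_contraction:
  obtains h where "graded_derivation R Y0 Y0 i1p id_fun 1 h"
    "\<And>x. x \<in> Mor Y0 \<Longrightarrow> Add Y0 (Diff Y (h x)) (h (Diff Y x)) = Sub R Y0 (Mmap i1 (Mmap proj x)) x"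
proof -
  obtain h where h: "graded_derivation R Y0 Y0 i1p id_fun 1 h"
    "\<And>x. x \<in> Mor D \<Longrightarrow> h (Mmap i1 x) = Zer Y0 (Dom D x) (Cod D x) (Deg D x + 1)"
    "\<And>x. x \<in> Mor D \<Longrightarrow> h (Mmap i2 x) = bar x"
    "\<And>\<alpha>. \<alpha> \<in> I \<Longrightarrow> h (sbar \<alpha>) = Zer Y0 (Dom D (s \<alpha>)) (Cod D (s \<alpha>)) (Deg D (s \<alpha>) + 2)"
    by (rule ex_contraction) blast
  interpret h: graded_derivation R Y0 Y0 i1p id_fun 1 h by (rule h)
  note id = graded_functor_id[OF Y_free.J.cod.graded_category_axioms]
  have h_bar: "h (bar x) = Zer Y0 (Dom D x) (Cod D x) (Deg D x + 2)" if x: "x \<in> Mor D" for x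
  proof -
    note A = graded_functor_comp[OF i1.graded_functor_axioms i1p.graded_functor_axioms]
      and B = graded_functor_comp[OF i2.graded_functor_axioms id]
    have "graded_derivation R D Y0 (comp_fun i1p i1) (comp_fun id_fun i2) (1 + 1) (\<lambda>x. h (bar x))"
      using bar_derivation h(1) by (rule graded_derivation_compose) (simp_all add: h)
    moreover have "graded_derivation R D Y0 (comp_fun i1p i1) (comp_fun id_fun i2) (1 + 1)
        (zero_derivation D Y0 (comp_fun i1p i1) (1 + 1))"
      using A B by (rule graded_derivation_zero) simp
    ultimately have "h (bar x) = zero_derivation D Y0 (comp_fun i1p i1) (1 + 1) x"
      using _ _ x
      by (rule D_free.derivation_eqI) (simp_all add: bar_F bar_gen h zero_derivation_def add.commute)
    then show ?thesis by (simp add: zero_derivation_def)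
  qed
  have 1: "graded_derivation R Y0 Y0 i1p id_fun 0 (\<lambda>x. Add Y0 (Diff Y (h x)) (h (Diff Y x)))"
    using h(1) Diff_Y_derivation Diff_Y_derivation
    by (rule graded_derivation_commutator) (simp_all add: Diff_i proj_Diff)
  have 2: "graded_derivation R Y0 Y0 i1p id_fun 0 (\<lambda>x. Sub R Y0 (Mmap i1p x) x)"
    using graded_derivation_diff[OF i1p.graded_functor_axioms id] by simp
  have "Add Y0 (Diff Y (h x)) (h (Diff Y x)) = Sub R Y0 (Mmap i1p x) x"
    if x: "x \<in> Mor Y0" for x
  proof (rule cylinder_derivation_eqI[OF 1 2 _ _ _ x])
    fix y assume y: "y \<in> Mor D"
    show "Add Y0 (Diff Y (h (Mmap i1 y))) (h (Diff Y (Mmap i1 y))) =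
        Sub R Y0 (Mmap i1p (Mmap i1 y)) (Mmap i1 y)"
      using y by (simp add: h Diff_i)
    show "Add Y0 (Diff Y (h (Mmap i2 y))) (h (Diff Y (Mmap i2 y))) =
        Sub R Y0 (Mmap i1p (Mmap i2 y)) (Mmap i2 y)"
      using y by (simp add: h Diff_i bar_homotopy)
  next
    fix \<alpha> assume \<alpha>: "\<alpha> \<in> I"
    show "Add Y0 (Diff Y (h (sbar \<alpha>))) (h (Diff Y (sbar \<alpha>))) =
        Sub R Y0 (Mmap i1p (sbar \<alpha>)) (sbar \<alpha>)"
      using \<alpha> by (simp add: h Diff_sbar dsbar_def h.der_Sub h_bar bar_gen)
  qed
  then show ?thesis using that h(1) by simp
qed

lemma quasi_equivalence_proj: "quasi_equivalence R Y D proj"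
  using dg_functor_proj dg_functor_i1
proof (rule retraction_quasi_equivalence)
  fix x y n t assume "t \<in> cycles Y x y n"
  then have t: "t \<in> Mor Y0" "Dom Y0 t = x" "Cod Y0 t = y" "Deg Y0 t = n" "Diff Y t = Zer Y0 x y (n - 1)"
    and xy [simp]: "x \<in> Obj D" "y \<in> Obj D"
    and cyc: "t \<in> cycles Y x y n"
    by (auto simp: cycles_def in_Hom_iff)
  obtain h where h: "graded_derivation R Y0 Y0 i1p id_fun 1 h"
    "\<And>x. x \<in> Mor Y0 \<Longrightarrow> Add Y0 (Diff Y (h x)) (h (Diff Y x)) = Sub R Y0 (Mmap i1 (Mmap proj x)) x"
    by (rule cylinder_contraction) blast
  interpret h: graded_derivation R Y0 Y0 i1p id_fun 1 h by (rule h)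
  have "Diff Y (h t) = Sub R Y0 (Mmap i1 (Mmap proj t)) t"
    using h(2)[OF t(1)] t by simp
  moreover have "Add Y0 t (Add Y0 (Mmap i1 (Mmap proj t)) (Y_free.J.cod.Neg t)) =
      Add Y0 (Mmap i1 (Mmap proj t)) (Add Y0 t (Y_free.J.cod.Neg t))"
    by (rule Y_free.J.cod.Add_left_comm) (simp_all add: t)
  ultimately have "Mmap i1 (Mmap proj t) = Add Y t (Diff Y (h t))"
    using t by (simp add: Sub_def)
  moreover have "Mmap i1 (Mmap proj t) \<in> cycles Y x y n"
  proof -
    interpret p: dg_functor R Y D proj by (rule dg_functor_proj)
    interpret i: dg_functor R D Y i1 by (rule dg_functor_i1)
    show ?thesis using i.map_cycles[OF p.map_cycles[OF cyc]] by simp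
  qed
  ultimately show "(Mmap i1 (Mmap proj t), t) \<in> homologous Y x y n"
    using cyc t by (intro homologousI[of _ _ _ _ _ _ "h t"]) (simp_all add: in_Hom_iff)
qed simp_all

end

section \<open>Lifting against trivial fibrations\<close>

text \<open>
  The relative form of the lifting property of a surjective quasi-isomorphism of complexes: a boundary
  \<open>d e\<close> of \<open>B\<close> together with a cycle \<open>z\<close> of \<open>A\<close> over it.  Injectivity on homology gives \<open>z = d a0\<close>.
  Then \<open>p a0 - e\<close> is a cycle, and by surjectivity on homology \<open>p c = p a0 - e + d b\<close> for some cycle
  \<open>c\<close>.  With \<open>b = p b'\<close>, the morphism \<open>a0 - c + d b'\<close> lies over \<open>e\<close> and has boundary \<open>z\<close>.
\<close>

lemma trivial_fibration_lift:
  assumes fib: "fibration R A B p" and qe: "quasi_equivalence R A B p"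
    and xy: "x \<in> Obj A" "y \<in> Obj A"
    and z: "z \<in> cycles A x y n"
    and e: "e \<in> Hom B (Omap p x) (Omap p y) (n + 1)" "Diff B e = Mmap p z"
  obtains a where "a \<in> Hom A x y (n + 1)" "Mmap p a = e" "Diff A a = z"
proof -
  interpret p: dg_functor R A B p using fib by (simp add: fibration_def)
  interpret G: graded_functor R A B p by (rule dg_functor_imp_graded_functor) (rule p.dg_functor_axioms)
  have surj: "Mmap p ` Hom A x y m = Hom B (Omap p x) (Omap p y) m" for m
    using fib xy by (simp add: fibration_def)
  have bij: "bij_betw (homology_map B p x y m) (homology A x y m) (homology B (Omap p x) (Omap p y) m)"
    for m
    using qe xy by (simp add: quasi_equivalence_def)
  note equiv_A = p.dom.equiv_homologous[of x y]
    and equiv_B = p.cod.equiv_homologous[of "Omap p x" "Omap p y"]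
  note [simp] = xy in_Hom_iff
  have zA: "z \<in> Mor A" "Dom A z = x" "Cod A z = y" "Deg A z = n"
    using z by (simp_all add: cycles_def)
  have eB: "e \<in> Mor B" "Dom B e = Omap p x" "Cod B e = Omap p y" "Deg B e = n + 1"
    using e(1) by simp_all
  have zero: "Zer A x y n \<in> cycles A x y n"
    by (simp add: cycles_def)
  have "(Mmap p z, Mmap p (Zer A x y n)) \<in> homologous B (Omap p x) (Omap p y) n"
    using p.map_cycles[OF z] p.map_cycles[OF zero] e(1)
    by (rule homologousI) (simp add: e(2) zA)
  then have "homology_map B p x y n (homologous A x y n `` {z}) =
      homology_map B p x y n (homologous A x y n `` {Zer A x y n})"
    unfolding p.homology_map_class[OF z] p.homology_map_class[OF zero]
    by (rule equiv_class_eq[OF equiv_B])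
  then have "homologous A x y n `` {z} = homologous A x y n `` {Zer A x y n}"
    by (rule inj_onD[OF bij_betw_imp_inj_on[OF bij]])
      (simp_all add: homology_def quotientI z zero)
  then have "(z, Zer A x y n) \<in> homologous A x y n"
    using eq_equiv_class_iff[OF equiv_A z zero] by simp
  then obtain a0 where a0: "a0 \<in> Mor A" "Dom A a0 = x" "Cod A a0 = y" "Deg A a0 = n + 1" "z = Diff A a0"
    unfolding homologous_def by auto
  define c' where "c' = Add B (Mmap p a0) (p.cod.Neg e)"
  have c': "c' \<in> cycles B (Omap p x) (Omap p y) (n + 1)"
    using a0 eB e(2) by (simp add: c'_def cycles_def zA flip: p.Mmap_Diff)
  then have "homologous B (Omap p x) (Omap p y) (n + 1) `` {c'} \<in>
      homology B (Omap p x) (Omap p y) (n + 1)"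
    unfolding homology_def by (rule quotientI)
  then obtain X where X: "X \<in> homology A x y (n + 1)"
    "homology_map B p x y (n + 1) X = homologous B (Omap p x) (Omap p y) (n + 1) `` {c'}"
    unfolding bij_betw_imp_surj_on[OF bij, symmetric] by auto
  then obtain c where c: "c \<in> cycles A x y (n + 1)" "X = homologous A x y (n + 1) `` {c}"
    unfolding homology_def by (auto elim!: quotientE)
  have "(Mmap p c, c') \<in> homologous B (Omap p x) (Omap p y) (n + 1)"
    using X(2) p.homology_map_class[OF c(1)] eq_equiv_class_iff[OF equiv_B p.map_cycles[OF c(1)] c'] c(2)
    by simp
  then obtain b where b: "b \<in> Hom B (Omap p x) (Omap p y) (n + 2)" "Mmap p c = Add B c' (Diff B b)"
    unfolding homologous_def by (auto simp: add.assoc)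
  obtain b' where b': "b' \<in> Hom A x y (n + 2)" "b = Mmap p b'"
    using b(1) surj[of "n + 2", symmetric] by blast
  have cA: "c \<in> Mor A" "Dom A c = x" "Cod A c = y" "Deg A c = n + 1" "Diff A c = Zer A x y n"
    using c(1) by (simp_all add: cycles_def)
  define a where "a = Add A (Add A a0 (p.dom.Neg c)) (Diff A b')"
  have "a \<in> Hom A x y (n + 1)"
    using a0 cA b'(1) by (simp add: a_def)
  moreover have "Diff A a = z"
    using a0 cA b'(1) by (simp add: a_def)
  moreover have "Mmap p a = e"
  proof -
    have *: "Add B (Add B s (p.cod.Neg (Add B (Add B s (p.cod.Neg e)) d))) d = e"
      if "s \<in> Mor B" "d \<in> Mor B" "Dom B s = Dom B e" "Cod B s = Cod B e" "Deg B s = Deg B e"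
        "Dom B d = Dom B e" "Cod B d = Cod B e" "Deg B d = Deg B e" for s d
    proof -
      have "Add B (Add B s (p.cod.Neg (Add B (Add B s (p.cod.Neg e)) d))) d =
          Add B (Add B s (Add B (Add B (p.cod.Neg s) e) (p.cod.Neg d))) d"
        using that eB(1) by simp
      also have "\<dots> = Add B (Add B s (p.cod.Neg s)) (Add B e (Add B (p.cod.Neg d) d))"
        using that eB(1) by (simp add: p.cod.Add_assoc del: p.cod.Add_Neg p.cod.Add_Neg_Add)
      also have "\<dots> = e"
        using that eB(1) by simp
      finally show ?thesis .
    qed
    have "Mmap p a = Add B (Add B (Mmap p a0) (p.cod.Neg (Mmap p c))) (Diff B b)"
      using a0 cA b' by (simp add: a_def p.Mmap_Diff)
    also have "\<dots> = e"
      unfolding b(2) c'_def using a0 b' eB by (intro *) simp_all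
    finally show ?thesis .
  qed
  ultimately show ?thesis using that by blast
qed

context free_dg_under
begin

lemma composite_Mor: "composite C D F I s w t m \<Longrightarrow> t \<in> Mor D"
  by (induction rule: composite.induct) simp_all

text \<open>
  Weights add up under composition, so a composite of weight less than \<open>k\<close> only involves generators
  of weight less than \<open>k\<close>.
\<close>

lemma derivation_eq_weight_below:
  assumes g: "graded_derivation R D B H L q g" "graded_derivation R D B H L q g'"
    and C: "\<And>c. c \<in> Mor C \<Longrightarrow> g (Mmap F c) = g' (Mmap F c)"
    and gen: "\<And>\<beta>. \<beta> \<in> I \<Longrightarrow> w \<beta> < k \<Longrightarrow> g (s \<beta>) = g' (s \<beta>)"
    and t: "weight_below C D F I s w k x y n t" and xy: "x \<in> Obj D" "y \<in> Obj D"
  shows "g t = g' t"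
proof -
  interpret g: graded_derivation R D B H L q g by (rule g)
  interpret g': graded_derivation R D B H L q g' by (rule g)
  have 1: "g t = g' t" if "composite C D F I s w t m" "m < k" for t m
    using that
  proof (induction rule: composite.induct)
    case (comp t m u n)
    then show ?case using composite_Mor[OF comp.hyps(1)] composite_Mor[OF comp.hyps(2)] by simp
  qed (simp_all add: C gen)
  have "t \<in> Hom D x y n \<and> g t = g' t"
    using t
  proof (induction rule: weight_below.induct)
    case (add u t m)
    then show ?case using 1[of t m] by (auto simp: in_Hom_iff)
  qed (simp add: in_Hom_iff xy)
  then show ?thesis ..
qed

end

locale cylinder_lifting = free_dg_under R C D F I s +
  u: dg_functor R "coproduct_under R C D F" A u +
  v: dg_functor R "relative_cylinder R C D F I s" B v +
  p: dg_functor R A B p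
  for R :: "'a ring"
    and C :: "('a, 'o, 'm) dgcat"
    and D :: "('a, 'o, 'n) dgcat"
    and F :: "('o, 'm, 'o, 'n) dgfun"
    and I :: "'i set" and s :: "'i \<Rightarrow> 'n"
    and A :: "('a, 'q, 'k) dgcat" and B :: "('a, 'r, 'l) dgcat" and p u v +
  fixes w :: "'i \<Rightarrow> nat"
  assumes weight: "\<alpha> \<in> I \<Longrightarrow> weight_below C D F I s w (w \<alpha>) (Dom D (s \<alpha>)) (Cod D (s \<alpha>)) (Deg D (s \<alpha>) - 1)
          (Diff D (s \<alpha>))"
    and fibration: "fibration R A B p" and quasi_equivalence: "quasi_equivalence R A B p"
    and square: "eq_fun P (comp_fun p u) (comp_fun v incl)"
begin

sublocale gu: graded_functor R P0 A u
  using dg_functor_imp_graded_functor[OF u.dg_functor_axioms] by simp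

sublocale gv: graded_functor R Y0 B v
  using dg_functor_imp_graded_functor[OF v.dg_functor_axioms] by simp

sublocale gp: graded_functor R A B p
  using dg_functor_imp_graded_functor[OF p.dg_functor_axioms] by simp

abbreviation "u1 \<equiv> comp_fun u in1"
abbreviation "u2 \<equiv> comp_fun u in2"

sublocale u1: graded_functor R D A u1
  using in1.graded_functor_axioms gu.graded_functor_axioms by (rule graded_functor_comp)

sublocale u2: graded_functor R D A u2
  using in2.graded_functor_axioms gu.graded_functor_axioms by (rule graded_functor_comp)

lemma Omap_square [simp]: "x \<in> Obj D \<Longrightarrow> Omap p (Omap u x) = Omap v x"
  using square by (simp add: eq_fun_def)

lemma Mmap_square [simp]: "x \<in> Mor P0 \<Longrightarrow> Mmap p (Mmap u x) = Mmap v (Mmap incl x)"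
  using square by (simp add: eq_fun_def)

lemma Diff_u [simp]: "x \<in> Mor P0 \<Longrightarrow> Diff A (Mmap u x) = Mmap u (Diff P x)"
  using u.Mmap_Diff by simp

lemma Diff_v [simp]: "x \<in> Mor Y0 \<Longrightarrow> Diff B (Mmap v x) = Mmap v (Diff Y x)"
  using v.Mmap_Diff by simp

text \<open>
  The possible images of \<open>sbar \<alpha>\<close> under a graded functor that extends \<open>u\<close>.
\<close>

definition shifted :: "'i \<Rightarrow> 'k set" where
  "shifted \<alpha> = Hom A (Omap u (Dom D (s \<alpha>))) (Omap u (Cod D (s \<alpha>))) (Deg D (s \<alpha>) + 1)"

text \<open>
  The derivation \<open>g\<close> is what a lift with values \<open>b \<alpha>\<close> at \<open>sbar \<alpha>\<close> makes of \<open>bar\<close>.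
\<close>

definition extends where
  "extends b g \<longleftrightarrow> graded_derivation R D A u1 u2 1 g \<and>
     (\<forall>c\<in>Mor C. g (Mmap F c) = Zer A (Omap u (Dom C c)) (Omap u (Cod C c)) (Deg C c + 1)) \<and>
     (\<forall>\<alpha>\<in>I. g (s \<alpha>) = b \<alpha>)"

definition ext where "ext b = (SOME g. extends b g)"

lemma extends_ext:
  assumes "\<And>\<alpha>. \<alpha> \<in> I \<Longrightarrow> b \<alpha> \<in> shifted \<alpha>"
  shows "extends b (ext b)"
proof -
  note 1 = graded_functor_comp[OF F.graded_functor_axioms u1.graded_functor_axioms]
    and 2 = graded_functor_comp[OF F.graded_functor_axioms u2.graded_functor_axioms]
  obtain g where "graded_derivation R D A u1 u2 1 g"
    "\<And>x. x \<in> Mor C \<Longrightarrow> g (Mmap F x) = zero_derivation C A (comp_fun u1 F) 1 x"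
    "\<And>i. i \<in> I \<Longrightarrow> g (s i) = b i"
    by (rule D_free.ex_derivation[OF u1.graded_functor_axioms u2.graded_functor_axioms _
          graded_derivation_zero[OF 1 2, where p = 1], where b = b])
      (simp_all add: assms[unfolded shifted_def])
  then have "extends b g"
    by (simp add: extends_def zero_derivation_def)
  then show ?thesis unfolding ext_def by (rule someI[of "extends b"])
qed

text \<open>
  During the recursion \<open>b\<close> is only known below a certain weight.  Replacing all other values by zero
  gives a family that always extends to a derivation, and that depends only on the values already
  chosen.
\<close>

definition truncated :: "('i \<Rightarrow> 'k) \<Rightarrow> nat \<Rightarrow> 'i \<Rightarrow> 'k" where
  "truncated b k \<beta> = (if w \<beta> < k \<and> b \<beta> \<in> shifted \<beta> then b \<beta>
     else Zer A (Omap u (Dom D (s \<beta>))) (Omap u (Cod D (s \<beta>))) (Deg D (s \<beta>) + 1))"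

lemma extends_ext_truncated: "extends (truncated b k) (ext (truncated b k))"
  by (rule extends_ext) (simp add: truncated_def shifted_def in_Hom_iff)

text \<open>
  The image \<open>r\<close> of \<open>sbar \<alpha>\<close> has to be compatible with the projections to \<open>B\<close> and with the
  differentials; the boundary that \<open>r\<close> must have depends on the values \<open>b \<beta>\<close> of smaller weight only.
\<close>

definition admissible :: "('i \<Rightarrow> 'k) \<Rightarrow> 'i \<Rightarrow> 'k \<Rightarrow> bool" where
  "admissible b \<alpha> r \<longleftrightarrow> (\<alpha> \<in> I \<longrightarrow> r \<in> shifted \<alpha> \<and> Mmap p r = Mmap v (sbar \<alpha>) \<and>
     Diff A r = Sub R A (Sub R A (Mmap u1 (s \<alpha>)) (Mmap u2 (s \<alpha>))) (ext (truncated b (w \<alpha>)) (Diff D (s \<alpha>))))"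

lemma ext_truncated_Diff:
  assumes \<alpha>: "\<alpha> \<in> I" and g: "extends b' g"
    and b': "\<And>\<beta>. \<beta> \<in> I \<Longrightarrow> w \<beta> < w \<alpha> \<Longrightarrow> b' \<beta> = truncated b (w \<alpha>) \<beta>"
  shows "ext (truncated b (w \<alpha>)) (Diff D (s \<alpha>)) = g (Diff D (s \<alpha>))"
proof (rule derivation_eq_weight_below[OF _ _ _ _ weight[OF \<alpha>]])
  show "graded_derivation R D A u1 u2 1 (ext (truncated b (w \<alpha>)))" "graded_derivation R D A u1 u2 1 g"
    using extends_ext_truncated[of b "w \<alpha>"] g by (simp_all add: extends_def)
qed (use extends_ext_truncated[of b "w \<alpha>"] g b' \<alpha> in \<open>simp_all add: extends_def\<close>)

text \<open>
  Let \<open>g\<close> be the derivation with the values chosen so far.  Below the weight of \<open>s \<alpha>\<close> it satisfies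
  \<open>d g + g d = u1 - u2\<close> and \<open>p g = v bar\<close>, since both hold on the generators of smaller weight.
  Applied to \<open>d (s \<alpha>)\<close>, the first identity shows that the prescribed boundary of \<open>r\<close> is a cycle, the
  second that it lies over the boundary of \<open>v (sbar \<alpha>)\<close>.
\<close>

lemma ex_admissible:
  assumes IH: "\<And>\<beta>. w \<beta> < w \<alpha> \<Longrightarrow> admissible b \<beta> (b \<beta>)"
  shows "\<exists>r. admissible b \<alpha> r"
proof (cases "\<alpha> \<in> I")
  case \<alpha>: True
  let ?g = "ext (truncated b (w \<alpha>))"
  have ext: "extends (truncated b (w \<alpha>)) ?g" by (rule extends_ext_truncated)
  interpret g: graded_derivation R D A u1 u2 1 ?g
    using ext by (simp add: extends_def)
  have g_F: "?g (Mmap F c) = Zer A (Omap u (Dom C c)) (Omap u (Cod C c)) (Deg C c + 1)" if "c \<in> Mor C" for c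
    using ext that by (simp add: extends_def)
  have trunc: "truncated b (w \<alpha>) \<beta> = b \<beta>" if "\<beta> \<in> I" "w \<beta> < w \<alpha>" for \<beta>
    using IH[OF that(2)] that by (simp add: admissible_def truncated_def)
  have g_s: "?g (s \<beta>) = b \<beta>" if "\<beta> \<in> I" "w \<beta> < w \<alpha>" for \<beta>
    using ext that trunc by (simp add: extends_def)
  have ds: "Diff D (s \<alpha>) \<in> Mor D" using \<alpha> by simp
  have dA: "graded_derivation R A A id_fun id_fun (- 1) (Diff A)"
    by (rule u.cod.graded_derivation_Diff)
  have Diff_b: "Diff A (b \<beta>) = Sub R A (Sub R A (Mmap u1 (s \<beta>)) (Mmap u2 (s \<beta>))) (?g (Diff D (s \<beta>)))"
    if \<beta>: "\<beta> \<in> I" "w \<beta> < w \<alpha>" for \<beta>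
  proof -
    have "ext (truncated b (w \<beta>)) (Diff D (s \<beta>)) = ?g (Diff D (s \<beta>))"
      using \<beta> by (intro ext_truncated_Diff[OF \<beta>(1) ext]) (simp add: truncated_def)
    then show ?thesis using IH[OF \<beta>(2)] \<beta>(1) by (simp add: admissible_def)
  qed
  have homotopy: "Add A (Diff A (?g (Diff D (s \<alpha>)))) (?g (Diff D (Diff D (s \<alpha>)))) =
      Sub R A (Mmap u1 (Diff D (s \<alpha>))) (Mmap u2 (Diff D (s \<alpha>)))"
  proof (rule derivation_eq_weight_below[OF _ _ _ _ weight[OF \<alpha>]])
    show "graded_derivation R D A u1 u2 0 (\<lambda>x. Add A (Diff A (?g x)) (?g (Diff D x)))"
      using g.graded_derivation_axioms D.graded_derivation_axioms dA
      by (rule graded_derivation_commutator) (simp_all add: Diff_in)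
    show "graded_derivation R D A u1 u2 0 (\<lambda>x. Sub R A (Mmap u1 x) (Mmap u2 x))"
      using u1.graded_functor_axioms u2.graded_functor_axioms by (rule graded_derivation_diff) simp
    fix \<beta> assume \<beta>: "\<beta> \<in> I" "w \<beta> < w \<alpha>"
    then show "Add A (Diff A (?g (s \<beta>))) (?g (Diff D (s \<beta>))) = Sub R A (Mmap u1 (s \<beta>)) (Mmap u2 (s \<beta>))"
      by (simp add: g_s Diff_b Sub_def u.cod.Add_assoc)
  qed (use \<alpha> in \<open>simp_all add: g_F in2_F\<close>)
  have p_g: "Mmap p (?g (Diff D (s \<alpha>))) = Mmap v (bar (Diff D (s \<alpha>)))"
  proof (rule derivation_eq_weight_below[OF _ _ _ _ weight[OF \<alpha>]])
    show "graded_derivation R D B (comp_fun p u1) (comp_fun p u2) 1 (\<lambda>x. Mmap p (?g x))"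
      using g.graded_derivation_axioms gp.graded_functor_axioms by (rule graded_derivation_comp_left)
    show "graded_derivation R D B (comp_fun p u1) (comp_fun p u2) 1 (\<lambda>x. Mmap v (bar x))"
      using graded_derivation_comp_left[OF bar_derivation gv.graded_functor_axioms]
      by (rule graded_derivation_cong) (simp_all add: eq_fun_def incl_in)
    fix \<beta> assume \<beta>: "\<beta> \<in> I" "w \<beta> < w \<alpha>"
    then show "Mmap p (?g (s \<beta>)) = Mmap v (bar (s \<beta>))"
      using IH[OF \<beta>(2)] by (simp add: g_s bar_gen admissible_def)
  qed (use \<alpha> in \<open>simp_all add: g_F bar_F\<close>)
  define z where "z = Sub R A (Sub R A (Mmap u1 (s \<alpha>)) (Mmap u2 (s \<alpha>))) (?g (Diff D (s \<alpha>)))"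
  have z: "z \<in> cycles A (Omap u (Dom D (s \<alpha>))) (Omap u (Cod D (s \<alpha>))) (Deg D (s \<alpha>))"
  proof -
    have "Diff A (?g (Diff D (s \<alpha>))) = Sub R A (Mmap u1 (Diff D (s \<alpha>))) (Mmap u2 (Diff D (s \<alpha>)))"
      using homotopy \<alpha> by simp
    then show ?thesis
      using \<alpha> by (simp add: cycles_def in_Hom_iff z_def Diff_in u.cod.Diff_Sub)
  qed
  have "Mmap p z = Mmap v (Diff Y (sbar \<alpha>))"
    using \<alpha> by (simp add: z_def gp.map_Sub gv.map_Sub p_g Diff_sbar dsbar_def incl_in)
  then have "Diff B (Mmap v (sbar \<alpha>)) = Mmap p z"
    using \<alpha> by simp
  then obtain r where "r \<in> Hom A (Omap u (Dom D (s \<alpha>))) (Omap u (Cod D (s \<alpha>))) (Deg D (s \<alpha>) + 1)"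
    "Mmap p r = Mmap v (sbar \<alpha>)" "Diff A r = z"
    using trivial_fibration_lift[OF fibration quasi_equivalence _ _ z, of "Mmap v (sbar \<alpha>)"] \<alpha>
    by (auto simp: in_Hom_iff)
  then have "admissible b \<alpha> r" by (simp add: admissible_def shifted_def z_def)
  then show ?thesis ..
qed (simp add: admissible_def)

text \<open>
  After the recursion the truncations may be dropped: the derivation that extends all of \<open>b\<close> agrees
  at \<open>d (s \<alpha>)\<close> with the one used in the choice of \<open>b \<alpha>\<close>.
\<close>

lemma ex_compatible_values:
  obtains b where "\<And>\<alpha>. \<alpha> \<in> I \<Longrightarrow> b \<alpha> \<in> shifted \<alpha>" "\<And>\<alpha>. \<alpha> \<in> I \<Longrightarrow> Mmap p (b \<alpha>) = Mmap v (sbar \<alpha>)"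
    "\<And>\<alpha>. \<alpha> \<in> I \<Longrightarrow> Diff A (b \<alpha>) =
      Sub R A (Sub R A (Mmap u1 (s \<alpha>)) (Mmap u2 (s \<alpha>))) (ext b (Diff D (s \<alpha>)))"
proof -
  have "\<exists>b. \<forall>\<alpha>. admissible b \<alpha> (b \<alpha>)"
  proof (rule dependent_wf_choice[where R = "measure w"])
    fix b b' :: "'i \<Rightarrow> 'k" and \<alpha> r
    assume "\<And>\<beta>. (\<beta>, \<alpha>) \<in> measure w \<Longrightarrow> b \<beta> = b' \<beta>"
    then have "truncated b (w \<alpha>) = truncated b' (w \<alpha>)"
      by (auto simp: truncated_def fun_eq_iff)
    then show "admissible b \<alpha> r = admissible b' \<alpha> r" by (simp add: admissible_def)
  next
    fix \<alpha> and b :: "'i \<Rightarrow> 'k"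
    assume "\<And>\<beta>. (\<beta>, \<alpha>) \<in> measure w \<Longrightarrow> admissible b \<beta> (b \<beta>)"
    then show "\<exists>r. admissible b \<alpha> r" by (intro ex_admissible) simp
  qed simp
  then obtain b where b: "\<And>\<alpha>. admissible b \<alpha> (b \<alpha>)" by blast
  have type: "b \<alpha> \<in> shifted \<alpha>" if "\<alpha> \<in> I" for \<alpha>
    using b[of \<alpha>] that by (simp add: admissible_def)
  have "ext (truncated b (w \<alpha>)) (Diff D (s \<alpha>)) = ext b (Diff D (s \<alpha>))" if "\<alpha> \<in> I" for \<alpha>
    using that extends_ext[of b, OF type] by (rule ext_truncated_Diff) (simp_all add: truncated_def type)
  then show ?thesis
    using b by (intro that[of b]) (simp_all add: admissible_def)
qed

text \<open>
  The functor \<open>H\<close> with values \<open>b \<alpha>\<close> at \<open>sbar \<alpha>\<close> satisfies \<open>H bar = g\<close> for the derivation \<open>g\<close> with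
  values \<open>b\<close>; the equation chosen for \<open>d (b \<alpha>)\<close> is therefore compatibility of \<open>H\<close> with the
  differentials at \<open>sbar \<alpha>\<close>.
\<close>

lemma lift:
  obtains H where "dg_functor R Y A H" "eq_fun P (comp_fun H incl) u" "eq_fun Y (comp_fun p H) v"
proof -
  obtain b where b: "\<And>\<alpha>. \<alpha> \<in> I \<Longrightarrow> b \<alpha> \<in> shifted \<alpha>"
    "\<And>\<alpha>. \<alpha> \<in> I \<Longrightarrow> Mmap p (b \<alpha>) = Mmap v (sbar \<alpha>)"
    "\<And>\<alpha>. \<alpha> \<in> I \<Longrightarrow> Diff A (b \<alpha>) =
      Sub R A (Sub R A (Mmap u1 (s \<alpha>)) (Mmap u2 (s \<alpha>))) (ext b (Diff D (s \<alpha>)))"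
    by (rule ex_compatible_values) blast
  have "graded_functor R P A u" by (simp add: gu.graded_functor_axioms)
  then obtain H where H: "graded_functor R Y0 A H" "Omap H = Omap u"
    "\<And>x. x \<in> Mor P \<Longrightarrow> Mmap H (Mmap incl x) = Mmap u x" "\<And>\<alpha>. \<alpha> \<in> I \<Longrightarrow> Mmap H (sbar \<alpha>) = b \<alpha>"
    by (rule Y_free.ex_functor[where b = b]) (use b(1) in \<open>simp_all add: shifted_def\<close>)
  interpret H: graded_functor R Y0 A H by (rule H)
  have H_i: "Mmap H (Mmap i1 x) = Mmap u1 x" "Mmap H (Mmap i2 x) = Mmap u2 x" if "x \<in> Mor D" for x
    using that by (simp_all add: H(3) flip: incl_in)
  have ext: "extends b (ext b)" using b(1) by (rule extends_ext)
  have H_bar: "Mmap H (bar x) = ext b x" if x: "x \<in> Mor D" for x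
  proof (rule D_free.derivation_eqI[OF _ _ _ _ x])
    show "graded_derivation R D A u1 u2 1 (\<lambda>x. Mmap H (bar x))"
      using graded_derivation_comp_left[OF bar_derivation H(1)]
      by (rule graded_derivation_cong) (simp_all add: eq_fun_def H_i H(2))
    show "graded_derivation R D A u1 u2 1 (ext b)" using ext by (simp add: extends_def)
  qed (use ext in \<open>simp_all add: extends_def bar_F bar_gen H(2,4)\<close>)
  have H_Diff: "Mmap H (Diff Y x) = Diff A (Mmap H x)" if x: "x \<in> Mor Y0" for x
  proof (rule cylinder_derivation_eqI[OF _ _ _ _ _ x])
    show "graded_derivation R Y0 A H H (- 1) (\<lambda>x. Mmap H (Diff Y x))"
      using graded_derivation_comp_left[OF Diff_Y_derivation H(1)]
      by (rule graded_derivation_cong) (simp_all add: eq_fun_def)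
    show "graded_derivation R Y0 A H H (- 1) (\<lambda>x. Diff A (Mmap H x))"
      using graded_derivation_comp_right[OF H(1) u.cod.graded_derivation_Diff]
      by (rule graded_derivation_cong) (simp_all add: eq_fun_def)
  next
    fix \<alpha> assume "\<alpha> \<in> I"
    then show "Mmap H (Diff Y (sbar \<alpha>)) = Diff A (Mmap H (sbar \<alpha>))"
      by (simp add: Diff_sbar dsbar_def H.map_Sub H_i H_bar H(4) b(3))
  qed (simp_all add: Diff_i H_i Diff_in)
  have "dg_functor R Y A H"
    using dg_category_Y u.cod.dg_category_axioms
    by (rule dg_functorI) (simp_all add: H(1) H_Diff)
  moreover have "eq_fun P (comp_fun H incl) u"
    using H(2,3) by (simp add: eq_fun_def)
  moreover have "eq_fun Y (comp_fun p H) v"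
  proof -
    have "eq_fun Y0 (comp_fun p H) v"
      using graded_functor_comp[OF H(1) gp.graded_functor_axioms] gv.graded_functor_axioms
      by (rule Y_free.functor_eqI) (use H(3) in \<open>simp_all add: H(2,4) b(2)\<close>)
    then show ?thesis by (simp add: eq_fun_def)
  qed
  ultimately show ?thesis by (rule that)
qed

end

section \<open>The cylinder is a good cylinder object\<close>

context free_dg_under
begin

lemma left_lifting_incl:
  fixes A :: "('a, 'q, 'k) dgcat" and B :: "('a, 'r, 'l) dgcat"
  assumes "cofibrant_over C D F I s" "fibration R A B p" "quasi_equivalence R A B p"
  shows "left_lifting R P Y incl A B p"
  unfolding left_lifting_def
proof (intro allI impI)
  fix u v
  assume uv: "dg_functor R P A u" "dg_functor R Y B v"
    and square: "eq_fun P (comp_fun p u) (comp_fun v incl)"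
  obtain w :: "'i \<Rightarrow> nat" where w: "\<forall>\<alpha>\<in>I. weight_below C D F I s w (w \<alpha>) (Dom D (s \<alpha>)) (Cod D (s \<alpha>))
      (Deg D (s \<alpha>) - 1) (Diff D (s \<alpha>))"
    using assms(1) by (auto simp: cofibrant_over_def)
  have p: "dg_functor R A B p" using assms(2) by (simp add: fibration_def)
  interpret cylinder_lifting R C D F I s A B p u v w
    by (intro cylinder_lifting.intro cylinder_lifting_axioms.intro free_dg_under_axioms uv p assms square)
      (use w in blast)
  show "\<exists>h. dg_functor R Y A h \<and> eq_fun P (comp_fun h incl) u \<and> eq_fun Y (comp_fun p h) v"
    using lift by blast
qed

theorem good_cylinder_relative_cylinder:
  assumes "cofibrant_over C D F I s"
  shows "good_cylinder TYPE('q \<times> 'k \<times> 'r \<times> 'l) R C D F Y (cyl_unit R C D F I s) incl proj"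
proof -
  have "under_functor R C P (comp_fun in1 F) Y (cyl_unit R C D F I s) incl"
    unfolding under_functor_def cyl_unit_def
    using dg_functor_comp[OF dg_functor_axioms dg_functor_in1]
      dg_functor_comp[OF dg_functor_axioms dg_functor_i1] dg_functor_incl
    by (simp add: eq_fun_def incl_in)
  moreover have "under_functor R C Y (cyl_unit R C D F I s) D F proj"
    unfolding under_functor_def cyl_unit_def
    using dg_functor_comp[OF dg_functor_axioms dg_functor_i1] dg_functor_axioms dg_functor_proj
    by (simp add: eq_fun_def)
  moreover have "eq_fun P (comp_fun proj incl) cod"
    by (simp add: eq_fun_def)
  moreover have "cofibration TYPE('q \<times> 'k \<times> 'r \<times> 'l) R P Y incl"
    unfolding cofibration_def using dg_functor_incl left_lifting_incl[OF assms] by blast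
  ultimately show ?thesis
    unfolding good_cylinder_def Let_def using quasi_equivalence_proj by blast
qed

end

theorem proposition2p4:
  fixes R :: "'a ring"
    and C :: "('a, 'o, 'm) dgcat"
    and D :: "('a, 'o, 'n) dgcat"
    and F :: "('o, 'm, 'o, 'n) dgfun"
    and I :: "'i set"
    and s :: "'i \<Rightarrow> 'n"
  assumes "cring R"
    and "dg_category R C" and "dg_category R D"
    and "flat_category R C" and "flat_category R D"
    and "dg_functor R C D F"
    and "Obj C = Obj D" and "\<forall>x\<in>Obj C. Omap F x = x"
    and "freely_generated R C D F I s"
    and "cofibrant_over C D F I s"
  shows "good_cylinder TYPE('q \<times> 'k \<times> 'r \<times> 'l) R C D F
           (relative_cylinder R C D F I s)
           (cyl_unit R C D F I s) (cyl_incl R C D F I s) (cyl_proj D s)"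
proof -
  interpret free_dg_under R C D F I s
    using assms by (intro free_dg_under.intro dg_under.intro dg_under_axioms.intro
        free_dg_under_axioms.intro) auto
  show ?thesis using assms(10) by (rule good_cylinder_relative_cylinder)
qed

end
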